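(* Let $m,n\ge1$ and $k\ge2$ be integers, let $1<p_i<\infty$ for $i=1,\dots,m$, and let $p$ be defined by $\frac1p=\sum_{i=1}^m\frac1{p_i}$. Let $p<q<\infty$ and $0<\alpha_1,\dots,\alpha_k<mn$. Suppose that $u$ and $w_1,\dots,w_m$ are a.e. positive functions on $\mathbb{R}^{kn}$ such that $u^q,w_1^{p_1},\dots,w_m^{p_m}$ are weights, that the $w_i$ are of product type: $w_i(x^{(1)},\dots,x^{(k)})=w_i^{(1)}(x^{(1)})\cdots w_i^{(k)}(x^{(k)})$, $i=1,\dots,m$, where $w_i^{(1)},\dots,w_i^{(k)}$ are a.e. positive functions defined on $\mathbb{R}^n$, and that $\big(w_i^{(1)}\big)^{-p_i'},\dots,\big(w_i^{(k)}\big)^{-p_i'}\in RD(\mathbb{R}^n)$ for $i=1,\dots,m$. Suppose that $u^q$ satisfies the $A_\infty(\mathbb{R}^n)$ condition in each variable $x^{(j)}\in\mathbb{R}^n$ separately, uniformly with respect to the other variables. Then there is a constant $c>0$ such that the inequality $$\|u\, \mathcal{I}_{\alpha_1, \dots, \alpha_k}(\overrightarrow{f})\|_{L^q(\mathbb{R}^{kn})} \leq c\prod_{i=1}^{m} \|w_if_i \|_{L^{p_i}(\mathbb{R}^{kn})}$$ holds for all $\overrightarrow{f}=(f_1,\dots,f_m)\in L^{p_1}_{w_1^{p_1}}(\mathbb{R}^{kn})\times\cdots\times L^{p_m}_{w_m^{p_m}}(\mathbb{R}^{kn})$ if and only if $$\sup_{Q_1,\dots, Q_k \in \mathcal{Q}}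 |Q_1|^{\alpha_1/n-m} \cdots |Q_k|^{\alpha_k/n-m} \bigg( \int_{Q_1\times\cdots \times Q_k} u^{q}(x)\, dx \bigg)^{1/q} \prod_{i=1}^m \bigg( \int_{Q_1 \times \cdots \times Q_k} w_i^{-p'_i}(y_i)\, dy_i \bigg)^{1/p'_i}< \infty.$$
   Context: $p_i'=p_i/(p_i-1)$. $\mathcal{Q}$ is the family of all cubes in $\mathbb{R}^n$ with sides parallel to the coordinate axes, and $|Q|$ is the volume of $Q$. A weight is an a.e. positive, locally integrable function. For a weight $\rho$ and $0<r<\infty$, $L^r_\rho$ is the class of measurable $f$ with $\|f\|_{L^r_\rho}=\big(\int|f|^r\rho\,dx\big)^{1/r}<\infty$. Points of $\mathbb{R}^{kn}$ are written $x=(x^{(1)},\dots,x^{(k)})$ with $x^{(j)}\in\mathbb{R}^n$. The multilinear Riesz potential operator with product kernels is $$\mathcal{I}_{\alpha_1, \dots, \alpha_k} (\overrightarrow{f})(x^{(1)}, \dots, x^{(k)})= \int_{ (\mathbb{R}^{kn})^m }\frac{ \prod_{i=1}^m f_i (y^{(1)}_i,\dots, y^{(k)}_i)}{ \prod_{s=1}^k \big(\sum_{i=1}^m |x^{(s)}-y_i^{(s)}|\big)^{mn-\alpha_s} }\, dy_1\cdots dy_m,$$ where $y_i=(y_i^{(1)},\dots,y_i^{(k)})\in\mathbb{R}^{kn}$. A weight $\rho$ on $\mathbb{R}^n$ satisfies the reverse doubling condition ($\rho\in RD(\mathbb{R}^n)$) if there is a constant $d>1$ such that $d\,\rho(Q')\le\rho(Q)$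 for all cubes $Q\in\mathcal{Q}$ and all $Q'$ that are one of the $2^n$ equal subcubes arising by dividing $Q$ into $2^n$ equal parts, where $\rho(E)=\int_E\rho\,dx$. $A_\infty(\mathbb{R}^n)=\bigcup_{r\ge1}A_r(\mathbb{R}^n)$, where $A_r(\mathbb{R}^n)$ is the Muckenhoupt class of weights $\rho$ with $\sup_{Q\in\mathcal{Q}}\big(\frac1{|Q|}\int_Q\rho\big)^{1/r}\big(\frac1{|Q|}\int_Q\rho^{1-r'}\big)^{1/r'}<\infty$ (for $r=1$ the second factor is understood as $(\inf_Q\rho)^{-1}$, the essential infimum). A weight $v$ on $\mathbb{R}^{kn}$ satisfies $A_\infty(\mathbb{R}^n)$ in each variable separately, uniformly with respect to the others, if for each $j\in\{1,\dots,k\}$ there is $r<\infty$ such that for a.e. choice of the remaining variables $x^{(l)}$, $l\neq j$, the function $x^{(j)}\mapsto v(x^{(1)},\dots,x^{(k)})$ belongs to $A_r(\mathbb{R}^n)$ with $A_r$ constant bounded independently of the remaining variables. *)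

theory Defs
  imports "HOL-Analysis.Analysis"
begin

text \<open>
  \<open>\<real>\<^sup>n\<close> is \<open>real ^ 'n\<close>, \<open>\<real>\<^sup>k\<^sup>n\<close> is \<open>real ^ 'n ^ 'k\<close> (so \<open>x $ s\<close> is the block \<open>x\<^sup>(\<^sup>s\<^sup>)\<close>), and
  \<open>(\<real>\<^sup>k\<^sup>n)\<^sup>m\<close> is \<open>real ^ 'n ^ 'k ^ 'm\<close>.
\<close>

text \<open>Real powers on \<open>[0,\<infinity>]\<close>, for exponents \<open>a > 0\<close> only.\<close>

definition epow :: "ennreal \<Rightarrow> real \<Rightarrow> ennreal" where
  "epow z a = (if z = \<infinity> then \<infinity> else ennreal (enn2real z powr a))"

definition conj_exp :: "real \<Rightarrow> real" where
  "conj_exp r = r / (r - 1)"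

definition wnorm :: "real \<Rightarrow> ('a::euclidean_space \<Rightarrow> real) \<Rightarrow> ('a \<Rightarrow> real) \<Rightarrow> ennreal" where
  "wnorm r \<rho> f = epow (\<integral>\<^sup>+ x. ennreal (\<bar>f x\<bar> powr r * \<rho> x) \<partial>lebesgue) (1 / r)"

abbreviation lnorm :: "real \<Rightarrow> ('a::euclidean_space \<Rightarrow> real) \<Rightarrow> ennreal" where
  "lnorm r f \<equiv> wnorm r (\<lambda>_. 1) f"

definition wLp :: "real \<Rightarrow> ('a::euclidean_space \<Rightarrow> real) \<Rightarrow> ('a \<Rightarrow> real) set" where
  "wLp r \<rho> = {f \<in> borel_measurable lebesgue. wnorm r \<rho> f < \<infinity>}"

definition ae_positive :: "('a::euclidean_space \<Rightarrow> real) \<Rightarrow> bool" where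
  "ae_positive \<rho> \<longleftrightarrow> (AE x in lebesgue. 0 < \<rho> x)"

definition weight :: "('a::euclidean_space \<Rightarrow> real) \<Rightarrow> bool" where
  "weight \<rho> \<longleftrightarrow> \<rho> \<in> borel_measurable lebesgue \<and> ae_positive \<rho> \<and>
     (\<forall>K. compact K \<longrightarrow> set_integrable lebesgue K \<rho>)"

definition cube :: "real ^ 'n \<Rightarrow> real \<Rightarrow> (real ^ 'n::finite) set" where
  "cube a l = cbox a (\<chi> i. a $ i + l)"

definition cubes :: "(real ^ 'n::finite) set set" where
  "cubes = {cube a l | a l. 0 < l}"

text \<open>The set \<open>S\<close> of coordinates selects one of the \<open>2\<^sup>n\<close> equal subcubes of \<open>cube a l\<close>.\<close>

definition subcube :: "real ^ 'n \<Rightarrow> real \<Rightarrow> 'n set \<Rightarrow> (real ^ 'n::finite) set" where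
  "subcube a l S = cube (\<chi> i. if i \<in> S then a $ i + l / 2 else a $ i) (l / 2)"

definition reverse_doubling :: "(real ^ 'n::finite \<Rightarrow> real) \<Rightarrow> bool" where
  "reverse_doubling \<rho> \<longleftrightarrow> weight \<rho> \<and>
     (\<exists>d>1. \<forall>a l S. 0 < l \<longrightarrow>
        d * (LINT x:subcube a l S|lebesgue. \<rho> x) \<le> (LINT x:cube a l|lebesgue. \<rho> x))"

definition ess_inf_on :: "(real ^ 'n::finite) set \<Rightarrow> (real ^ 'n \<Rightarrow> real) \<Rightarrow> ennreal" where
  "ess_inf_on Q \<rho> = Sup {c. AE x in lebesgue. x \<in> Q \<longrightarrow> c \<le> ennreal (\<rho> x)}"

definition average :: "(real ^ 'n::finite) set \<Rightarrow> (real ^ 'n \<Rightarrow> real) \<Rightarrow> ennreal" where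
  "average Q \<rho> = (\<integral>\<^sup>+ x\<in>Q. ennreal (\<rho> x) \<partial>lebesgue) / emeasure lebesgue Q"

definition Ar_const :: "real \<Rightarrow> (real ^ 'n::finite \<Rightarrow> real) \<Rightarrow> ennreal" where
  "Ar_const r \<rho> = (SUP Q\<in>cubes. epow (average Q \<rho>) (1 / r) *
     (if r = 1 then inverse (ess_inf_on Q \<rho>)
      else epow (average Q (\<lambda>x. \<rho> x powr (1 - conj_exp r))) (1 / conj_exp r)))"

definition Muckenhoupt :: "real \<Rightarrow> (real ^ 'n::finite \<Rightarrow> real) \<Rightarrow> bool" where
  "Muckenhoupt r \<rho> \<longleftrightarrow> weight \<rho> \<and> Ar_const r \<rho> < \<infinity>"

text \<open>
  The remaining variables are a family \<open>y\<close> indexed by \<open>UNIV - {j}\<close>. The product measure below is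
  Lebesgue measure on their space up to completion, which does not affect the null sets in \<open>AE\<close>.
\<close>

definition slice :: "(real ^ 'n ^ 'k \<Rightarrow> real) \<Rightarrow> 'k \<Rightarrow> ('k \<Rightarrow> real ^ 'n) \<Rightarrow> real ^ 'n::finite \<Rightarrow> real"
  where "slice v j y t = v (\<chi> l. if l = j then t else y l)"

definition A_infty_separately :: "(real ^ 'n::finite ^ 'k::finite \<Rightarrow> real) \<Rightarrow> bool" where
  "A_infty_separately v \<longleftrightarrow>
     (\<forall>j. \<exists>r\<ge>1. \<exists>C<\<infinity>. AE y in (\<Pi>\<^sub>M l\<in>UNIV - {j}. (lborel :: (real ^ 'n) measure)).
        Muckenhoupt r (slice v j y) \<and> Ar_const r (slice v j y) \<le> C)"

text \<open>
  The kernel is only singular on a null set of \<open>y\<close>, where the quotient takes the value \<open>0\<close>.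
\<close>

definition riesz_integrand ::
    "('k \<Rightarrow> real) \<Rightarrow> ('m \<Rightarrow> real ^ 'n ^ 'k \<Rightarrow> real) \<Rightarrow> real ^ 'n ^ 'k
      \<Rightarrow> real ^ 'n::finite ^ 'k::finite ^ 'm::finite \<Rightarrow> real" where
  "riesz_integrand \<alpha> f x y =
     (\<Prod>i\<in>UNIV. f i (y $ i)) /
     (\<Prod>s\<in>UNIV. (\<Sum>i\<in>UNIV. norm (x $ s - y $ i $ s)) powr
        (real CARD('m) * real CARD('n) - \<alpha> s))"

definition riesz ::
    "('k::finite \<Rightarrow> real) \<Rightarrow> ('m::finite \<Rightarrow> real ^ 'n::finite ^ 'k \<Rightarrow> real) \<Rightarrow> real ^ 'n ^ 'k \<Rightarrow> real" where
  "riesz \<alpha> f x = (LINT y|lebesgue. riesz_integrand \<alpha> f x y)"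

text \<open>
  \<open>riesz\<close> is the Bochner integral, which is \<open>0\<close> by convention when it does not converge
  absolutely. An inequality for \<open>riesz\<close> therefore also has to assert convergence; otherwise a
  divergent potential (equal to \<open>\<infinity>\<close> for nonnegative \<open>f\<close>) would satisfy it vacuously.
\<close>

definition riesz_converges_ae ::
    "('k::finite \<Rightarrow> real) \<Rightarrow> ('m::finite \<Rightarrow> real ^ 'n::finite ^ 'k \<Rightarrow> real) \<Rightarrow> bool" where
  "riesz_converges_ae \<alpha> f \<longleftrightarrow> (AE x in lebesgue. integrable lebesgue (riesz_integrand \<alpha> f x))"

definition block_prod :: "('k \<Rightarrow> (real ^ 'n) set) \<Rightarrow> (real ^ 'n ^ 'k::finite) set" where
  "block_prod Q = {x. \<forall>s. x $ s \<in> Q s}"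

end

(*
  Write v = u^q and sigma_i = w_i^(-p_i'). All these weights are reverse doubling in each variable
  separately: for sigma_i by the product structure, for v because the A_infinity condition gives the
  complement of a subcube a fixed share of the mass, uniformly in the other variables.

  Sufficiency. By the one third trick the kernel is dominated by a sum over the rectangles R of
  finitely many dyadic product grids, so that it is enough to bound
  F = sum_R c_R (prod_i int_R f_i) 1_R in L^q(v), with constants independent of the grid. The
  hypothesis gives F <= A sum_R b_R v(R)^(-1/q) 1_R with
  b_R = prod_i sigma_i(R)^(-1/p_i') int_R f_i. In one variable, if sum_R b_R^s <= 1 and s < q, then
  b_R <= min(1, (S v(R))^(1/s)) with S = sum_{R containing x} b_R^s / v(R), and since the v(R) grow
  geometrically along the cubes containing x, a Hedberg type splitting of the sum gives F^q <= C S
  pointwise; integrating, ||F||_{L^q(v)} <= C (sum_R b_R^s)^(1/s). Minkowski's inequality carries this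
  to several variables. The same estimate for sigma_i, dualized, is a Carleson embedding which
  bounds sum_R b_R^s for p < s < q.

  Necessity. Test the inequality on f_i = sigma_i 1_R.
*)
theory Submission
  imports Defs
begin

section \<open>Finite sums\<close>

text \<open>The weight \<open>u^q\<close> is not a product, so a one-variable bound cannot be
  tensored, and a Hedberg argument would ordinarily call for a maximal theorem over rectangles for
  this weight. That is avoided: the pointwise majorant is the sum \<open>S\<close>, whose integral
  is computed exactly, and the variables are treated one at a time. Freezing variables works because
  reverse doubling in one variable is a linear inequality in the weight, so it survives integration
  over the others. The exponent \<open>s\<close> between \<open>p0\<close> and \<open>q\<close> has
  to meet two demands. The bound for \<open>u^q\<close> needs \<open>s < q\<close>. Hoelder's
  inequality with exponents \<open>p i / p0\<close> leaves the power \<open>s * p i / p0\<close>,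
  and the embedding for the \<open>i\<close>-th weight needs this to exceed \<open>p i\<close>, that
  is \<open>s > p0\<close>. The numbers \<open>p0\<close>, \<open>s\<close>, \<open>q\<close> may
  lie below 1. All estimates are proved for finite sums, over grids cut off at mesh
  \<open>2^-N\<close> and top scale \<open>2^N\<close>, with constants independent of
  \<open>N\<close>. Fatou's lemma then reaches the potential, and the finiteness of the limit almost
  everywhere is what proves absolute convergence.\<close>

lemma weighted_arith_geom_mean:
  fixes x :: "'a \<Rightarrow> real"
  assumes "finite S" and \<theta>: "\<And>i. i \<in> S \<Longrightarrow> \<theta> i > 0" "sum \<theta> S = 1"
    and x: "\<And>i. i \<in> S \<Longrightarrow> x i \<ge> 0"
  shows "(\<Prod>i\<in>S. x i powr \<theta> i) \<le> (\<Sum>i\<in>S. \<theta> i * x i)"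
proof (cases "\<exists>i\<in>S. x i = 0")
  case True
  then have "(\<Prod>i\<in>S. x i powr \<theta> i) = 0"
    by (auto simp: \<open>finite S\<close> intro!: prod_zero)
  then show ?thesis
    using x \<theta>(1) by (simp add: sum_nonneg less_imp_le)
next
  case False
  have pos: "x i > 0" if "i \<in> S" for i
    using False x[OF that] that by (metis less_eq_real_def)
  have "S \<noteq> {}" using \<theta> by auto
  have "ln (\<Sum>i\<in>S. \<theta> i *\<^sub>R x i) \<ge> (\<Sum>i\<in>S. \<theta> i * ln (x i))"
  proof (intro concave_on_sum[of S "{0<..}"])
    show "\<theta> i \<ge> 0" if "i \<in> S" for i using \<theta>(1)[OF that] by simp
  qed (use \<open>finite S\<close> \<open>S \<noteq> {}\<close> \<theta>(2) pos ln_concave in auto)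
  moreover have "(\<Sum>i\<in>S. \<theta> i *\<^sub>R x i) > 0"
    using \<open>finite S\<close> \<open>S \<noteq> {}\<close> \<theta>(1) pos by (intro sum_pos) auto
  ultimately have "exp (\<Sum>i\<in>S. \<theta> i * ln (x i)) \<le> (\<Sum>i\<in>S. \<theta> i *\<^sub>R x i)"
    using ln_ge_iff by blast
  moreover have "exp (\<Sum>i\<in>S. \<theta> i * ln (x i)) = (\<Prod>i\<in>S. x i powr \<theta> i)"
    unfolding exp_sum[OF \<open>finite S\<close>] using pos by (intro prod.cong refl) (force simp: powr_def)
  ultimately show ?thesis by simp
qed

text \<open>Dividing each \<open>a i\<close> by its total \<open>A i\<close> reduces every term to
  the weighted mean inequality, and the right sides then add up to
  \<open>sum \<theta> I = 1\<close>. A vanishing total is set apart because one cannot divide by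
  it.\<close>

lemma Holder_inequality_sum:
  fixes a :: "'i \<Rightarrow> 'a \<Rightarrow> real"
  assumes I: "finite I" and X: "finite X"
    and \<theta>: "\<And>i. i \<in> I \<Longrightarrow> \<theta> i > 0" "sum \<theta> I = 1"
    and a: "\<And>i x. i \<in> I \<Longrightarrow> x \<in> X \<Longrightarrow> a i x \<ge> 0"
  shows "(\<Sum>x\<in>X. \<Prod>i\<in>I. a i x powr \<theta> i) \<le> (\<Prod>i\<in>I. (\<Sum>x\<in>X. a i x) powr \<theta> i)"
proof (cases "\<exists>i\<in>I. (\<Sum>x\<in>X. a i x) = 0")
  case True
  then obtain i where i: "i \<in> I" "(\<Sum>x\<in>X. a i x) = 0" by auto
  then have "a i x = 0" if "x \<in> X" for x
    using sum_nonneg_eq_0_iff[OF X, of "a i"] a that by auto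
  then have "(\<Sum>x\<in>X. \<Prod>i\<in>I. a i x powr \<theta> i) = 0"
    using i I by (intro sum.neutral ballI prod_zero) auto
  then show ?thesis by (simp add: prod_nonneg)
next
  case False
  define A where "A i = (\<Sum>x\<in>X. a i x)" for i
  have A: "A i > 0" if "i \<in> I" for i
    using False that a sum_nonneg[of X "a i"] unfolding A_def by force
  define P where "P = (\<Prod>i\<in>I. A i powr \<theta> i)"
  have P: "P \<ge> 0" by (simp add: P_def prod_nonneg)
  have "(\<Prod>i\<in>I. a i x powr \<theta> i) \<le> P * (\<Sum>i\<in>I. \<theta> i * (a i x / A i))" if x: "x \<in> X" for x
  proof -
    have "(\<Prod>i\<in>I. a i x powr \<theta> i) = (\<Prod>i\<in>I. A i powr \<theta> i * (a i x / A i) powr \<theta> i)"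
    proof (rule prod.cong)
      fix i assume "i \<in> I"
      then show "a i x powr \<theta> i = A i powr \<theta> i * (a i x / A i) powr \<theta> i"
        using A[of i] a[of i x] x by (simp add: powr_mult[symmetric])
    qed simp
    also have "\<dots> = P * (\<Prod>i\<in>I. (a i x / A i) powr \<theta> i)"
      by (simp add: prod.distrib P_def)
    also have "\<dots> \<le> P * (\<Sum>i\<in>I. \<theta> i * (a i x / A i))"
      by (intro mult_left_mono weighted_arith_geom_mean P I \<theta>)
        (use A a x in \<open>auto intro!: divide_nonneg_nonneg simp: less_imp_le\<close>)
    finally show ?thesis .
  qed
  then have "(\<Sum>x\<in>X. \<Prod>i\<in>I. a i x powr \<theta> i) \<le> (\<Sum>x\<in>X. P * (\<Sum>i\<in>I. \<theta> i * (a i x / A i)))"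
    by (rule sum_mono)
  also have "\<dots> = P * (\<Sum>i\<in>I. \<theta> i * ((\<Sum>x\<in>X. a i x) / A i))"
    unfolding sum_divide_distrib sum_distrib_left by (rule sum.swap)
  also have "\<dots> = P * (\<Sum>i\<in>I. \<theta> i)"
    by (intro arg_cong[where f="\<lambda>x. P * x"] sum.cong refl) (use A in \<open>force simp: A_def\<close>)
  finally show ?thesis by (simp add: \<theta> P_def A_def)
qed

lemma Holder_inequality_sum2:
  fixes a b :: "'a \<Rightarrow> real"
  assumes X: "finite X" and \<theta>: "0 < \<theta>" "\<theta> < 1"
    and a: "\<And>x. x \<in> X \<Longrightarrow> a x \<ge> 0" and b: "\<And>x. x \<in> X \<Longrightarrow> b x \<ge> 0"
  shows "(\<Sum>x\<in>X. a x powr \<theta> * b x powr (1 - \<theta>)) \<le> (\<Sum>x\<in>X. a x) powr \<theta> * (\<Sum>x\<in>X. b x) powr (1 - \<theta>)"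
proof -
  have "(\<Sum>x\<in>X. \<Prod>i\<in>(UNIV::bool set). (if i then a x else b x) powr (if i then \<theta> else 1 - \<theta>))
    \<le> (\<Prod>i\<in>UNIV. (\<Sum>x\<in>X. (if i then a x else b x)) powr (if i then \<theta> else 1 - \<theta>))"
    by (rule Holder_inequality_sum) (use assms in \<open>auto simp: UNIV_bool\<close>)
  then show ?thesis by (simp add: UNIV_bool mult.commute)
qed

lemma Holder_exponent_pos:
  fixes p :: "'m::finite \<Rightarrow> real"
  assumes p: "\<And>i. 1 < p i" and p0: "1 / p0 = (\<Sum>i\<in>UNIV. 1 / p i)"
  shows "p0 > 0"
proof -
  have "(\<Sum>i\<in>UNIV. 1 / p i) > 0" using p by (intro sum_pos) (auto intro: less_trans[of 0 1])
  then show ?thesis using p0 by (metis zero_less_divide_1_iff)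
qed

text \<open>One factor of \<open>S y powr \<tau>\<close> is expanded as a sum over \<open>k\<close>,
  and Hoelder's inequality is applied for each \<open>k\<close> with \<open>\<tau>\<close> and its
  conjugate. The power of \<open>T\<close> that comes out is cancelled against the left side, hence
  the separate case \<open>T = 0\<close>.\<close>

lemma Minkowski_inequality_sum:
  fixes A :: "'q \<Rightarrow> 'y \<Rightarrow> real"
  assumes Y: "finite Y" and \<tau>: "\<tau> > 1"
    and A: "\<And>k y. k \<in> K \<Longrightarrow> y \<in> Y \<Longrightarrow> A k y \<ge> 0"
  shows "(\<Sum>y\<in>Y. (\<Sum>k\<in>K. A k y) powr \<tau>) \<le> (\<Sum>k\<in>K. (\<Sum>y\<in>Y. A k y powr \<tau>) powr (1 / \<tau>)) powr \<tau>"
proof -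
  define S where "S y = (\<Sum>k\<in>K. A k y)" for y
  define T where "T = (\<Sum>y\<in>Y. S y powr \<tau>)"
  define N where "N = (\<Sum>k\<in>K. (\<Sum>y\<in>Y. A k y powr \<tau>) powr (1 / \<tau>))"
  have S: "S y \<ge> 0" if "y \<in> Y" for y unfolding S_def using A that by (auto intro: sum_nonneg)
  have T: "T \<ge> 0" unfolding T_def by (auto intro: sum_nonneg)
  have "T \<le> N * T powr (1 - 1 / \<tau>)"
  proof -
    have "T = (\<Sum>y\<in>Y. \<Sum>k\<in>K. A k y * S y powr (\<tau> - 1))"
      unfolding T_def
    proof (intro sum.cong refl)
      fix y assume "y \<in> Y"
      have "S y powr \<tau> = S y * S y powr (\<tau> - 1)"
        using S[OF \<open>y \<in> Y\<close>] \<tau> powr_mult_base[of "S y" "\<tau> - 1"] by simp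
      then show "S y powr \<tau> = (\<Sum>k\<in>K. A k y * S y powr (\<tau> - 1))"
        by (subst (asm) (2) S_def) (simp add: sum_distrib_right)
    qed
    also have "\<dots> = (\<Sum>k\<in>K. \<Sum>y\<in>Y. (A k y powr \<tau>) powr (1/\<tau>) * (S y powr \<tau>) powr (1 - 1/\<tau>))"
      unfolding sum.swap[of _ Y]
    proof (intro sum.cong refl arg_cong2[where f="(*)"])
      fix k y assume *: "k \<in> K" "y \<in> Y"
      show "A k y = (A k y powr \<tau>) powr (1/\<tau>)"
        using A[OF *] \<tau> by (simp add: powr_powr)
      show "S y powr (\<tau> - 1) = (S y powr \<tau>) powr (1 - 1/\<tau>)"
        using \<tau> by (simp add: powr_powr algebra_simps)
    qed
    also have "\<dots> \<le> (\<Sum>k\<in>K. (\<Sum>y\<in>Y. A k y powr \<tau>) powr (1/\<tau>) * (\<Sum>y\<in>Y. S y powr \<tau>) powr (1 - 1/\<tau>))"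
      by (intro sum_mono Holder_inequality_sum2 Y) (use \<tau> in auto)
    finally show ?thesis by (simp add: N_def T_def sum_distrib_right)
  qed
  have N: "N \<ge> 0" unfolding N_def by (auto intro: sum_nonneg)
  show ?thesis
  proof (cases "T = 0")
    case True
    then show ?thesis by (simp add: T_def S_def)
  next
    case False
    with T have "T > 0" by simp
    have "T powr (1/\<tau>) * T powr (1 - 1/\<tau>) \<le> N * T powr (1 - 1 / \<tau>)"
      using \<open>T \<le> _\<close> \<open>T > 0\<close> by (simp add: powr_add[symmetric])
    then have "T powr (1/\<tau>) \<le> N" using \<open>T > 0\<close> by simp
    then have "(T powr (1/\<tau>)) powr \<tau> \<le> N powr \<tau>"
      using \<tau> by (intro powr_mono2) auto
    then show ?thesis using \<tau> \<open>T > 0\<close> by (simp add: powr_powr T_def S_def N_def)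
  qed
qed

text \<open>Telescoping: from \<open>x\<close> to \<open>D * x\<close> the increasing function
  \<open>\<phi> x = x / (1 + x)\<close> grows by
  \<open>(D - 1) * x / ((1 + D * x) * (1 + x))\<close>, at least a fixed multiple of
  \<open>min x (1 / x)\<close>, while its total growth is at most 1. This replaces a splitting of
  the sequence where it passes 1.\<close>

lemma sum_min_inverse_le:
  fixes m :: "nat \<Rightarrow> real"
  assumes D: "D > 1" and m: "\<And>j. j \<le> L \<Longrightarrow> m j > 0" and g: "\<And>j. j < L \<Longrightarrow> D * m j \<le> m (Suc j)"
  shows "(\<Sum>j\<le>L. min (m j) (1 / m j)) \<le> 2 * (D + 1) / (D - 1) + 1"
proof -
  \<comment> \<open>The product \<open>(1 + D * x) * (1 + x)\<close> is at most
    \<open>2 * (D + 1)\<close> for \<open>x \<le> 1\<close>, and at most that times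
    \<open>x^2\<close> for \<open>x > 1\<close>; the denominator \<open>D - 1\<close> comes from the
    increment of \<open>\<phi>\<close>.\<close>
  define K where "K = 2 * (D + 1) / (D - 1)"
  define \<phi> where "\<phi> x = x / (1 + x)" for x :: real
  have mono: "\<phi> x \<le> \<phi> y" if "0 < x" "x \<le> y" for x y
    using that by (simp add: \<phi>_def divide_simps) (simp add: algebra_simps)
  have K: "K > 0" using D by (simp add: K_def)
  have step: "min x (1 / x) \<le> K * (\<phi> (D * x) - \<phi> x)" if "x > 0" for x
  proof -
    have pos: "0 < (1 + D * x) * (1 + x)" using that D by (simp add: add_pos_pos)
    have "K * (\<phi> (D * x) - \<phi> x) = 2 * (D + 1) * x / ((1 + D * x) * (1 + x))"
    proof -
      have "\<phi> (D * x) - \<phi> x = (D - 1) * x / ((1 + D * x) * (1 + x))"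
        using that D pos unfolding \<phi>_def by (simp add: diff_frac_eq add_pos_pos less_imp_neq[symmetric] algebra_simps)
      then show ?thesis using D by (simp add: K_def)
    qed
    moreover have "min x (1 / x) * ((1 + D * x) * (1 + x)) \<le> 2 * (D + 1) * x"
    proof (cases "x \<le> 1")
      case True
      have "(1 + D * x) * (1 + x) \<le> (1 + D) * 2"
        using True that D by (intro mult_mono) auto
      then have "x * ((1 + D * x) * (1 + x)) \<le> x * ((1 + D) * 2)" using that by simp
      moreover have "min x (1 / x) = x" using True that by (simp add: min_def divide_simps) (smt (verit) mult_left_le)
      ultimately show ?thesis by (simp add: algebra_simps)
    next
      case False
      have "(1 + D * x) * (1 + x) \<le> ((1 + D) * x) * (2 * x)"
        using False D by (intro mult_mono) (auto simp: algebra_simps)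
      then have "(1 / x) * ((1 + D * x) * (1 + x)) \<le> (1 / x) * (((1 + D) * x) * (2 * x))"
        using that by (intro mult_left_mono) auto
      moreover have "min x (1 / x) = 1 / x"
        using False by (simp add: min_def divide_simps) (smt (verit) mult_le_cancel_right1)
      ultimately show ?thesis using that by (simp add: algebra_simps)
    qed
    ultimately show ?thesis using pos by (simp add: pos_le_divide_eq)
  qed
  have "(\<Sum>j<L'. min (m j) (1 / m j)) \<le> K * \<phi> (m L')" if "L' \<le> L" for L'
    using that
  proof (induction L')
    case 0
    then show ?case using m[of 0] K by (simp add: \<phi>_def)
  next
    case (Suc L')
    have "(\<Sum>j<Suc L'. min (m j) (1 / m j)) \<le> K * \<phi> (m L') + K * (\<phi> (D * m L') - \<phi> (m L'))"
      using Suc step[of "m L'"] m[of L'] by simp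
    also have "\<dots> = K * \<phi> (D * m L')" by (simp add: algebra_simps)
    also have "\<dots> \<le> K * \<phi> (m (Suc L'))"
      using g[of L'] m[of L'] K D Suc.prems by (intro mult_left_mono mono) auto
    finally show ?case .
  qed
  from this[of L] have "(\<Sum>j<L. min (m j) (1 / m j)) \<le> K * \<phi> (m L)" by simp
  also have "\<dots> \<le> K * 1" using m[of L] K by (intro mult_left_mono) (auto simp: \<phi>_def)
  finally have "(\<Sum>j<L. min (m j) (1 / m j)) \<le> K" by simp
  \<comment> \<open>The last index has no successor to compare with. It stays outside the
    telescoping and costs the extra 1.\<close>
  moreover have "min (m L) (1 / m L) \<le> 1" using m[of L] by (cases "m L \<le> 1") (auto simp: min_le_iff_disj)
  ultimately show ?thesis by (simp add: K_def lessThan_Suc_atMost[symmetric])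
qed

text \<open>With \<open>n = S * m j\<close> a term is \<open>S powr (1/t)\<close> times
  \<open>min 1 (n powr (1/s)) * n powr (-1/t)\<close>. The latter is at most
  \<open>n powr (1/s - 1/t)\<close> and at most \<open>n powr (-1/t)\<close>, the useful bounds for
  small and for large \<open>n\<close>. Taking the smaller exponent \<open>\<beta>\<close>, positive
  because \<open>s < t\<close>, \<open>sum_min_inverse_le\<close> applies to the numbers
  \<open>n powr \<beta>\<close>, which grow by the factor \<open>d powr \<beta>\<close>.\<close>

lemma geometric_sum_bound:
  fixes s t d :: real
  assumes d: "d > 1" and st: "0 < s" "s < t"
  obtains C where "C > 0" "\<And>(m :: nat \<Rightarrow> real) L S. (\<And>j. j \<le> L \<Longrightarrow> m j > 0) \<Longrightarrow> (\<And>j. j < L \<Longrightarrow> d * m j \<le> m (Suc j))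
     \<Longrightarrow> S > 0 \<Longrightarrow> (\<Sum>j\<le>L. min 1 ((S * m j) powr (1/s)) * m j powr (-1/t)) \<le> C * S powr (1/t)"
proof -
  define \<beta> where "\<beta> = min (1/t) (1/s - 1/t)"
  have \<beta>: "\<beta> > 0" "\<beta> \<le> 1/t" "\<beta> \<le> 1/s - 1/t" using st by (auto simp: \<beta>_def field_simps)
  define D where "D = d powr \<beta>"
  have D: "D > 1" using d \<beta> by (simp add: D_def)
  define C where "C = 2 * (D + 1) / (D - 1) + 1"
  have "C > 0" using D by (simp add: C_def add_pos_pos)
  moreover have "(\<Sum>j\<le>L. min 1 ((S * m j) powr (1/s)) * m j powr (-1/t)) \<le> C * S powr (1/t)"
    if m: "\<And>j. j \<le> L \<Longrightarrow> m j > 0" and g: "\<And>j. j < L \<Longrightarrow> d * m j \<le> m (Suc j)" and S: "S > 0"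
    for m :: "nat \<Rightarrow> real" and L S
  proof -
    have "(\<Sum>j\<le>L. min 1 ((S * m j) powr (1/s)) * m j powr (-1/t))
       \<le> (\<Sum>j\<le>L. S powr (1/t) * min ((S * m j) powr \<beta>) (1 / (S * m j) powr \<beta>))"
    proof (rule sum_mono)
      fix j assume "j \<in> {..L}"
      then have mj: "m j > 0" using m by auto
      define n where "n = S * m j"
      have n: "n > 0" using S mj by (simp add: n_def)
      have "m j powr (-1/t) = S powr (1/t) * n powr (-1/t)"
        using S mj by (simp add: n_def powr_mult powr_add[symmetric] flip: mult.assoc)
      moreover have "min 1 (n powr (1/s)) * n powr (-1/t) \<le> min (n powr \<beta>) (1 / n powr \<beta>)"
      proof (cases "n \<le> 1")
        case True
        have "min 1 (n powr (1/s)) * n powr (-1/t) \<le> n powr (1/s) * n powr (-1/t)"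
          by (intro mult_right_mono) auto
        also have "\<dots> = n powr (1/s - 1/t)" by (simp add: powr_add[symmetric])
        also have "\<dots> \<le> n powr \<beta>" using True n \<beta> by (intro powr_mono') auto
        finally have 1: "min 1 (n powr (1/s)) * n powr (-1/t) \<le> n powr \<beta>" .
        have "n powr \<beta> \<le> n powr (- \<beta>)" using True n \<beta> by (intro powr_mono') auto
        with 1 show ?thesis by (simp add: powr_minus_divide)
      next
        case False
        have "min 1 (n powr (1/s)) * n powr (-1/t) \<le> 1 * n powr (-1/t)"
          by (intro mult_right_mono) auto
        also have "\<dots> \<le> n powr (-\<beta>)" using False \<beta> by (auto intro!: powr_mono)
        finally have 1: "min 1 (n powr (1/s)) * n powr (-1/t) \<le> n powr (-\<beta>)" .
        have "n powr (-\<beta>) \<le> n powr \<beta>" using False \<beta> by (auto intro!: powr_mono)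
        with 1 show ?thesis by (simp add: powr_minus_divide)
      qed
      ultimately show "min 1 ((S * m j) powr (1/s)) * m j powr (-1/t)
         \<le> S powr (1/t) * min ((S * m j) powr \<beta>) (1 / (S * m j) powr \<beta>)"
        by (simp add: n_def[symmetric] mult.left_commute mult_left_mono)
    qed
    also have "\<dots> = S powr (1/t) * (\<Sum>j\<le>L. min ((S * m j) powr \<beta>) (1 / (S * m j) powr \<beta>))"
      by (simp add: sum_distrib_left)
    also have "\<dots> \<le> S powr (1/t) * C"
      unfolding C_def
    proof (intro mult_left_mono sum_min_inverse_le D)
      show "(S * m j) powr \<beta> > 0" if "j \<le> L" for j using S m[OF that] by simp
      show "D * (S * m j) powr \<beta> \<le> (S * m (Suc j)) powr \<beta>" if "j < L" for j
      proof -
        have "D * (S * m j) powr \<beta> = (S * (d * m j)) powr \<beta>"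
          using m[of j] S that d by (simp add: D_def powr_mult)
        also have "\<dots> \<le> (S * m (Suc j)) powr \<beta>"
          using g[OF that] S \<beta> m[of j] that d by (intro powr_mono2 mult_left_mono) auto
        finally show ?thesis .
      qed
    qed simp
    finally show ?thesis by (simp add: mult.commute)
  qed
  ultimately show ?thesis using that by blast
qed

section \<open>Reverse doubling on finite trees\<close>

lemma sum_PiE_insert:
  assumes "i \<notin> I"
  shows "(\<Sum>x\<in>PiE (insert i I) S. f x) = (\<Sum>y\<in>PiE I S. \<Sum>c\<in>S i. f (y(i := c)))"
proof -
  have "(\<Sum>x\<in>PiE (insert i I) S. f x) = (\<Sum>(c, y)\<in>S i \<times> PiE I S. f (y(i := c)))"
    unfolding PiE_insert_eq
    by (subst sum.reindex[OF inj_combinator[OF assms]]) (simp add: case_prod_unfold)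
  also have "\<dots> = (\<Sum>c\<in>S i. \<Sum>y\<in>PiE I S. f (y(i := c)))"
    by (rule sum.cartesian_product[symmetric])
  also have "\<dots> = (\<Sum>y\<in>PiE I S. \<Sum>c\<in>S i. f (y(i := c)))" by (rule sum.swap)
  finally show ?thesis .
qed

text \<open>The sequence \<open>m\<close> stands for the masses of the nested nodes above a point. The minimum is what the
  two bounds \<open>b \<le> 1\<close> and \<open>b\<^sup>s \<le> S m\<close> leave of the coefficients, where \<open>S\<close> is the sum of \<open>b\<^sup>s / m\<close>.\<close>

definition hedberg_const :: "real \<Rightarrow> real \<Rightarrow> real \<Rightarrow> real \<Rightarrow> bool" where
  "hedberg_const C d s t \<longleftrightarrow> C > 0 \<and> (\<forall>(m :: nat \<Rightarrow> real) L S. (\<forall>j\<le>L. m j > 0) \<longrightarrow>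
     (\<forall>j<L. d * m j \<le> m (Suc j)) \<longrightarrow> S > 0 \<longrightarrow>
     (\<Sum>j\<le>L. min 1 ((S * m j) powr (1/s)) * m j powr (-1/t)) \<le> C * S powr (1/t))"

lemma hedberg_const_exists:
  assumes "d > 1" "0 < s" "s < t"
  shows "\<exists>C. hedberg_const C d s t"
proof -
  from geometric_sum_bound[OF assms] obtain C where C: "C > 0"
    "\<And>(m :: nat \<Rightarrow> real) L S. (\<And>j. j \<le> L \<Longrightarrow> m j > 0) \<Longrightarrow> (\<And>j. j < L \<Longrightarrow> d * m j \<le> m (Suc j))
     \<Longrightarrow> S > 0 \<Longrightarrow> (\<Sum>j\<le>L. min 1 ((S * m j) powr (1/s)) * m j powr (-1/t)) \<le> C * S powr (1/t)"
    by blast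
  show ?thesis
    unfolding hedberg_const_def by (intro exI[of _ C] conjI C(1) allI impI, rule C(2)) auto
qed

text \<open>A node carries its level: cells of different levels count as different nodes even if
  they contain the same points. Hence the nodes around a point are enumerated without repetition by
  the levels up to \<open>L\<close>. The growth of masses along a branch is a matter of the weight
  and enters through separate hypotheses.\<close>

locale leveled_tree =
  fixes X :: "'c set" and L :: nat and anc :: "nat \<Rightarrow> 'c \<Rightarrow> 'd"
  assumes finite_X: "finite X" and anc_level: "anc j x = anc j' x' \<Longrightarrow> j = j'"
begin

text \<open>Elements of \<open>X\<close> are the cells of the finest mesh and \<open>anc j x\<close> is the level \<open>j\<close> cell around \<open>x\<close>.\<close>

definition nodes :: "'d set" where
  "nodes = (\<lambda>(j, x). anc j x) ` ({..L} \<times> X)"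

definition leaves :: "'d \<Rightarrow> 'c set" where
  "leaves Q = {x \<in> X. \<exists>j\<le>L. anc j x = Q}"

lemma finite_nodes: "finite nodes"
  by (simp add: nodes_def finite_X)

lemma leaves_subset: "leaves Q \<subseteq> X"
  by (auto simp: leaves_def)

lemma finite_leaves: "finite (leaves Q)"
  using finite_subset[OF leaves_subset finite_X] .

lemma leaves_nonempty: "Q \<in> nodes \<Longrightarrow> leaves Q \<noteq> {}"
  by (auto simp: nodes_def leaves_def)

text \<open>Each level contributes exactly one node around \<open>x\<close>, so a sum over the tree
  becomes a sum along one branch, the form in which \<open>hedberg_const\<close> speaks.\<close>

lemma sum_nodes_containing:
  assumes "x \<in> X"
  shows "(\<Sum>Q\<in>nodes. of_bool (x \<in> leaves Q) * g Q) = (\<Sum>j\<le>L. g (anc j x) :: real)"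
proof -
  have "(\<Sum>Q\<in>nodes. of_bool (x \<in> leaves Q) * g Q) = (\<Sum>Q\<in>(\<lambda>j. anc j x) ` {..L}. g Q)"
  proof (rule sum.mono_neutral_cong_right[OF finite_nodes])
    show "(\<lambda>j. anc j x) ` {..L} \<subseteq> nodes" using assms by (auto simp: nodes_def)
  qed (use assms in \<open>auto simp: leaves_def\<close>)
  also have "\<dots> = (\<Sum>j\<le>L. g (anc j x))"
    by (subst sum.reindex) (auto simp: inj_on_def dest: anc_level)
  finally show ?thesis .
qed

text \<open>Homogeneity is carried along instead of being normalised away: with
  \<open>\<beta>\<close> the sum of all \<open>b Q powr s\<close>, every coefficient is at most
  \<open>\<beta> powr (1/s)\<close>, and \<open>S x / \<beta>\<close> plays the part of
  \<open>S\<close> in \<open>hedberg_const\<close>. Raising to the power \<open>t\<close> turns the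
  resulting \<open>S x powr (1/t)\<close> into \<open>S x\<close>, which is a sum over nodes and can
  be summed against \<open>\<mu>\<close> exactly.\<close>

lemma weighted_sum_le:
  assumes C: "hedberg_const C d s t" and st: "0 < s" "s < t"
    and \<mu>: "\<And>x. x \<in> X \<Longrightarrow> \<mu> x > 0"
    and rd: "\<And>x j. x \<in> X \<Longrightarrow> j < L \<Longrightarrow> d * sum \<mu> (leaves (anc j x)) \<le> sum \<mu> (leaves (anc (Suc j) x))"
    and b: "\<And>Q. Q \<in> nodes \<Longrightarrow> b Q \<ge> 0"
  shows "(\<Sum>x\<in>X. \<mu> x * (\<Sum>Q\<in>nodes. of_bool (x \<in> leaves Q) * (b Q * sum \<mu> (leaves Q) powr (-1/t))) powr t)
     \<le> C powr t * (\<Sum>Q\<in>nodes. b Q powr s) powr (t/s)"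
proof -
  define m where "m Q = sum \<mu> (leaves Q)" for Q
  have m: "m Q > 0" if "Q \<in> nodes" for Q
    unfolding m_def using \<mu> leaves_nonempty[OF that] finite_leaves leaves_subset
    by (intro sum_pos) auto
  have anc: "anc j x \<in> nodes" if "x \<in> X" "j \<le> L" for x j
    using that by (auto simp: nodes_def)
  define \<beta> where "\<beta> = (\<Sum>Q\<in>nodes. b Q powr s)"
  have \<beta>: "\<beta> \<ge> 0" unfolding \<beta>_def by (simp add: sum_nonneg)
  have C0: "C > 0" using C by (simp add: hedberg_const_def)
  define F where "F x = (\<Sum>j\<le>L. b (anc j x) * m (anc j x) powr (-1/t))" for x
  define S where "S x = (\<Sum>j\<le>L. b (anc j x) powr s / m (anc j x))" for x
  have F: "F x powr t \<le> C powr t * (\<beta> powr (t/s - 1) * S x)" if x: "x \<in> X" for x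
  \<comment> \<open>A branch without coefficients is set apart, since \<open>hedberg_const\<close>
    is to be applied with a positive \<open>S\<close>, and \<open>\<beta>\<close> is to be a
    divisor.\<close>
  proof (cases "\<forall>j\<le>L. b (anc j x) = 0")
    case True
    then show ?thesis using st by (simp add: F_def S_def)
  next
    case False
    then obtain j0 where j0: "j0 \<le> L" "b (anc j0 x) \<noteq> 0" by auto
    have "b (anc j0 x) powr s \<le> \<beta>"
      unfolding \<beta>_def by (rule member_le_sum) (use anc[OF x j0(1)] finite_nodes in auto)
    then have \<beta>0: "\<beta> > 0" using j0 b[OF anc[OF x j0(1)]] by (smt (verit) powr_gt_zero)
    have Snn: "b (anc j x) powr s / m (anc j x) \<ge> 0" if "j \<le> L" for j
      using m[OF anc[OF x that]] by simp
    have Sge: "b (anc j x) powr s / m (anc j x) \<le> S x" if "j \<le> L" for j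
      unfolding S_def by (rule member_le_sum) (use that Snn in auto)
    have S0: "S x > 0"
    proof -
      have "b (anc j0 x) powr s / m (anc j0 x) > 0"
        using j0 m[OF anc[OF x j0(1)]] by simp
      then show ?thesis using Sge[OF j0(1)] by simp
    qed
    have "F x \<le> (\<Sum>j\<le>L. \<beta> powr (1/s) * (min 1 ((S x / \<beta> * m (anc j x)) powr (1/s)) * m (anc j x) powr (-1/t)))"
      unfolding F_def
    proof (rule sum_mono)
      fix j assume "j \<in> {..L}"
      then have j: "j \<le> L" by simp
      note mj = m[OF anc[OF x j]] and bj = b[OF anc[OF x j]]
      have "b (anc j x) powr s \<le> \<beta>"
        unfolding \<beta>_def by (rule member_le_sum) (use anc[OF x j] finite_nodes in auto)
      then have "(b (anc j x) powr s) powr (1/s) \<le> \<beta> powr (1/s)"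
        using st by (intro powr_mono2) auto
      then have 1: "b (anc j x) \<le> \<beta> powr (1/s)" using st bj by (simp add: powr_powr)
      have "b (anc j x) powr s \<le> S x * m (anc j x)"
        using Sge[OF j] mj by (simp add: pos_divide_le_eq)
      then have "(b (anc j x) powr s) powr (1/s) \<le> (S x * m (anc j x)) powr (1/s)"
        using st by (intro powr_mono2) auto
      then have "b (anc j x) \<le> (S x * m (anc j x)) powr (1/s)" using st bj by (simp add: powr_powr)
      also have "S x * m (anc j x) = \<beta> * (S x / \<beta> * m (anc j x))" using \<beta>0 by simp
      also have "(\<beta> * (S x / \<beta> * m (anc j x))) powr (1/s) = \<beta> powr (1/s) * (S x / \<beta> * m (anc j x)) powr (1/s)"
        using \<beta>0 S0 mj by (subst powr_mult) auto
      finally have "b (anc j x) \<le> \<beta> powr (1/s) * min 1 ((S x / \<beta> * m (anc j x)) powr (1/s))"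
        using 1 by (simp add: min_def)
      then show "b (anc j x) * m (anc j x) powr (-1/t)
        \<le> \<beta> powr (1/s) * (min 1 ((S x / \<beta> * m (anc j x)) powr (1/s)) * m (anc j x) powr (-1/t))"
        by (simp add: mult.assoc[symmetric] mult_right_mono)
    qed
    also have "\<dots> = \<beta> powr (1/s) * (\<Sum>j\<le>L. min 1 ((S x / \<beta> * m (anc j x)) powr (1/s)) * m (anc j x) powr (-1/t))"
      by (simp add: sum_distrib_left)
    also have "\<dots> \<le> \<beta> powr (1/s) * (C * (S x / \<beta>) powr (1/t))"
    proof (intro mult_left_mono)
      show "(\<Sum>j\<le>L. min 1 ((S x / \<beta> * m (anc j x)) powr (1/s)) * m (anc j x) powr (-1/t)) \<le> C * (S x / \<beta>) powr (1/t)"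
        by (rule C[unfolded hedberg_const_def, THEN conjunct2, rule_format])
          (use m anc x rd[OF x] S0 \<beta>0 in \<open>auto simp: m_def\<close>)
    qed simp
    finally have "F x \<le> C * (\<beta> powr (1/s) * (S x / \<beta>) powr (1/t))" by (simp add: mult_ac)
    moreover have "F x \<ge> 0"
      unfolding F_def by (intro sum_nonneg) (use b anc x in auto)
    ultimately have "F x powr t \<le> (C * (\<beta> powr (1/s) * (S x / \<beta>) powr (1/t))) powr t"
      using st by (intro powr_mono2) auto
    also have "\<dots> = C powr t * (\<beta> powr (t/s) * (S x / \<beta>))"
      using C0 \<beta>0 S0 st by (simp add: powr_mult powr_powr)
    also have "\<dots> = C powr t * (\<beta> powr (t/s - 1) * S x)"
      using \<beta>0 by (simp add: powr_diff)
    finally show ?thesis .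
  qed
  have "(\<Sum>x\<in>X. \<mu> x * (\<Sum>Q\<in>nodes. of_bool (x \<in> leaves Q) * (b Q * sum \<mu> (leaves Q) powr (-1/t))) powr t)
     = (\<Sum>x\<in>X. \<mu> x * F x powr t)"
    by (intro sum.cong refl) (simp add: sum_nodes_containing F_def m_def)
  also have "\<dots> \<le> (\<Sum>x\<in>X. \<mu> x * (C powr t * (\<beta> powr (t/s - 1) * S x)))"
    by (intro sum_mono mult_left_mono F) (use \<mu> less_imp_le in auto)
  also have "\<dots> = C powr t * (\<beta> powr (t/s - 1) * (\<Sum>x\<in>X. \<mu> x * S x))"
    by (simp add: sum_distrib_left mult_ac)
  \<comment> \<open>Exchange of the sums: the points below a node \<open>Q\<close> have total weight
    \<open>m Q\<close>, which cancels the denominator in \<open>S\<close>.\<close>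
  also have "(\<Sum>x\<in>X. \<mu> x * S x) = \<beta>"
  proof -
    have "(\<Sum>x\<in>X. \<mu> x * S x) = (\<Sum>x\<in>X. \<mu> x * (\<Sum>Q\<in>nodes. of_bool (x \<in> leaves Q) * (b Q powr s / m Q)))"
      by (intro sum.cong refl) (simp add: sum_nodes_containing[where g="\<lambda>Q. b Q powr s / m Q"] S_def del: times_divide_eq_right)
    also have "\<dots> = (\<Sum>Q\<in>nodes. \<Sum>x\<in>X. of_bool (x \<in> leaves Q) * \<mu> x * (b Q powr s / m Q))"
      by (subst sum.swap) (simp add: sum_distrib_left mult_ac)
    also have "\<dots> = (\<Sum>Q\<in>nodes. m Q * (b Q powr s / m Q))"
    proof (intro sum.cong refl)
      fix Q
      have "(\<Sum>x\<in>X. of_bool (x \<in> leaves Q) * \<mu> x) = m Q"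
        unfolding m_def by (rule sum.mono_neutral_cong_right) (use leaves_subset finite_X in auto)
      then show "(\<Sum>x\<in>X. of_bool (x \<in> leaves Q) * \<mu> x * (b Q powr s / m Q)) = m Q * (b Q powr s / m Q)"
        by (simp add: sum_distrib_right[symmetric] sum_divide_distrib[symmetric])
    qed
    also have "\<dots> = \<beta>" unfolding \<beta>_def by (intro sum.cong refl) (use m in force)
    finally show ?thesis .
  qed
  also have "\<beta> powr (t/s - 1) * \<beta> = \<beta> powr (t/s)"
    using powr_mult_base[OF \<beta>, of "t/s - 1"] by (simp add: mult.commute)
  finally show ?thesis by (simp add: \<beta>_def)
qed

section \<open>Rectangles as products of tree nodes\<close>

definition rect :: "'k set \<Rightarrow> ('k \<Rightarrow> 'd) \<Rightarrow> ('k \<Rightarrow> 'c) set" where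
  "rect I R = PiE I (\<lambda>i. leaves (R i))"

lemma rect_subset: "rect I R \<subseteq> PiE I (\<lambda>_. X)"
  unfolding rect_def by (intro PiE_mono leaves_subset)

lemma finite_rect: "finite I \<Longrightarrow> finite (rect I R)"
  unfolding rect_def by (intro finite_PiE finite_leaves)

lemma rect_nonempty: "R \<in> PiE I (\<lambda>_. nodes) \<Longrightarrow> rect I R \<noteq> {}"
  unfolding rect_def PiE_eq_empty_iff using leaves_nonempty by (auto simp: PiE_def Pi_def)

lemma mass_pos:
  assumes "finite I" "R \<in> PiE I (\<lambda>_. nodes)" "\<And>x. x \<in> PiE I (\<lambda>_. X) \<Longrightarrow> v x > (0::real)"
  shows "sum v (rect I R) > 0"
proof (rule sum_pos[OF finite_rect[OF assms(1)] rect_nonempty[OF assms(2)]])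
  show "v x > 0" if "x \<in> rect I R" for x using assms(3) rect_subset that by blast
qed

definition separate_rd :: "real \<Rightarrow> 'k set \<Rightarrow> (('k \<Rightarrow> 'c) \<Rightarrow> real) \<Rightarrow> bool" where
  "separate_rd d I v \<longleftrightarrow> (\<forall>i\<in>I. \<forall>y\<in>PiE I (\<lambda>_. X). \<forall>j<L.
     d * (\<Sum>c\<in>leaves (anc j (y i)). v (y(i := c))) \<le> (\<Sum>c\<in>leaves (anc (Suc j) (y i)). v (y(i := c))))"

lemma sum_rect_insert:
  assumes "i \<notin> I"
  shows "sum f (rect (insert i I) (R(i := Q))) = (\<Sum>y\<in>rect I R. \<Sum>c\<in>leaves Q. f (y(i := c)))"
proof -
  have "PiE I (\<lambda>l. leaves ((R(i := Q)) l)) = PiE I (\<lambda>l. leaves (R l))"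
    using assms by (intro PiE_cong) auto
  then show ?thesis
    using sum_PiE_insert[OF assms, of f "\<lambda>l. leaves ((R(i := Q)) l)"] by (simp add: rect_def)
qed

lemma mem_rect_insert:
  assumes "i \<notin> I" "y \<in> PiE I (\<lambda>_. X)"
  shows "y(i := c) \<in> rect (insert i I) (R(i := Q)) \<longleftrightarrow> c \<in> leaves Q \<and> y \<in> rect I R"
  using assms by (auto simp: rect_def PiE_iff extensional_def fun_upd_def split: if_splits)

text \<open>In the induction the new variable is treated first, with the others frozen. The remaining sum has
  the same form with the weight integrated over a node in the new variable, since reverse doubling is
  linear in the weight; Minkowski's inequality joins the two steps.\<close>

theorem weighted_rect_sum_le:
  assumes C: "hedberg_const C d s t" and st: "0 < s" "s < t" and I: "finite I"
    and "\<And>x. x \<in> PiE I (\<lambda>_. X) \<Longrightarrow> v x > 0" and "separate_rd d I v"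
    and "\<And>R. R \<in> PiE I (\<lambda>_. nodes) \<Longrightarrow> b R \<ge> 0"
  shows "(\<Sum>x\<in>PiE I (\<lambda>_. X). v x * (\<Sum>R\<in>PiE I (\<lambda>_. nodes).
       of_bool (x \<in> rect I R) * (b R * sum v (rect I R) powr (-1/t))) powr t)
     \<le> (C powr t) ^ card I * (\<Sum>R\<in>PiE I (\<lambda>_. nodes). b R powr s) powr (t/s)"
  using I assms(5-)
proof (induction I arbitrary: v b rule: finite_induct)
  case empty
  \<comment> \<open>For the empty index set the extensional functions reduce to one, the constant
    \<open>undefined\<close>, and the claim is the equality of \<open>b powr t\<close> with
    \<open>(b powr s) powr (t/s)\<close>.\<close>
  have 1: "v (\<lambda>x. undefined) > 0" "b (\<lambda>x. undefined) \<ge> 0" using empty by auto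
  have "v (\<lambda>x. undefined) * (b (\<lambda>x. undefined) * v (\<lambda>x. undefined) powr (-1/t)) powr t = b (\<lambda>x. undefined) powr t"
    using 1 st by (simp add: powr_divide powr_powr powr_minus_divide)
  then show ?case
    using st 1(2) by (simp add: rect_def powr_powr)
next
  case (insert i I)
  note iI = \<open>i \<notin> I\<close>
  define K where "K = (C powr t) ^ card I"
  have K: "K \<ge> 0" by (simp add: K_def)
  define w where "w Q y = (\<Sum>c\<in>leaves Q. v (y(i := c)))" for Q y
  have upd: "y(i := c) \<in> PiE (insert i I) (\<lambda>_. X)" if "y \<in> PiE I (\<lambda>_. X)" "c \<in> X" for y c
    using that by (auto simp: PiE_iff extensional_def)
  have vpos: "v (y(i := c)) > 0" if "y \<in> PiE I (\<lambda>_. X)" "c \<in> X" for y c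
    by (rule insert.prems(1)[OF upd[OF that]])
  have w: "w Q y > 0" if "Q \<in> nodes" "y \<in> PiE I (\<lambda>_. X)" for Q y
    unfolding w_def using vpos[OF that(2)] leaves_nonempty[OF that(1)] leaves_subset
    by (intro sum_pos finite_leaves) auto
  have mass: "sum v (rect (insert i I) (P(i := Q))) = sum (w Q) (rect I P)" for P Q
    by (simp add: sum_rect_insert[OF iI] w_def)
  \<comment> \<open>For a fixed node \<open>Q\<close> in the new variable, \<open>H Q y\<close> is
    the sum that the induction hypothesis bounds for the weight \<open>w Q\<close>. On the line
    through \<open>y\<close> the node \<open>Q\<close> has mass \<open>w Q y\<close>; the factor
    \<open>w Q y powr (1/t)\<close> in \<open>B\<close> puts \<open>H\<close> into the shape of the
    coefficients in \<open>weighted_sum_le\<close>.\<close>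
  define H where "H Q y = (\<Sum>P\<in>PiE I (\<lambda>_. nodes). of_bool (y \<in> rect I P) * (b (P(i := Q)) * sum (w Q) (rect I P) powr (-1/t)))" for Q y
  define B where "B Q y = H Q y * w Q y powr (1/t)" for Q y
  have updR: "P(i := Q) \<in> PiE (insert i I) (\<lambda>_. nodes)" if "P \<in> PiE I (\<lambda>_. nodes)" "Q \<in> nodes" for P Q
    using that by (auto simp: PiE_iff extensional_def)
  have H: "H Q y \<ge> 0" if "Q \<in> nodes" for Q y
    unfolding H_def by (intro sum_nonneg mult_nonneg_nonneg insert.prems(3) updR that) auto
  have B: "B Q y \<ge> 0" if "Q \<in> nodes" for Q y
    using H[OF that] by (simp add: B_def)
  have inner: "(\<Sum>R\<in>PiE (insert i I) (\<lambda>_. nodes).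
       of_bool (y(i := c) \<in> rect (insert i I) R) * (b R * sum v (rect (insert i I) R) powr (-1/t)))
       = (\<Sum>Q\<in>nodes. of_bool (c \<in> leaves Q) * (B Q y * w Q y powr (-1/t)))"
    if y: "y \<in> PiE I (\<lambda>_. X)" for y c
  proof -
    have "(\<Sum>R\<in>PiE (insert i I) (\<lambda>_. nodes).
       of_bool (y(i := c) \<in> rect (insert i I) R) * (b R * sum v (rect (insert i I) R) powr (-1/t)))
      = (\<Sum>P\<in>PiE I (\<lambda>_. nodes). \<Sum>Q\<in>nodes. of_bool (c \<in> leaves Q) * (of_bool (y \<in> rect I P) *
           (b (P(i := Q)) * sum (w Q) (rect I P) powr (-1/t))))"
      unfolding sum_PiE_insert[OF iI]
      by (simp add: mem_rect_insert[OF iI y] mass of_bool_conj mult_ac)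
    also have "\<dots> = (\<Sum>Q\<in>nodes. of_bool (c \<in> leaves Q) * H Q y)"
      by (subst sum.swap) (simp add: H_def sum_distrib_left)
    also have "\<dots> = (\<Sum>Q\<in>nodes. of_bool (c \<in> leaves Q) * (B Q y * w Q y powr (-1/t)))"
    proof (intro sum.cong refl arg_cong2[where f="(*)"])
      fix Q assume "Q \<in> nodes"
      then show "H Q y = B Q y * w Q y powr (-1/t)"
        using w[OF _ y, of Q] by (simp add: B_def mult.assoc powr_add[symmetric])
    qed
    finally show ?thesis .
  qed
  have "(\<Sum>x\<in>PiE (insert i I) (\<lambda>_. X). v x * (\<Sum>R\<in>PiE (insert i I) (\<lambda>_. nodes).
       of_bool (x \<in> rect (insert i I) R) * (b R * sum v (rect (insert i I) R) powr (-1/t))) powr t)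
    = (\<Sum>y\<in>PiE I (\<lambda>_. X). \<Sum>c\<in>X. v (y(i := c)) * (\<Sum>Q\<in>nodes. of_bool (c \<in> leaves Q) * (B Q y * w Q y powr (-1/t))) powr t)"
    unfolding sum_PiE_insert[OF iI, of _ "\<lambda>_. X"] by (intro sum.cong refl) (simp only: inner)
  also have "\<dots> \<le> (\<Sum>y\<in>PiE I (\<lambda>_. X). C powr t * (\<Sum>Q\<in>nodes. B Q y powr s) powr (t/s))"
  proof (rule sum_mono)
    fix y assume y: "y \<in> PiE I (\<lambda>_. X)"
    show "(\<Sum>c\<in>X. v (y(i := c)) * (\<Sum>Q\<in>nodes. of_bool (c \<in> leaves Q) * (B Q y * w Q y powr (-1/t))) powr t)
      \<le> C powr t * (\<Sum>Q\<in>nodes. B Q y powr s) powr (t/s)"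
      unfolding w_def
    proof (rule weighted_sum_le[OF C st])
      show "0 < v (y(i := c))" if "c \<in> X" for c using vpos[OF y that] .
      show "d * (\<Sum>c\<in>leaves (anc j x). v (y(i := c))) \<le> (\<Sum>c\<in>leaves (anc (Suc j) x). v (y(i := c)))"
        if "x \<in> X" "j < L" for x j
        using insert.prems(2)[unfolded separate_rd_def, rule_format, of i "y(i := x)" j] upd[OF y that(1)] that
        by simp
    qed (rule B)
  qed
  also have "\<dots> = C powr t * (\<Sum>y\<in>PiE I (\<lambda>_. X). (\<Sum>Q\<in>nodes. B Q y powr s) powr (t/s))"
    by (simp add: sum_distrib_left)
  \<comment> \<open>Minkowski's inequality with exponent \<open>t/s > 1\<close> pulls the sum over
    \<open>Q\<close> out of the norm in \<open>y\<close>, so that each \<open>Q\<close> can be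
    handed to the induction hypothesis with its own weight \<open>w Q\<close>.\<close>
  also have "\<dots> \<le> C powr t * (\<Sum>Q\<in>nodes. (\<Sum>y\<in>PiE I (\<lambda>_. X). (B Q y powr s) powr (t/s)) powr (1 / (t/s))) powr (t/s)"
    by (intro mult_left_mono Minkowski_inequality_sum)
      (use st insert.hyps finite_X in \<open>auto intro!: finite_PiE\<close>)
  also have "\<dots> \<le> C powr t * (\<Sum>Q\<in>nodes. K powr (s/t) * (\<Sum>P\<in>PiE I (\<lambda>_. nodes). b (P(i := Q)) powr s)) powr (t/s)"
  proof (intro mult_left_mono powr_mono2 sum_mono sum_nonneg)
    fix Q assume Q: "Q \<in> nodes"
    have "(\<Sum>y\<in>PiE I (\<lambda>_. X). (B Q y powr s) powr (t/s)) = (\<Sum>y\<in>PiE I (\<lambda>_. X). w Q y * H Q y powr t)"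
    proof (intro sum.cong refl)
      fix y assume "y \<in> PiE I (\<lambda>_. X)"
      then show "(B Q y powr s) powr (t/s) = w Q y * H Q y powr t"
        using w[OF Q, of y] H[OF Q, of y] st by (simp add: B_def powr_powr powr_mult)
    qed
    also have "\<dots> \<le> K * (\<Sum>P\<in>PiE I (\<lambda>_. nodes). b (P(i := Q)) powr s) powr (t/s)"
      unfolding H_def K_def
    proof (rule insert.IH[of "w Q" "\<lambda>P. b (P(i := Q))"])
      show "separate_rd d I (w Q)"
        unfolding separate_rd_def
      proof (intro ballI allI impI)
        fix l y j assume l: "l \<in> I" and y: "y \<in> PiE I (\<lambda>_. X)" and j: "j < L"
        have "l \<noteq> i" using l iI by auto
        have swap: "(\<Sum>c\<in>Z. w Q (y(l := c))) = (\<Sum>c'\<in>leaves Q. \<Sum>c\<in>Z. v ((y(i := c'))(l := c)))" for Z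
          unfolding w_def using \<open>l \<noteq> i\<close> by (subst sum.swap) (simp add: fun_upd_twist)
        have "d * (\<Sum>c\<in>leaves (anc j (y l)). w Q (y(l := c)))
          = (\<Sum>c'\<in>leaves Q. d * (\<Sum>c\<in>leaves (anc j (y l)). v ((y(i := c'))(l := c))))"
          by (simp add: swap sum_distrib_left)
        also have "\<dots> \<le> (\<Sum>c'\<in>leaves Q. \<Sum>c\<in>leaves (anc (Suc j) (y l)). v ((y(i := c'))(l := c)))"
        proof (rule sum_mono)
          fix c' assume "c' \<in> leaves Q"
          then have "y(i := c') \<in> PiE (insert i I) (\<lambda>_. X)" using upd[OF y] leaves_subset by blast
          then show "d * (\<Sum>c\<in>leaves (anc j (y l)). v ((y(i := c'))(l := c)))
             \<le> (\<Sum>c\<in>leaves (anc (Suc j) (y l)). v ((y(i := c'))(l := c)))"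
            using insert.prems(2)[unfolded separate_rd_def, rule_format, of l "y(i := c')" j] l j \<open>l \<noteq> i\<close>
            by simp
        qed
        also have "\<dots> = (\<Sum>c\<in>leaves (anc (Suc j) (y l)). w Q (y(l := c)))" by (simp add: swap)
        finally show "d * (\<Sum>c\<in>leaves (anc j (y l)). w Q (y(l := c)))
          \<le> (\<Sum>c\<in>leaves (anc (Suc j) (y l)). w Q (y(l := c)))" .
      qed
    qed (simp_all add: w[OF Q] insert.prems(3)[OF updR[OF _ Q]])
    finally have "(\<Sum>y\<in>PiE I (\<lambda>_. X). (B Q y powr s) powr (t/s)) powr (1 / (t/s))
       \<le> (K * (\<Sum>P\<in>PiE I (\<lambda>_. nodes). b (P(i := Q)) powr s) powr (t/s)) powr (s/t)"
      using st by (auto intro!: powr_mono2 sum_nonneg)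
    also have "\<dots> = K powr (s/t) * (\<Sum>P\<in>PiE I (\<lambda>_. nodes). b (P(i := Q)) powr s)"
      using st by (simp add: powr_mult powr_powr sum_nonneg)
    finally show "(\<Sum>y\<in>PiE I (\<lambda>_. X). (B Q y powr s) powr (t/s)) powr (1 / (t/s))
       \<le> K powr (s/t) * (\<Sum>P\<in>PiE I (\<lambda>_. nodes). b (P(i := Q)) powr s)" .
  qed (use st in auto)
  also have "(\<Sum>Q\<in>nodes. K powr (s/t) * (\<Sum>P\<in>PiE I (\<lambda>_. nodes). b (P(i := Q)) powr s))
     = K powr (s/t) * (\<Sum>R\<in>PiE (insert i I) (\<lambda>_. nodes). b R powr s)"
    unfolding sum_PiE_insert[OF iI] sum_distrib_left by (rule sum.swap)
  \<comment> \<open>The factor \<open>K powr (s/t)\<close> did not depend on \<open>Q\<close>, and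
    the outer power \<open>t/s\<close> restores it to \<open>K\<close>; each variable thus costs one
    factor \<open>C powr t\<close>.\<close>
  also have "(K powr (s/t) * (\<Sum>R\<in>PiE (insert i I) (\<lambda>_. nodes). b R powr s)) powr (t/s)
     = K * (\<Sum>R\<in>PiE (insert i I) (\<lambda>_. nodes). b R powr s) powr (t/s)"
    using K st by (simp add: powr_mult powr_powr)
  finally show ?case
    by (simp only: K_def card_insert_disjoint[OF insert.hyps(1,2)] power_Suc mult.assoc)
qed

end

section \<open>The Carleson embedding and the multilinear estimate on the tree\<close>

context leveled_tree
begin

text \<open>Dual to \<open>weighted_rect_sum_le\<close>: the left side is tested against its own powers \<open>a\<^sup>s\<^sup>-\<^sup>1\<close>.\<close>

theorem Carleson_embedding:
  assumes C: "hedberg_const C d (s / (s - 1)) (r / (r - 1))" and r: "1 < r" and s: "r < s" and I: "finite I"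
    and \<sigma>: "\<And>x. x \<in> PiE I (\<lambda>_. X) \<Longrightarrow> \<sigma> x > 0" and rd: "separate_rd d I \<sigma>"
    and N: "\<And>x. x \<in> PiE I (\<lambda>_. X) \<Longrightarrow> N x \<ge> 0" and f0: "\<And>x. x \<in> PiE I (\<lambda>_. X) \<Longrightarrow> f x \<ge> 0"
    and f: "\<And>x. x \<in> PiE I (\<lambda>_. X) \<Longrightarrow> f x \<le> N x powr (1/r) * \<sigma> x powr (1 - 1/r)"
  shows "(\<Sum>R\<in>PiE I (\<lambda>_. nodes). (sum \<sigma> (rect I R) powr (1/r - 1) * sum f (rect I R)) powr s)
     \<le> ((C powr (r/(r-1))) ^ card I) powr (s * (1 - 1/r)) * (\<Sum>x\<in>PiE I (\<lambda>_. X). N x) powr (s/r)"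
proof -
  \<comment> \<open>The exponents conjugate to \<open>r\<close> and \<open>s\<close>. Conjugation
    reverses \<open>r < s\<close> into \<open>s' < t\<close>, the order required by
    \<open>weighted_rect_sum_le\<close>, and \<open>(s - 1) * s' = s\<close> makes the powers
    \<open>a R powr (s - 1)\<close> return the sum \<open>T\<close> itself.\<close>
  define t where "t = r / (r - 1)"
  define s' where "s' = s / (s - 1)"
  have t: "t > 0" "1 / t = 1 - 1/r" "-1/t = 1/r - 1" using r by (auto simp: t_def field_simps)
  have s': "s' > 0" "1 / s' = 1 - 1/s" "s' < t" "(s - 1) * s' = s" using r s by (auto simp: s'_def t_def field_simps)
  define a where "a R = sum \<sigma> (rect I R) powr (1/r - 1) * sum f (rect I R)" for R
  define T where "T = (\<Sum>R\<in>PiE I (\<lambda>_. nodes). a R powr s)"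
  define G where "G x = (\<Sum>R\<in>PiE I (\<lambda>_. nodes). of_bool (x \<in> rect I R) * (a R powr (s - 1) * sum \<sigma> (rect I R) powr (1/r - 1)))" for x
  define K where "K = (C powr t) ^ card I"
  have K: "K \<ge> 0" by (simp add: K_def)
  have fX: "finite (PiE I (\<lambda>_. X))" using I finite_X by (intro finite_PiE) auto
  have sf: "sum f (rect I R) \<ge> 0" for R using f0 rect_subset by (intro sum_nonneg) blast
  have a: "a R \<ge> 0" for R using sf by (simp add: a_def)
  have G: "G x \<ge> 0" for x unfolding G_def by (intro sum_nonneg) auto
  have T: "T \<ge> 0" by (simp add: T_def sum_nonneg)
  \<comment> \<open>One factor of \<open>a R powr s\<close> is written out and the sums are
    exchanged, so that \<open>T\<close> becomes the pairing of \<open>f\<close> with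
    \<open>G\<close>, a function of the kind bounded by \<open>weighted_rect_sum_le\<close>.\<close>
  have "T = (\<Sum>R\<in>PiE I (\<lambda>_. nodes). \<Sum>x\<in>PiE I (\<lambda>_. X). f x * (of_bool (x \<in> rect I R) * (a R powr (s - 1) * sum \<sigma> (rect I R) powr (1/r - 1))))"
    unfolding T_def
  proof (intro sum.cong refl)
    fix R
    have "sum f (rect I R) = (\<Sum>x\<in>PiE I (\<lambda>_. X). f x * of_bool (x \<in> rect I R))"
      by (rule sum.mono_neutral_cong_left) (use rect_subset fX in auto)
    moreover have "a R powr s = a R powr (s - 1) * (sum \<sigma> (rect I R) powr (1/r - 1) * sum f (rect I R))"
      using powr_mult_base[OF a, of R "s - 1"] by (simp add: a_def mult.commute)
    ultimately show "a R powr s = (\<Sum>x\<in>PiE I (\<lambda>_. X). f x * (of_bool (x \<in> rect I R) * (a R powr (s - 1) * sum \<sigma> (rect I R) powr (1/r - 1))))"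
      by (simp add: sum_distrib_left sum_distrib_right mult_ac)
  qed
  also have "\<dots> = (\<Sum>x\<in>PiE I (\<lambda>_. X). f x * G x)"
    by (subst sum.swap) (simp add: G_def sum_distrib_left)
  also have "\<dots> \<le> (\<Sum>x\<in>PiE I (\<lambda>_. X). N x powr (1/r) * (\<sigma> x * G x powr t) powr (1 - 1/r))"
  proof (rule sum_mono)
    fix x assume x: "x \<in> PiE I (\<lambda>_. X)"
    have "(\<sigma> x * G x powr t) powr (1 - 1/r) = \<sigma> x powr (1 - 1/r) * G x"
      using \<sigma>[OF x] G[of x] t by (simp add: powr_mult powr_powr flip: t(2))
    then show "f x * G x \<le> N x powr (1/r) * (\<sigma> x * G x powr t) powr (1 - 1/r)"
      using mult_right_mono[OF f[OF x] G[of x]] by (simp add: mult_ac)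
  qed
  also have "\<dots> \<le> (\<Sum>x\<in>PiE I (\<lambda>_. X). N x) powr (1/r) * (\<Sum>x\<in>PiE I (\<lambda>_. X). \<sigma> x * G x powr t) powr (1 - 1/r)"
    by (rule Holder_inequality_sum2) (use r fX N \<sigma>[THEN less_imp_le] in auto)
  also have "\<dots> \<le> (\<Sum>x\<in>PiE I (\<lambda>_. X). N x) powr (1/r) * (K * T powr (t / s')) powr (1 - 1/r)"
  proof (intro mult_left_mono powr_mono2)
    have "(\<Sum>x\<in>PiE I (\<lambda>_. X). \<sigma> x * G x powr t) \<le> K * (\<Sum>R\<in>PiE I (\<lambda>_. nodes). (a R powr (s - 1)) powr s') powr (t / s')"
      unfolding G_def K_def t(3)[symmetric]
      by (rule weighted_rect_sum_le[OF C[folded t_def s'_def] s'(1,3) I]) (use \<sigma> rd in auto)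
    then show "(\<Sum>x\<in>PiE I (\<lambda>_. X). \<sigma> x * G x powr t) \<le> K * T powr (t / s')"
      using s' by (simp add: powr_powr T_def)
    show "0 \<le> (\<Sum>x\<in>PiE I (\<lambda>_. X). \<sigma> x * G x powr t)" using \<sigma> by (intro sum_nonneg) (simp add: less_imp_le)
  qed (use r in auto)
  also have "(K * T powr (t / s')) powr (1 - 1/r) = K powr (1 - 1/r) * T powr (1 - 1/s)"
    using K t s' r by (simp add: powr_mult powr_powr flip: t(2) s'(2))
  finally have main: "T \<le> ((\<Sum>x\<in>PiE I (\<lambda>_. X). N x) powr (1/r) * K powr (1 - 1/r)) * T powr (1 - 1/s)"
    by (simp add: mult.assoc)
  \<comment> \<open>In \<open>main\<close> the sum \<open>T\<close> stands on both sides, with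
    exponent below 1 on the right. It is a finite sum, so it can be absorbed once
    \<open>T = 0\<close> has been set apart.\<close>
  have "T \<le> K powr (s * (1 - 1/r)) * (\<Sum>x\<in>PiE I (\<lambda>_. X). N x) powr (s/r)"
  proof (cases "T = 0")
    case False
    then have T0: "T > 0" using T by simp
    have "T powr (1/s) * T powr (1 - 1/s) \<le> ((\<Sum>x\<in>PiE I (\<lambda>_. X). N x) powr (1/r) * K powr (1 - 1/r)) * T powr (1 - 1/s)"
      using main T0 by (simp add: powr_add[symmetric])
    then have "T powr (1/s) \<le> (\<Sum>x\<in>PiE I (\<lambda>_. X). N x) powr (1/r) * K powr (1 - 1/r)"
      using T0 by simp
    then have "(T powr (1/s)) powr s \<le> ((\<Sum>x\<in>PiE I (\<lambda>_. X). N x) powr (1/r) * K powr (1 - 1/r)) powr s"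
      using r s by (intro powr_mono2) auto
    then show ?thesis
      using T0 r s K by (simp add: powr_powr powr_mult mult.commute)
  qed (use K in auto)
  then show ?thesis unfolding T_def a_def K_def t_def .
qed

text \<open>Since \<open>p\<^sub>0 < s < q\<close>, the exponents \<open>s p\<^sub>i / p\<^sub>0\<close> exceed \<open>p\<^sub>i\<close>, which is the room that the Carleson
  embedding needs after Hoelder's inequality over \<open>i\<close>.\<close>

theorem multilinear_rect_sum_le:
  fixes p :: "'m::finite \<Rightarrow> real" and \<sigma> f N :: "'m \<Rightarrow> ('k \<Rightarrow> 'c) \<Rightarrow> real"
  assumes p: "\<And>i. 1 < p i" and p0: "1 / p0 = (\<Sum>i\<in>UNIV. 1 / p i)" and s: "p0 < s" "s < q"
    and Cv: "hedberg_const Cv d s q"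
    and C: "\<And>i. hedberg_const (C i) d ((s * p i / p0) / (s * p i / p0 - 1)) (p i / (p i - 1))"
    and I: "finite I"
    and v: "\<And>x. x \<in> PiE I (\<lambda>_. X) \<Longrightarrow> v x > 0" and rdv: "separate_rd d I v"
    and \<sigma>: "\<And>i x. x \<in> PiE I (\<lambda>_. X) \<Longrightarrow> \<sigma> i x > 0" and rd: "\<And>i. separate_rd d I (\<sigma> i)"
    and N: "\<And>i x. x \<in> PiE I (\<lambda>_. X) \<Longrightarrow> N i x \<ge> 0"
    and f0: "\<And>i x. x \<in> PiE I (\<lambda>_. X) \<Longrightarrow> f i x \<ge> 0"
    and f: "\<And>i x. x \<in> PiE I (\<lambda>_. X) \<Longrightarrow> f i x \<le> N i x powr (1/p i) * \<sigma> i x powr (1 - 1/p i)"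
    and c: "\<And>R. R \<in> PiE I (\<lambda>_. nodes) \<Longrightarrow> c R \<ge> 0"
    and A: "A \<ge> 0" "\<And>R. R \<in> PiE I (\<lambda>_. nodes) \<Longrightarrow>
      c R * sum v (rect I R) powr (1/q) * (\<Prod>i\<in>UNIV. sum (\<sigma> i) (rect I R) powr (1 - 1/p i)) \<le> A"
  shows "(\<Sum>x\<in>PiE I (\<lambda>_. X). v x * (\<Sum>R\<in>PiE I (\<lambda>_. nodes).
           of_bool (x \<in> rect I R) * (c R * (\<Prod>i\<in>UNIV. sum (f i) (rect I R)))) powr q)
    \<le> (Cv powr q) ^ card I * (\<Prod>i\<in>UNIV. (((C i powr (p i/(p i-1))) ^ card I) powr (s * p i / p0 * (1 - 1/p i))) powr (p0 / p i)) powr (q/s)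
       * A powr q * (\<Prod>i\<in>UNIV. (\<Sum>x\<in>PiE I (\<lambda>_. X). N i x) powr (q / p i))"
proof -
  have p0pos: "p0 > 0" by (rule Holder_exponent_pos[OF p p0])
  have ppos: "p i > 0" for i using p[of i] by simp
  have s0: "s > 0" "q > 0" using s p0pos by auto
  define S where "S i = s * p i / p0" for i
  have S: "S i > p i" for i using s p0pos ppos[of i] by (simp add: S_def field_simps)
  define K where "K i = ((C i powr (p i/(p i-1))) ^ card I) powr (S i * (1 - 1/p i))" for i
  have K: "K i \<ge> 0" for i by (simp add: K_def)
  define a where "a i R = sum (\<sigma> i) (rect I R) powr (1/p i - 1) * sum (f i) (rect I R)" for i R
  define b where "b R = A * (\<Prod>i\<in>UNIV. a i R)" for R
  have fX: "finite (PiE I (\<lambda>_. nodes))" using I finite_nodes by (intro finite_PiE) auto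
  have sf: "sum (f i) (rect I R) \<ge> 0" for i R using f0 rect_subset by (intro sum_nonneg) blast
  have a: "a i R \<ge> 0" for i R using sf by (simp add: a_def)
  have Nn: "(\<Sum>x\<in>PiE I (\<lambda>_. X). N i x) \<ge> 0" for i using N by (intro sum_nonneg) auto
  have coef: "c R * (\<Prod>i\<in>UNIV. sum (f i) (rect I R)) \<le> b R * sum v (rect I R) powr (-1/q)"
    if R: "R \<in> PiE I (\<lambda>_. nodes)" for R
  proof -
    define V where "V = sum v (rect I R)"
    have V: "V > 0" unfolding V_def using mass_pos[OF I R, of v] v by blast
    have \<sigma>R: "sum (\<sigma> i) (rect I R) > 0" for i using mass_pos[OF I R, of "\<sigma> i"] \<sigma> by blast
    have "sum (f i) (rect I R) = sum (\<sigma> i) (rect I R) powr (1 - 1/p i) * a i R" for i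
      using \<sigma>R[of i] by (simp add: a_def mult.assoc[symmetric] powr_add[symmetric])
    then have "c R * (\<Prod>i\<in>UNIV. sum (f i) (rect I R))
       = (c R * V powr (1/q) * (\<Prod>i\<in>UNIV. sum (\<sigma> i) (rect I R) powr (1 - 1/p i))) * ((\<Prod>i\<in>UNIV. a i R) * V powr (-1/q))"
      using V by (simp add: prod.distrib powr_minus_divide)
    also have "\<dots> \<le> A * ((\<Prod>i\<in>UNIV. a i R) * V powr (-1/q))"
      using A(2)[OF R] a by (intro mult_right_mono) (auto simp: V_def prod_nonneg)
    finally show ?thesis by (simp add: b_def V_def)
  qed
  have "(\<Sum>x\<in>PiE I (\<lambda>_. X). v x * (\<Sum>R\<in>PiE I (\<lambda>_. nodes).
           of_bool (x \<in> rect I R) * (c R * (\<Prod>i\<in>UNIV. sum (f i) (rect I R)))) powr q)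
    \<le> (\<Sum>x\<in>PiE I (\<lambda>_. X). v x * (\<Sum>R\<in>PiE I (\<lambda>_. nodes).
           of_bool (x \<in> rect I R) * (b R * sum v (rect I R) powr (-1/q))) powr q)"
  proof (intro sum_mono mult_left_mono powr_mono2 sum_nonneg)
    show "0 \<le> of_bool (x \<in> rect I R) * (c R * (\<Prod>i\<in>UNIV. sum (f i) (rect I R)))" if "R \<in> PiE I (\<lambda>_. nodes)" for x R
      using c[OF that] sf by (auto intro!: mult_nonneg_nonneg prod_nonneg)
  qed (use coef v[THEN less_imp_le] s0 in auto)
  also have "\<dots> \<le> (Cv powr q) ^ card I * (\<Sum>R\<in>PiE I (\<lambda>_. nodes). b R powr s) powr (q/s)"
    by (rule weighted_rect_sum_le[OF Cv s0(1) s(2) I v rdv])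
      (use A a in \<open>auto simp: b_def intro!: mult_nonneg_nonneg prod_nonneg\<close>)
  also have "\<dots> \<le> (Cv powr q) ^ card I * (A powr s * (\<Prod>i\<in>UNIV. (K i * (\<Sum>x\<in>PiE I (\<lambda>_. X). N i x) powr (S i / p i)) powr (p0 / p i))) powr (q/s)"
  proof (intro mult_left_mono powr_mono2 sum_nonneg)
    have "(\<Sum>R\<in>PiE I (\<lambda>_. nodes). b R powr s) = A powr s * (\<Sum>R\<in>PiE I (\<lambda>_. nodes). \<Prod>i\<in>UNIV. (a i R powr S i) powr (p0 / p i))"
      unfolding sum_distrib_left
    proof (intro sum.cong refl)
      fix R
      have "(a i R powr S i) powr (p0 / p i) = a i R powr s" for i
        using ppos[of i] p0pos by (simp add: powr_powr S_def)
      then show "b R powr s = A powr s * (\<Prod>i\<in>UNIV. (a i R powr S i) powr (p0 / p i))"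
        using A a by (simp add: b_def powr_mult prod_nonneg prod_powr_distrib)
    qed
    \<comment> \<open>Hoelder's inequality with weights \<open>p0 / p i\<close>, which add up to 1
      by the choice of \<open>p0\<close>; each factor then holds the sum of
      \<open>a i R powr S i\<close>, ready for the embedding.\<close>
    also have "\<dots> \<le> A powr s * (\<Prod>i\<in>UNIV. (\<Sum>R\<in>PiE I (\<lambda>_. nodes). a i R powr S i) powr (p0 / p i))"
    proof (intro mult_left_mono Holder_inequality_sum fX)
      have "(\<Sum>i\<in>UNIV. p0 / p i) = p0 * (1 / p0)" unfolding p0 by (simp add: sum_distrib_left)
      then show "(\<Sum>i\<in>UNIV. p0 / p i) = 1" using p0pos by simp
    qed (use p0pos ppos in auto)
    also have "\<dots> \<le> A powr s * (\<Prod>i\<in>UNIV. (K i * (\<Sum>x\<in>PiE I (\<lambda>_. X). N i x) powr (S i / p i)) powr (p0 / p i))"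
    proof (intro mult_left_mono prod_mono conjI powr_mono2 sum_nonneg)
      fix i
      show "(\<Sum>R\<in>PiE I (\<lambda>_. nodes). a i R powr S i) \<le> K i * (\<Sum>x\<in>PiE I (\<lambda>_. X). N i x) powr (S i / p i)"
        unfolding a_def K_def
        by (rule Carleson_embedding[OF C[of i, folded S_def] p S I \<sigma> rd N f0 f])
    qed (use p0pos ppos[THEN less_imp_le] in auto)
    finally show "(\<Sum>R\<in>PiE I (\<lambda>_. nodes). b R powr s)
      \<le> A powr s * (\<Prod>i\<in>UNIV. (K i * (\<Sum>x\<in>PiE I (\<lambda>_. X). N i x) powr (S i / p i)) powr (p0 / p i))" .
  qed (use s0 in auto)
  also have "(\<Prod>i\<in>UNIV. (K i * (\<Sum>x\<in>PiE I (\<lambda>_. X). N i x) powr (S i / p i)) powr (p0 / p i))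
    = (\<Prod>i\<in>UNIV. K i powr (p0 / p i)) * (\<Prod>i\<in>UNIV. (\<Sum>x\<in>PiE I (\<lambda>_. X). N i x) powr (s / p i))"
    unfolding prod.distrib[symmetric]
  proof (intro prod.cong refl)
    fix i
    have "S i / p i * (p0 / p i) = s / p i" using p0pos ppos[of i] by (simp add: S_def)
    then show "(K i * (\<Sum>x\<in>PiE I (\<lambda>_. X). N i x) powr (S i / p i)) powr (p0 / p i)
      = K i powr (p0 / p i) * (\<Sum>x\<in>PiE I (\<lambda>_. X). N i x) powr (s / p i)"
      using K[of i] by (simp add: powr_mult powr_powr)
  qed
  also have "(A powr s * ((\<Prod>i\<in>UNIV. K i powr (p0 / p i)) * (\<Prod>i\<in>UNIV. (\<Sum>x\<in>PiE I (\<lambda>_. X). N i x) powr (s / p i)))) powr (q/s)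
    = (\<Prod>i\<in>UNIV. K i powr (p0 / p i)) powr (q/s) * A powr q * (\<Prod>i\<in>UNIV. (\<Sum>x\<in>PiE I (\<lambda>_. X). N i x) powr (q / p i))"
  proof -
    have "(\<Prod>i\<in>UNIV. (\<Sum>x\<in>PiE I (\<lambda>_. X). N i x) powr (s / p i)) powr (q/s) = (\<Prod>i\<in>UNIV. ((\<Sum>x\<in>PiE I (\<lambda>_. X). N i x) powr (s / p i)) powr (q/s))"
      by (rule prod_powr_distrib)
    also have "\<dots> = (\<Prod>i\<in>UNIV. (\<Sum>x\<in>PiE I (\<lambda>_. X). N i x) powr (q / p i))"
      using s0 by (simp add: powr_powr)
    finally show ?thesis
      using s0 by (simp add: powr_mult powr_powr prod_nonneg mult_ac)
  qed
  finally show ?thesis by (simp add: K_def S_def mult_ac)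
qed

end

section \<open>Lebesgue measure on block vectors\<close>

lemma mem_box_vec: "x \<in> box l u \<longleftrightarrow> (\<forall>i. x $ i \<in> box (l $ i) (u $ i))"
  for x :: "'a::euclidean_space ^ 'k::finite"
  by (auto simp: mem_box Basis_vec_def inner_axis)

lemma prod_Basis_vec:
  fixes g :: "'a::euclidean_space ^ 'k::finite \<Rightarrow> 'b::comm_monoid_mult"
  shows "prod g Basis = (\<Prod>i\<in>UNIV. \<Prod>b\<in>Basis. g (axis i b))"
proof -
  have B: "(Basis :: ('a ^ 'k) set) = (\<lambda>(i, b). axis i b) ` (UNIV \<times> Basis)"
    by (auto simp: Basis_vec_def)
  have "inj_on (\<lambda>(i, b). axis i b :: 'a ^ 'k) (UNIV \<times> Basis)"
    by (auto simp: inj_on_def axis_eq_axis)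
  then show ?thesis
    unfolding B by (simp add: prod.reindex prod.cartesian_product case_prod_unfold)
qed

lemma measurable_vec_lambda_PiM:
  "(\<lambda>f. (\<chi> i. f i) :: 'a::euclidean_space ^ 'k::finite) \<in> (\<Pi>\<^sub>M i\<in>UNIV. lborel) \<rightarrow>\<^sub>M borel"
proof (rule borel_measurable_euclidean_space[THEN iffD2], intro ballI)
  fix v :: "'a ^ 'k" assume "v \<in> Basis"
  then obtain i b where v: "v = axis i b" by (auto simp: Basis_vec_def)
  show "(\<lambda>f. (\<chi> i. f i) \<bullet> v) \<in> borel_measurable (\<Pi>\<^sub>M i\<in>(UNIV :: 'k set). lborel)"
    unfolding v inner_axis by simp
qed

text \<open>A box of the block space is the product of boxes in the blocks, so the image of the
  product measure gives every box its volume, and this characterises \<open>lborel\<close>.\<close>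

lemma lborel_vec_eq_distr:
  "(lborel :: ('a::euclidean_space ^ 'k::finite) measure) = distr (\<Pi>\<^sub>M i\<in>UNIV. lborel) borel (\<lambda>f. \<chi> i. f i)"
proof (rule lborel_eqI)
  fix l u :: "'a ^ 'k" assume le: "\<And>b. b \<in> Basis \<Longrightarrow> l \<bullet> b \<le> u \<bullet> b"
  interpret product_sigma_finite "\<lambda>_ :: 'k. lborel :: 'a measure" by standard
  have le': "l $ i \<bullet> b \<le> u $ i \<bullet> b" if "b \<in> Basis" for i b
    using le[of "axis i b"] that by (simp add: axis_in_Basis_iff inner_axis)
  have "(\<lambda>f. \<chi> i. f i) -` box l u \<inter> space (\<Pi>\<^sub>M i\<in>UNIV. lborel) = PiE UNIV (\<lambda>i. box (l $ i) (u $ i))"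
    by (auto simp: mem_box_vec space_PiM PiE_def Pi_def)
  then have "emeasure (distr (\<Pi>\<^sub>M i\<in>UNIV. lborel) borel (\<lambda>f. \<chi> i. f i)) (box l u)
     = emeasure (\<Pi>\<^sub>M i\<in>UNIV. lborel) (PiE UNIV (\<lambda>i. box (l $ i) (u $ i)))"
    by (subst emeasure_distr[OF measurable_vec_lambda_PiM]) auto
  also have "\<dots> = (\<Prod>i\<in>UNIV. emeasure lborel (box (l $ i) (u $ i)))"
    by (rule emeasure_PiM) auto
  also have "\<dots> = (\<Prod>i\<in>UNIV. ennreal (\<Prod>b\<in>Basis. (u $ i - l $ i) \<bullet> b))"
    by (intro prod.cong refl emeasure_lborel_box) (use le' in auto)
  also have "\<dots> = ennreal (\<Prod>i\<in>UNIV. \<Prod>b\<in>Basis. (u $ i - l $ i) \<bullet> b)"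
    by (intro prod_ennreal prod_nonneg) (use le' in \<open>auto simp: inner_diff_left\<close>)
  also have "(\<Prod>i\<in>UNIV. \<Prod>b\<in>Basis. (u $ i - l $ i) \<bullet> b) = (\<Prod>b\<in>Basis. (u - l) \<bullet> b)"
    by (simp add: prod_Basis_vec inner_axis)
  finally show "emeasure (distr (\<Pi>\<^sub>M i\<in>UNIV. lborel) borel (\<lambda>f. \<chi> i. f i)) (box l u) = (\<Prod>b\<in>Basis. (u - l) \<bullet> b)" .
qed simp

lemma nn_integral_lborel_vec:
  fixes f :: "'a::euclidean_space ^ 'k::finite \<Rightarrow> ennreal"
  assumes "f \<in> borel_measurable borel"
  shows "(\<integral>\<^sup>+x. f x \<partial>lborel) = (\<integral>\<^sup>+y. f (\<chi> i. y i) \<partial>(\<Pi>\<^sub>M i\<in>UNIV. lborel))"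
  unfolding lborel_vec_eq_distr using assms by (subst nn_integral_distr[OF measurable_vec_lambda_PiM]) auto

lemma measurable_vec_nth[measurable]: "(\<lambda>x. x $ i) \<in> borel_measurable borel"
  for i :: "'k::finite"
  by (intro borel_measurable_continuous_onI continuous_intros)

lemma nn_integral_lborel_vec_prod:
  fixes f :: "'k::finite \<Rightarrow> 'a::euclidean_space \<Rightarrow> ennreal"
  assumes [measurable]: "\<And>i. f i \<in> borel_measurable borel"
  shows "(\<integral>\<^sup>+x. (\<Prod>i\<in>UNIV. f i (x $ i)) \<partial>lborel) = (\<Prod>i\<in>UNIV. \<integral>\<^sup>+t. f i t \<partial>lborel)"
proof -
  interpret product_sigma_finite "\<lambda>_ :: 'k. lborel :: 'a measure" by standard
  have "(\<integral>\<^sup>+x. (\<Prod>i\<in>UNIV. f i (x $ i)) \<partial>lborel) = (\<integral>\<^sup>+y. (\<Prod>i\<in>UNIV. f i (y i)) \<partial>(\<Pi>\<^sub>M i\<in>UNIV. lborel))"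
    by (subst nn_integral_lborel_vec) auto
  also have "\<dots> = (\<Prod>i\<in>UNIV. \<integral>\<^sup>+t. f i t \<partial>lborel)"
    by (rule product_nn_integral_prod) auto
  finally show ?thesis .
qed

lemma AE_lborel_vec_nth:
  fixes i :: "'k::finite"
  assumes "AE t in lborel. P (t :: 'a::euclidean_space)"
  shows "AE x in (lborel :: ('a ^ 'k) measure). P (x $ i)"
proof -
  from assms obtain N where N: "{t. \<not> P t} \<subseteq> N" "N \<in> null_sets lborel"
    by (auto elim!: AE_E simp: null_sets_def)
  have [measurable]: "N \<in> sets borel" using N by auto
  have "emeasure lborel {x :: 'a ^ 'k. x $ i \<in> N} = (\<integral>\<^sup>+x. indicator {x :: 'a ^ 'k. x $ i \<in> N} x \<partial>lborel)"
    by (rule nn_integral_indicator[symmetric]) measurable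
  also have "\<dots> = (\<integral>\<^sup>+x. (\<Prod>j\<in>UNIV. indicator (if j = i then N else UNIV) ((x :: 'a ^ 'k) $ j)) \<partial>lborel)"
  proof (intro nn_integral_cong)
    fix x :: "'a ^ 'k"
    have "(\<Prod>j\<in>UNIV. indicator (if j = i then N else UNIV) (x $ j)) = (\<Prod>j\<in>{i}. indicator N (x $ j) :: ennreal)"
      by (rule prod.mono_neutral_cong_right) auto
    then show "indicator {x. x $ i \<in> N} x = (\<Prod>j\<in>UNIV. indicator (if j = i then N else UNIV) (x $ j) :: ennreal)"
      by (simp add: indicator_def)
  qed
  also have "\<dots> = (\<Prod>j\<in>UNIV. \<integral>\<^sup>+t. indicator (if j = i then N else UNIV) t \<partial>(lborel :: 'a measure))"
    by (rule nn_integral_lborel_vec_prod) auto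
  \<comment> \<open>The other factors are infinite measures of whole spaces, but in
    \<open>ennreal\<close> a single zero factor makes the product zero.\<close>
  also have "\<dots> = 0"
    by (rule prod_zero) (use N in \<open>auto intro!: bexI[of _ i]\<close>)
  finally have "{x :: 'a ^ 'k. x $ i \<in> N} \<in> null_sets lborel"
    by (simp add: null_sets_def)
  then show ?thesis by (rule AE_I') (use N in auto)
qed

lemma AE_lebesgue_iff: "(AE x in lebesgue. P x) \<longleftrightarrow> (AE x in lborel. P x)"
  by (rule AE_completion_iff)

lemma AE_lebesgue_vec_nth:
  fixes i :: "'k::finite"
  assumes "AE t in lebesgue. P (t :: 'a::euclidean_space)"
  shows "AE x in (lebesgue :: ('a ^ 'k) measure). P (x $ i)"
  using assms unfolding AE_lebesgue_iff by (rule AE_lborel_vec_nth)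

text \<open>The assembly map inside \<open>slice\<close>: \<open>slice v j y t\<close> is
  \<open>v (join j y t)\<close>. The value of \<open>y\<close> at \<open>j\<close> is ignored, so
  \<open>y\<close> may come from the product space over \<open>UNIV - {j}\<close>.\<close>

definition join :: "'k \<Rightarrow> ('k \<Rightarrow> 'a) \<Rightarrow> 'a \<Rightarrow> 'a ^ 'k::finite" where
  "join j y t = (\<chi> l. if l = j then t else y l)"

lemma nn_integral_lborel_join:
  fixes f :: "'a::euclidean_space ^ 'k::finite \<Rightarrow> ennreal"
  assumes [measurable]: "f \<in> borel_measurable borel"
  shows "(\<integral>\<^sup>+x. f x \<partial>lborel) = (\<integral>\<^sup>+y. (\<integral>\<^sup>+t. f (join j y t) \<partial>lborel) \<partial>(\<Pi>\<^sub>M l\<in>UNIV - {j}. lborel))"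
proof -
  interpret product_sigma_finite "\<lambda>_ :: 'k. lborel :: 'a measure" by standard
  have U: "insert j (UNIV - {j}) = UNIV" by auto
  have [measurable]: "(\<lambda>y. f (\<chi> i. y i)) \<in> borel_measurable (Pi\<^sub>M UNIV (\<lambda>_. lborel))"
    by (rule measurable_compose[OF measurable_vec_lambda_PiM]) simp
  have "(\<integral>\<^sup>+x. f x \<partial>lborel) = (\<integral>\<^sup>+y. f (\<chi> i. y i) \<partial>(\<Pi>\<^sub>M i\<in>insert j (UNIV - {j}). lborel))"
    unfolding U by (rule nn_integral_lborel_vec) simp
  also have "\<dots> = (\<integral>\<^sup>+y. (\<integral>\<^sup>+t. f (\<chi> i. (y(j := t)) i) \<partial>lborel) \<partial>(\<Pi>\<^sub>M l\<in>UNIV - {j}. lborel))"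
    by (rule product_nn_integral_insert) (auto simp: U)
  also have "\<dots> = (\<integral>\<^sup>+y. (\<integral>\<^sup>+t. f (join j y t) \<partial>lborel) \<partial>(\<Pi>\<^sub>M l\<in>UNIV - {j}. lborel))"
    by (simp add: join_def fun_upd_def)
  finally show ?thesis .
qed

lemma measurable_join:
  "(\<lambda>(y, t). join j y t :: 'a::euclidean_space ^ 'k::finite) \<in> (\<Pi>\<^sub>M l\<in>UNIV - {j}. lborel) \<Otimes>\<^sub>M lborel \<rightarrow>\<^sub>M borel"
proof (rule borel_measurable_euclidean_space[THEN iffD2], intro ballI)
  fix v :: "'a ^ 'k" assume "v \<in> Basis"
  then obtain i b where v: "v = axis i b" by (auto simp: Basis_vec_def)
  show "(\<lambda>z. (case z of (y, t) \<Rightarrow> join j y t) \<bullet> v) \<in> borel_measurable ((\<Pi>\<^sub>M l\<in>UNIV - {j}. lborel) \<Otimes>\<^sub>M lborel)"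
  proof (cases "i = j")
    case True
    then show ?thesis unfolding v inner_axis by (simp add: join_def case_prod_unfold)
  next
    case False
    then have "i \<in> UNIV - {j}" by auto
    from measurable_component_singleton[OF this, of "\<lambda>_. lborel :: 'a measure"]
    have "(\<lambda>z. fst z i) \<in> borel_measurable ((\<Pi>\<^sub>M l\<in>UNIV - {j}. (lborel :: 'a measure)) \<Otimes>\<^sub>M (lborel :: 'a measure))"
      by (intro measurable_compose[OF measurable_fst]) simp
    then show ?thesis unfolding v inner_axis using False by (simp add: join_def case_prod_unfold)
  qed
qed

text \<open>By Tonelli almost every slice of a null set is null. This allows a Borel version of the
  weight to replace the weight inside almost every slice, where the
  \<open>A_infty_separately\<close> condition speaks about the weight itself.\<close>

lemma AE_lborel_join:
  assumes "AE x in (lborel :: ('a::euclidean_space ^ 'k::finite) measure). P x"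
  shows "AE y in (\<Pi>\<^sub>M l\<in>UNIV - {j}. lborel). AE t in lborel. P (join j y t)"
proof -
  interpret F: finite_product_sigma_finite "\<lambda>_ :: 'k. lborel :: 'a measure" "UNIV - {j}"
    by standard auto
  from assms obtain N where N: "{t. \<not> P t} \<subseteq> N" "N \<in> null_sets lborel"
    by (auto elim!: AE_E simp: null_sets_def)
  have [measurable]: "N \<in> sets borel" using N by auto
  have m: "(\<lambda>(y, t). indicator N (join j y t) :: ennreal) \<in> borel_measurable ((\<Pi>\<^sub>M l\<in>UNIV - {j}. lborel) \<Otimes>\<^sub>M lborel)"
    using measurable_compose[OF measurable_join, of "indicator N" borel j] by (simp add: case_prod_unfold)
  then have [measurable]: "(\<lambda>y. \<integral>\<^sup>+t. indicator N (join j y t) \<partial>lborel) \<in> borel_measurable (\<Pi>\<^sub>M l\<in>UNIV - {j}. lborel)"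
    by (rule lborel.borel_measurable_nn_integral)
  have "(\<integral>\<^sup>+y. (\<integral>\<^sup>+t. indicator N (join j y t) \<partial>lborel) \<partial>(\<Pi>\<^sub>M l\<in>UNIV - {j}. lborel)) = (\<integral>\<^sup>+x. indicator N x \<partial>lborel)"
    by (rule nn_integral_lborel_join[symmetric]) simp
  also have "\<dots> = 0" using N by auto
  finally have null: "AE y in (\<Pi>\<^sub>M l\<in>UNIV - {j}. lborel). (\<integral>\<^sup>+t. indicator N (join j y t) \<partial>lborel) = 0"
    by (subst (asm) nn_integral_0_iff_AE) auto
  have slice: "AE t in lborel. P (join j y t)"
    if y: "y \<in> space (\<Pi>\<^sub>M l\<in>UNIV - {j}. lborel)" "(\<integral>\<^sup>+t. indicator N (join j y t) \<partial>lborel) = 0" for y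
  proof -
    have [measurable]: "(\<lambda>t. indicator N (join j y t) :: ennreal) \<in> borel_measurable lborel"
      using measurable_compose[OF measurable_Pair1'[OF y(1)] m] by simp
    have "AE t in lborel. indicator N (join j y t) = (0 :: ennreal)"
      using y(2) by (subst (asm) nn_integral_0_iff_AE) auto
    then show ?thesis
      by eventually_elim (use N in \<open>auto simp: indicator_eq_0_iff\<close>)
  qed
  from AE_space null show ?thesis by eventually_elim (rule slice)
qed

section \<open>Reverse doubling on rectangles\<close>

text \<open>Young's inequality after division by \<open>A\<close> and \<open>B\<close>. The
  integrals enter only through finite upper bounds, so that the result is an inequality between real
  numbers; a zero bound forces the integrand to vanish almost everywhere.\<close>

lemma nn_integral_Holder:
  fixes f g :: "'a \<Rightarrow> real"
  assumes [measurable]: "f \<in> borel_measurable M" "g \<in> borel_measurable M"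
    and f: "\<And>x. f x \<ge> 0" and g: "\<And>x. g x \<ge> 0" and \<theta>: "0 < \<theta>" "\<theta> < 1"
    and A: "(\<integral>\<^sup>+x. ennreal (f x) \<partial>M) \<le> ennreal A" "A \<ge> 0" and B: "(\<integral>\<^sup>+x. ennreal (g x) \<partial>M) \<le> ennreal B" "B \<ge> 0"
  shows "(\<integral>\<^sup>+x. ennreal (f x powr \<theta> * g x powr (1 - \<theta>)) \<partial>M) \<le> ennreal (A powr \<theta> * B powr (1 - \<theta>))"
proof (cases "A = 0 \<or> B = 0")
  case True
  have "AE x in M. f x powr \<theta> * g x powr (1 - \<theta>) = 0"
  proof (cases "A = 0")
    case True
    then have "(\<integral>\<^sup>+x. ennreal (f x) \<partial>M) = 0" using A by simp
    then have "AE x in M. ennreal (f x) = 0" by (subst (asm) nn_integral_0_iff_AE) auto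
    then show ?thesis by eventually_elim (use f in \<open>auto simp: ennreal_eq_0_iff dest: antisym\<close>)
  next
    case False
    then have "(\<integral>\<^sup>+x. ennreal (g x) \<partial>M) = 0" using B \<open>A = 0 \<or> B = 0\<close> by simp
    then have "AE x in M. ennreal (g x) = 0" by (subst (asm) nn_integral_0_iff_AE) auto
    then show ?thesis by eventually_elim (use g in \<open>auto simp: ennreal_eq_0_iff dest: antisym\<close>)
  qed
  then have "(\<integral>\<^sup>+x. ennreal (f x powr \<theta> * g x powr (1 - \<theta>)) \<partial>M) = (\<integral>\<^sup>+x. 0 \<partial>M)"
    by (intro nn_integral_cong_AE) auto
  then show ?thesis by simp
next
  case False
  then have pos: "A > 0" "B > 0" using A B by auto
  define D where "D = A powr \<theta> * B powr (1 - \<theta>)"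
  have D: "D > 0" using pos by (simp add: D_def)
  have "f x powr \<theta> * g x powr (1 - \<theta>) \<le> (D * \<theta> / A) * f x + (D * (1 - \<theta>) / B) * g x" for x
  proof (cases "f x = 0 \<or> g x = 0")
    case True
    then show ?thesis using f[of x] g[of x] pos D \<theta> by (auto simp: powr_0)
  next
    case False
    then have fg: "f x > 0" "g x > 0" using f[of x] g[of x] by auto
    have "(f x / A) powr \<theta> * (g x / B) powr (1 - \<theta>) \<le> \<theta> * (f x / A) + (1 - \<theta>) * (g x / B)"
      by (rule Youngs_inequality_0) (use \<theta> fg pos in auto)
    then have "D * ((f x / A) powr \<theta> * (g x / B) powr (1 - \<theta>)) \<le> D * (\<theta> * (f x / A) + (1 - \<theta>) * (g x / B))"
      using D by simp
    moreover have "D * ((f x / A) powr \<theta> * (g x / B) powr (1 - \<theta>)) = f x powr \<theta> * g x powr (1 - \<theta>)"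
      using pos by (simp add: D_def powr_divide)
    ultimately show ?thesis by (simp add: algebra_simps)
  qed
  then have "(\<integral>\<^sup>+x. ennreal (f x powr \<theta> * g x powr (1 - \<theta>)) \<partial>M)
    \<le> (\<integral>\<^sup>+x. ennreal (D * \<theta> / A) * ennreal (f x) + ennreal (D * (1 - \<theta>) / B) * ennreal (g x) \<partial>M)"
    using D \<theta> pos f g
    by (intro nn_integral_mono) (simp flip: ennreal_mult ennreal_plus)
  also have "\<dots> = ennreal (D * \<theta> / A) * (\<integral>\<^sup>+x. ennreal (f x) \<partial>M) + ennreal (D * (1 - \<theta>) / B) * (\<integral>\<^sup>+x. ennreal (g x) \<partial>M)"
    by (subst nn_integral_add) (auto simp: nn_integral_cmult)
  also have "\<dots> \<le> ennreal (D * \<theta> / A) * ennreal A + ennreal (D * (1 - \<theta>) / B) * ennreal B"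
    using A B by (intro add_mono mult_left_mono) auto
  also have "\<dots> = ennreal D"
    using D \<theta> pos by (simp flip: ennreal_mult ennreal_plus add: field_simps)
  finally show ?thesis by (simp add: D_def)
qed

text \<open>Weights and test functions are only Lebesgue measurable, whereas the Tonelli arguments
  are carried out for Borel functions. Each of them starts by passing to a nonnegative Borel
  version.\<close>

lemma borel_representative:
  fixes f :: "'a::euclidean_space \<Rightarrow> real"
  assumes "f \<in> borel_measurable lebesgue" "AE x in lebesgue. f x \<ge> 0"
  obtains g where "g \<in> borel_measurable borel" "\<And>x. g x \<ge> 0" "AE x in lborel. f x = g x"
proof -
  obtain h where h: "h \<in> borel_measurable lborel" "AE x in lborel. f x = h x"
    using completion_ex_borel_measurable_real[OF assms(1)] by auto
  have "AE x in lborel. f x = max 0 (h x)"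
    using h(2) assms(2)[unfolded AE_lebesgue_iff] by eventually_elim auto
  with h(1) show ?thesis by (intro that[of "\<lambda>x. max 0 (h x)"]) auto
qed

lemma borel_block_prod[measurable]:
  assumes "\<And>s. Q s \<in> sets borel"
  shows "block_prod Q \<in> sets (borel :: (real ^ 'n::finite ^ 'k::finite) measure)"
proof -
  have "block_prod Q = (\<Inter>s\<in>UNIV. (\<lambda>x. x $ s) -` Q s \<inter> space borel)"
    by (auto simp: block_prod_def)
  also have "\<dots> \<in> sets borel"
    by (intro sets.finite_INT) (use assms in \<open>auto intro: measurable_sets_borel[OF measurable_vec_nth]\<close>)
  finally show ?thesis .
qed

lemma indicator_block_prod:
  "(indicator (block_prod Q) x :: ennreal) = (\<Prod>j\<in>UNIV. indicator (Q j) (x $ j))"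
proof (cases "x \<in> block_prod Q")
  case False
  then obtain j where "x $ j \<notin> Q j" by (auto simp: block_prod_def)
  then have "(\<Prod>j\<in>UNIV. indicator (Q j) (x $ j) :: ennreal) = 0"
    by (intro prod_zero bexI[of _ j]) auto
  with False show ?thesis by simp
qed (simp add: block_prod_def)

lemma borel_cube[measurable]: "cube a l \<in> sets borel" "subcube a l S \<in> sets borel"
  by (simp_all add: cube_def subcube_def)

lemma rect_integral_product:
  fixes W :: "'k::finite \<Rightarrow> real ^ 'n::finite \<Rightarrow> real" and \<sigma> :: "real ^ 'n ^ 'k \<Rightarrow> real"
  assumes Wm: "\<And>j. W j \<in> borel_measurable lebesgue" and W0: "\<And>j t. W j t \<ge> 0"
    and \<sigma>: "AE x in lebesgue. \<sigma> x = (\<Prod>j\<in>UNIV. W j (x $ j))" and Q[measurable]: "\<And>j. Q j \<in> sets borel"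
  shows "(\<integral>\<^sup>+x\<in>block_prod Q. ennreal (\<sigma> x) \<partial>lebesgue) = (\<Prod>j\<in>UNIV. \<integral>\<^sup>+t\<in>Q j. ennreal (W j t) \<partial>lebesgue)"
proof -
  have "\<exists>g. g \<in> borel_measurable borel \<and> (\<forall>x. g x \<ge> 0) \<and> (AE x in lborel. W j x = g x)" for j
  proof -
    have "AE x in lebesgue. 0 \<le> W j x" using W0 by simp
    from borel_representative[OF Wm this] show ?thesis by blast
  qed
  then have "\<forall>j. \<exists>g. g \<in> borel_measurable borel \<and> (\<forall>x. g x \<ge> 0) \<and> (AE x in lborel. W j x = g x)" ..
  from choice[OF this] obtain g where "\<forall>j. g j \<in> borel_measurable borel \<and> (\<forall>x. g j x \<ge> 0) \<and> (AE x in lborel. W j x = g j x)" ..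
  then have g[measurable]: "\<And>j. g j \<in> borel_measurable borel" and g0: "\<And>j x. g j x \<ge> 0"
    and Wg: "\<And>j. AE x in lborel. W j x = g j x" by simp_all
  have "AE x in lborel. \<forall>j\<in>UNIV. W j ((x :: real ^ 'n ^ 'k) $ j) = g j (x $ j)"
    by (subst AE_finite_all) (simp_all add: AE_lborel_vec_nth[OF Wg])
  with \<sigma>[unfolded AE_lebesgue_iff]
  have ae: "AE x in lborel. ennreal (\<sigma> x) * indicator (block_prod Q) x = (\<Prod>j\<in>UNIV. ennreal (g j (x $ j)) * indicator (Q j) (x $ j))"
  proof eventually_elim
    case (elim x)
    then show ?case using g0 by (simp add: indicator_block_prod prod.distrib prod_ennreal)
  qed
  have "(\<integral>\<^sup>+x\<in>block_prod Q. ennreal (\<sigma> x) \<partial>lebesgue) = (\<integral>\<^sup>+x. (\<Prod>j\<in>UNIV. ennreal (g j (x $ j)) * indicator (Q j) (x $ j)) \<partial>lebesgue)"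
    by (intro nn_integral_cong_AE) (use ae in \<open>simp add: AE_lebesgue_iff\<close>)
  also have "\<dots> = (\<integral>\<^sup>+x. (\<Prod>j\<in>UNIV. ennreal (g j (x $ j)) * indicator (Q j) (x $ j)) \<partial>lborel)"
    by (rule nn_integral_completion)
  also have "\<dots> = (\<Prod>j\<in>UNIV. \<integral>\<^sup>+t. ennreal (g j t) * indicator (Q j) t \<partial>lborel)"
    by (rule nn_integral_lborel_vec_prod) measurable
  also have "\<dots> = (\<Prod>j\<in>UNIV. \<integral>\<^sup>+t\<in>Q j. ennreal (W j t) \<partial>lebesgue)"
  proof (intro prod.cong refl)
    fix j
    have "(\<integral>\<^sup>+t\<in>Q j. ennreal (W j t) \<partial>lebesgue) = (\<integral>\<^sup>+t. ennreal (g j t) * indicator (Q j) t \<partial>lebesgue)"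
      by (intro nn_integral_cong_AE) (use Wg[of j] in \<open>auto simp: AE_lebesgue_iff\<close>)
    then show "(\<integral>\<^sup>+t. ennreal (g j t) * indicator (Q j) t \<partial>lborel) = (\<integral>\<^sup>+t\<in>Q j. ennreal (W j t) \<partial>lebesgue)"
      by (simp add: nn_integral_completion)
  qed
  finally show ?thesis .
qed

lemma set_nn_integral_eq_set_integral:
  assumes "set_integrable M A f" "\<And>x. f x \<ge> (0::real)"
  shows "(\<integral>\<^sup>+x\<in>A. ennreal (f x) \<partial>M) = ennreal (LINT x:A|M. f x)"
proof -
  have "(\<integral>\<^sup>+x\<in>A. ennreal (f x) \<partial>M) = (\<integral>\<^sup>+x. ennreal (indicator A x *\<^sub>R f x) \<partial>M)"
    by (intro nn_integral_cong) (simp add: indicator_def)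
  also have "\<dots> = ennreal (LINT x:A|M. f x)"
    unfolding set_lebesgue_integral_def
    by (rule nn_integral_eq_integral) (use assms in \<open>auto simp: set_integrable_def\<close>)
  finally show ?thesis .
qed

text \<open>The common form to which the product hypothesis on the \<open>w i\<close> and the
  \<open>A_infty_separately\<close> hypothesis on \<open>u\<close> are both reduced: only the side
  in block \<open>s\<close> shrinks, and masses of whole rectangles are compared. Nonnegative
  integrals keep it meaningful without integrability.\<close>

definition rect_rd :: "real \<Rightarrow> (real ^ 'n::finite ^ 'k::finite \<Rightarrow> real) \<Rightarrow> bool" where
  "rect_rd d v \<longleftrightarrow> (\<forall>a l s S. (\<forall>r. 0 < l r) \<longrightarrow>
     ennreal d * (\<integral>\<^sup>+x\<in>block_prod ((\<lambda>r. cube (a r) (l r))(s := subcube (a s) (l s) S)). ennreal (v x) \<partial>lebesgue)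
       \<le> (\<integral>\<^sup>+x\<in>block_prod (\<lambda>r. cube (a r) (l r)). ennreal (v x) \<partial>lebesgue))"

lemma rect_rd_mono:
  assumes "rect_rd d v" "d' \<le> d"
  shows "rect_rd d' v"
  unfolding rect_rd_def
proof (intro allI impI)
  fix a l s S assume l: "\<forall>r. 0 < (l :: 'b \<Rightarrow> real) r"
  let ?X = "\<integral>\<^sup>+x\<in>block_prod ((\<lambda>r. cube (a r) (l r))(s := subcube (a s) (l s) S)). ennreal (v x) \<partial>lebesgue"
  have "ennreal d' * ?X \<le> ennreal d * ?X" by (intro mult_right_mono ennreal_leI assms(2)) simp
  also have "\<dots> \<le> (\<integral>\<^sup>+x\<in>block_prod (\<lambda>r. cube (a r) (l r)). ennreal (v x) \<partial>lebesgue)"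
    using assms(1) l unfolding rect_rd_def by blast
  finally show "ennreal d' * ?X \<le> (\<integral>\<^sup>+x\<in>block_prod (\<lambda>r. cube (a r) (l r)). ennreal (v x) \<partial>lebesgue)" .
qed

text \<open>The minimum of finitely many constants above 1 is still above 1. This merges the
  constants of the separate variables and of the separate weights into one.\<close>

lemma uniform_constant:
  fixes P :: "'i::finite \<Rightarrow> real \<Rightarrow> bool"
  assumes ex: "\<And>i. \<exists>d>1. P i d" and mono: "\<And>i d d'. P i d \<Longrightarrow> d' \<le> d \<Longrightarrow> P i d'"
  shows "\<exists>d>1. \<forall>i. P i d"
proof -
  from ex obtain d where d: "\<And>i. d i > 1" "\<And>i. P i (d i)" by metis
  define d0 where "d0 = Min (range d)"
  have "d0 > 1" unfolding d0_def using d(1) by (subst Min_gr_iff) auto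
  moreover have "P i d0" for i by (rule mono[OF d(2)[of i]]) (simp add: d0_def)
  ultimately show ?thesis by blast
qed

text \<open>The mass of a rectangle is the product of the masses of its sides, and passing to the
  subcube in block \<open>s\<close> alters only the factor of that block.\<close>

lemma rect_rd_product:
  fixes W :: "'k::finite \<Rightarrow> real ^ 'n::finite \<Rightarrow> real" and \<sigma> :: "real ^ 'n ^ 'k \<Rightarrow> real"
  assumes RD: "\<And>j. reverse_doubling (W j)" and W0: "\<And>j t. W j t \<ge> 0"
    and \<sigma>: "AE x in lebesgue. \<sigma> x = (\<Prod>j\<in>UNIV. W j (x $ j))"
  shows "\<exists>d>1. rect_rd d \<sigma>"
proof -
  have w: "weight (W j)" for j using RD by (auto simp: reverse_doubling_def)
  have eq: "(\<integral>\<^sup>+x\<in>block_prod Q. ennreal (\<sigma> x) \<partial>lebesgue) = (\<Prod>j\<in>UNIV. \<integral>\<^sup>+t\<in>Q j. ennreal (W j t) \<partial>lebesgue)"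
    if "\<And>j. Q j \<in> sets borel" for Q
    by (rule rect_integral_product[OF _ W0 \<sigma> that]) (use w in \<open>auto simp: weight_def\<close>)
  have "\<exists>d>1. \<forall>j. \<forall>a l S. 0 < l \<longrightarrow> ennreal d * (\<integral>\<^sup>+t\<in>subcube a l S. ennreal (W j t) \<partial>lebesgue)
      \<le> (\<integral>\<^sup>+t\<in>cube a l. ennreal (W j t) \<partial>lebesgue)"
  proof (rule uniform_constant)
    fix j
    obtain d where d: "d > 1" "\<And>a l S. 0 < l \<Longrightarrow> d * (LINT x:subcube a l S|lebesgue. W j x) \<le> (LINT x:cube a l|lebesgue. W j x)"
      using RD[of j] unfolding reverse_doubling_def by blast
    have int: "set_integrable lebesgue (cube a l) (W j)" "set_integrable lebesgue (subcube a l S) (W j)" for a l S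
      using w[of j] by (auto simp: weight_def cube_def subcube_def)
    have "ennreal d * (\<integral>\<^sup>+t\<in>subcube a l S. ennreal (W j t) \<partial>lebesgue)
      \<le> (\<integral>\<^sup>+t\<in>cube a l. ennreal (W j t) \<partial>lebesgue)" if "l > 0" for a l S
      using d int W0 that
      by (simp add: set_nn_integral_eq_set_integral ennreal_mult'[symmetric] ennreal_leI)
    with d show "\<exists>d>1. \<forall>a l S. 0 < l \<longrightarrow> ennreal d * (\<integral>\<^sup>+t\<in>subcube a l S. ennreal (W j t) \<partial>lebesgue)
      \<le> (\<integral>\<^sup>+t\<in>cube a l. ennreal (W j t) \<partial>lebesgue)" by blast
  next
    fix j d d'
    assume *: "\<forall>a l S. 0 < l \<longrightarrow> ennreal d * (\<integral>\<^sup>+t\<in>subcube a l S. ennreal (W j t) \<partial>lebesgue)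
      \<le> (\<integral>\<^sup>+t\<in>cube a l. ennreal (W j t) \<partial>lebesgue)" and "d' \<le> d"
    show "\<forall>a l S. 0 < l \<longrightarrow> ennreal d' * (\<integral>\<^sup>+t\<in>subcube a l S. ennreal (W j t) \<partial>lebesgue)
      \<le> (\<integral>\<^sup>+t\<in>cube a l. ennreal (W j t) \<partial>lebesgue)"
      using * by (blast intro: order_trans[OF mult_right_mono[OF ennreal_leI[OF \<open>d' \<le> d\<close>] zero_le]])
  qed
  then obtain d where d: "d > 1" "\<And>j a l S. 0 < l \<Longrightarrow> ennreal d * (\<integral>\<^sup>+t\<in>subcube a l S. ennreal (W j t) \<partial>lebesgue)
      \<le> (\<integral>\<^sup>+t\<in>cube a l. ennreal (W j t) \<partial>lebesgue)" by blast
  have "rect_rd d \<sigma>"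
    unfolding rect_rd_def
  proof (intro allI impI)
    fix a :: "'k \<Rightarrow> real ^ 'n" and l s S assume l: "\<forall>r. 0 < (l :: 'k \<Rightarrow> real) r"
    let ?g = "\<lambda>Q j. \<integral>\<^sup>+t\<in>Q. ennreal (W j t) \<partial>lebesgue"
    have "(\<integral>\<^sup>+x\<in>block_prod ((\<lambda>r. cube (a r) (l r))(s := subcube (a s) (l s) S)). ennreal (\<sigma> x) \<partial>lebesgue)
       = (\<Prod>j\<in>UNIV. ?g (((\<lambda>r. cube (a r) (l r))(s := subcube (a s) (l s) S)) j) j)"
      by (rule eq) auto
    also have "\<dots> = ?g (subcube (a s) (l s) S) s * (\<Prod>j\<in>UNIV - {s}. ?g (cube (a j) (l j)) j)"
      by (subst prod.remove[of UNIV s]) (auto intro!: prod.cong)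
    finally have "ennreal d * (\<integral>\<^sup>+x\<in>block_prod ((\<lambda>r. cube (a r) (l r))(s := subcube (a s) (l s) S)). ennreal (\<sigma> x) \<partial>lebesgue)
       = (ennreal d * ?g (subcube (a s) (l s) S) s) * (\<Prod>j\<in>UNIV - {s}. ?g (cube (a j) (l j)) j)"
      by (simp add: mult.assoc)
    also have "\<dots> \<le> ?g (cube (a s) (l s)) s * (\<Prod>j\<in>UNIV - {s}. ?g (cube (a j) (l j)) j)"
      by (intro mult_right_mono d) (use l in auto)
    also have "\<dots> = (\<Prod>j\<in>UNIV. ?g (cube (a j) (l j)) j)"
      by (simp add: prod.remove[of UNIV s "\<lambda>j. ?g (cube (a j) (l j)) j"])
    also have "\<dots> = (\<integral>\<^sup>+x\<in>block_prod (\<lambda>r. cube (a r) (l r)). ennreal (\<sigma> x) \<partial>lebesgue)"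
      by (rule eq[symmetric]) auto
    finally show "ennreal d * (\<integral>\<^sup>+x\<in>block_prod ((\<lambda>r. cube (a r) (l r))(s := subcube (a s) (l s) S)). ennreal (\<sigma> x) \<partial>lebesgue)
       \<le> (\<integral>\<^sup>+x\<in>block_prod (\<lambda>r. cube (a r) (l r)). ennreal (\<sigma> x) \<partial>lebesgue)" .
  qed
  with d(1) show ?thesis by blast
qed

section \<open>Reverse doubling of Muckenhoupt weights\<close>

lemma ennreal_less_infinityE:
  assumes "x < (\<infinity> :: ennreal)"
  obtains r where "x = ennreal r" "r \<ge> 0"
  using assms by (cases x) auto

lemma emeasure_lborel_cube:
  fixes a :: "real ^ 'n::finite"
  assumes "l \<ge> 0"
  shows "emeasure lborel (cube a l) = ennreal (l ^ CARD('n))"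
proof -
  have ne: "cbox a (\<chi> i. a $ i + l) \<noteq> {}"
    using assms by (auto simp: mem_box_cart intro!: exI[of _ a] simp flip: ex_in_conv)
  have "emeasure lborel (cube a l) = ennreal (measure lborel (cbox a (\<chi> i. a $ i + l)))"
    unfolding cube_def by (intro emeasure_eq_ennreal_measure) (use emeasure_lborel_cbox_finite[of a "\<chi> i. a $ i + l"] in auto)
  then show ?thesis using content_cbox_cart[OF ne] by simp
qed

lemma subcube_subset: "l \<ge> 0 \<Longrightarrow> subcube a l S \<subseteq> cube a l"
proof
  fix x assume "l \<ge> 0" "x \<in> subcube a l S"
  then have *: "(if i \<in> S then a $ i + l / 2 else a $ i) \<le> x $ i \<and> x $ i \<le> (if i \<in> S then a $ i + l / 2 else a $ i) + l / 2" for i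
    by (auto simp: subcube_def cube_def mem_box_cart)
  then show "x \<in> cube a l"
    unfolding cube_def mem_box_cart
  proof (intro allI)
    fix i show "a $ i \<le> x $ i \<and> x $ i \<le> (\<chi> i. a $ i + l) $ i"
      using *[of i] \<open>l \<ge> 0\<close> by (auto split: if_splits)
  qed
qed

text \<open>A subcube takes the share \<open>2^-n\<close>, at most one half because the dimension is
  at least 1. The crude half is kept since it leaves the later constants free of the
  dimension.\<close>

lemma emeasure_cube_diff_subcube:
  fixes a :: "real ^ 'n::finite"
  assumes "l > 0"
  shows "ennreal (l ^ CARD('n) / 2) \<le> emeasure lborel (cube a l - subcube a l S)"
proof -
  have "emeasure lborel (cube a l - subcube a l S) = ennreal (l ^ CARD('n)) - ennreal ((l / 2) ^ CARD('n))"
    using assms subcube_subset[of l a S] emeasure_lborel_cube[of l a]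
      emeasure_lborel_cube[of "l / 2" "\<chi> i. if i \<in> S then a $ i + l / 2 else a $ i"]
    by (subst emeasure_Diff) (auto simp: subcube_def)
  also have "\<dots> = ennreal (l ^ CARD('n) - (l / 2) ^ CARD('n))"
    using assms by (simp add: ennreal_minus)
  also have "\<dots> \<ge> ennreal (l ^ CARD('n) / 2)"
  proof (rule ennreal_leI)
    have "(l / 2) ^ CARD('n) = l ^ CARD('n) * (1/2) ^ CARD('n)" by (simp add: power_divide)
    also have "\<dots> \<le> l ^ CARD('n) * (1/2) ^ 1"
      using assms by (intro mult_left_mono power_decreasing) (auto simp: Suc_leI)
    finally show "l ^ CARD('n) / 2 \<le> l ^ CARD('n) - (l / 2) ^ CARD('n)" by simp
  qed
  finally show ?thesis .
qed

lemma set_nn_integral_pos: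
  fixes \<mu> :: "'a::euclidean_space \<Rightarrow> real"
  assumes "\<mu> \<in> borel_measurable lebesgue" "ae_positive \<mu>" "A \<in> sets borel" "emeasure lborel A > 0"
  shows "(\<integral>\<^sup>+x\<in>A. ennreal (\<mu> x) \<partial>lebesgue) > 0"
proof (rule ccontr)
  assume "\<not> ?thesis"
  then have "(\<integral>\<^sup>+x\<in>A. ennreal (\<mu> x) \<partial>lebesgue) = 0" by (simp add: not_gr_zero)
  moreover have [measurable]: "A \<in> sets lebesgue" "\<mu> \<in> borel_measurable lebesgue" using assms by auto
  ultimately have "AE x in lebesgue. ennreal (\<mu> x) * indicator A x = 0"
    by (subst (asm) nn_integral_0_iff_AE) auto
  with assms(2)[unfolded ae_positive_def] have "AE x in lebesgue. x \<notin> A"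
    by eventually_elim (auto simp: indicator_def ennreal_eq_0_iff split: if_splits)
  then have "AE x in lborel. x \<notin> A" unfolding AE_lebesgue_iff .
  then have "emeasure lborel A = 0" using assms(3) by (subst (asm) AE_iff_measurable[of A]) auto
  then show False using assms(4) by simp
qed

lemma set_nn_integral_mono_set:
  assumes "A \<subseteq> B"
  shows "(\<integral>\<^sup>+x\<in>A. f x \<partial>M) \<le> (\<integral>\<^sup>+x\<in>B. f x \<partial>M :: ennreal)"
  by (intro nn_integral_mono) (use assms in \<open>auto simp: indicator_def\<close>)

lemma weight_finite:
  assumes "weight \<mu>" "compact K"
  shows "(\<integral>\<^sup>+x\<in>K. ennreal (\<mu> x) \<partial>lebesgue) < \<infinity>"
proof -
  have "integrable lebesgue (\<lambda>x. indicator K x *\<^sub>R \<mu> x)"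
    using assms by (auto simp: weight_def set_integrable_def)
  then have "(\<integral>\<^sup>+x. ennreal (norm (indicator K x *\<^sub>R \<mu> x)) \<partial>lebesgue) < \<infinity>"
    by (simp add: integrable_iff_bounded)
  moreover have "(\<integral>\<^sup>+x\<in>K. ennreal (\<mu> x) \<partial>lebesgue) \<le> (\<integral>\<^sup>+x. ennreal (norm (indicator K x *\<^sub>R \<mu> x)) \<partial>lebesgue)"
    by (intro nn_integral_mono) (auto simp: indicator_def intro!: ennreal_leI)
  ultimately show ?thesis by order
qed

lemma compact_cube: "compact (cube a l)" by (simp add: cube_def)

text \<open>For \<open>r > 1\<close> write 1 on \<open>E\<close> as
  \<open>\<mu> powr (1/r) * \<sigma> powr (1 - 1/r)\<close> with the dual weight
  \<open>\<sigma>\<close>. Hoelder's inequality bounds the volume of \<open>E\<close> by the mass of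
  \<open>E\<close> and the \<open>\<sigma>\<close>-mass of the whole cube, and the
  \<open>Ar_const\<close> bound trades the latter for the mass of the cube. For \<open>r = 1\<close>
  the essential infimum is compared with the average over \<open>E\<close>. The factor 2 in the
  constant is the inverse of the volume share of \<open>E\<close>.\<close>

lemma Muckenhoupt_subset:
  fixes \<mu> :: "real ^ 'n::finite \<Rightarrow> real"
  assumes \<mu>: "Muckenhoupt r \<mu>" and r: "r \<ge> 1" and C: "Ar_const r \<mu> \<le> ennreal C" "C > 0" and l: "l > 0"
    and E: "E \<subseteq> cube a l" "E \<in> sets borel" "emeasure lborel E \<ge> ennreal (l ^ CARD('n) / 2)"
  shows "ennreal ((1 / (2 * C)) powr r) * (\<integral>\<^sup>+x\<in>cube a l. ennreal (\<mu> x) \<partial>lebesgue) \<le> (\<integral>\<^sup>+x\<in>E. ennreal (\<mu> x) \<partial>lebesgue)"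
proof -
  define V where "V = l ^ CARD('n)"
  have V: "V > 0" using l by (simp add: V_def)
  have w: "weight \<mu>" using \<mu> by (simp add: Muckenhoupt_def)
  have \<mu>m[measurable]: "\<mu> \<in> borel_measurable lebesgue" and pos: "ae_positive \<mu>" using w by (auto simp: weight_def)
  have [measurable]: "E \<in> sets lebesgue" "cube a l \<in> sets lebesgue" using E by auto
  have vol: "emeasure lebesgue (cube a l) = ennreal V"
    using emeasure_lborel_cube[of l a] l by (simp add: V_def)
  define m where "m = enn2real (\<integral>\<^sup>+x\<in>cube a l. ennreal (\<mu> x) \<partial>lebesgue)"
  have fin: "(\<integral>\<^sup>+x\<in>cube a l. ennreal (\<mu> x) \<partial>lebesgue) < \<infinity>"
    by (rule weight_finite[OF w compact_cube])
  then have m: "(\<integral>\<^sup>+x\<in>cube a l. ennreal (\<mu> x) \<partial>lebesgue) = ennreal m" by (simp add: m_def)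
  have "(\<integral>\<^sup>+x\<in>cube a l. ennreal (\<mu> x) \<partial>lebesgue) > 0"
    using V emeasure_lborel_cube[of l a] l by (intro set_nn_integral_pos[OF \<mu>m pos]) (auto simp: V_def)
  then have m0: "m > 0" using m by simp
  define e where "e = enn2real (\<integral>\<^sup>+x\<in>E. ennreal (\<mu> x) \<partial>lebesgue)"
  have "(\<integral>\<^sup>+x\<in>E. ennreal (\<mu> x) \<partial>lebesgue) < \<infinity>"
    using set_nn_integral_mono_set[OF E(1)] fin by (rule le_less_trans)
  then have e: "(\<integral>\<^sup>+x\<in>E. ennreal (\<mu> x) \<partial>lebesgue) = ennreal e" by (simp add: e_def)
  have "0 < ennreal (l ^ CARD('n) / 2)" using V by (simp add: V_def)
  then have "(\<integral>\<^sup>+x\<in>E. ennreal (\<mu> x) \<partial>lebesgue) > 0"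
    using E by (intro set_nn_integral_pos[OF \<mu>m pos] less_le_trans[OF _ E(3)]) auto
  then have e0: "e > 0" using e by simp
  have avg: "average (cube a l) \<mu> = ennreal (m / V)"
    unfolding average_def m vol using V m0 by (simp add: divide_ennreal)
  have epow: "epow (ennreal z) b = ennreal (z powr b)" if "z \<ge> 0" for z b
    using that by (simp add: epow_def)
  have "cube a l \<in> cubes" using l by (auto simp: cubes_def)
  then have Q: "epow (average (cube a l) \<mu>) (1 / r) *
     (if r = 1 then inverse (ess_inf_on (cube a l) \<mu>)
      else epow (average (cube a l) (\<lambda>x. \<mu> x powr (1 - conj_exp r))) (1 / conj_exp r)) \<le> ennreal C"
    using C(1) unfolding Ar_const_def by (meson SUP_upper order.trans)
  have "(1 / (2 * C)) powr r * m \<le> e"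
  proof (cases "r = 1")
    case True
    define i where "i = ess_inf_on (cube a l) \<mu>"
    \<comment> \<open>Any essential lower bound of \<open>\<mu>\<close> on the cube is at most the
      average over \<open>E\<close>, whose volume is at least \<open>V / 2\<close>.\<close>
    have "i \<le> ennreal (2 * e / V)"
      unfolding i_def ess_inf_on_def
    proof (rule Sup_least, clarify)
      fix c assume c: "AE x in lebesgue. x \<in> cube a l \<longrightarrow> c \<le> ennreal (\<mu> x)"
      have "c * ennreal (V / 2) \<le> c * emeasure lebesgue E" using E(2,3) by (intro mult_left_mono) (auto simp: V_def)
      also have "\<dots> = (\<integral>\<^sup>+x\<in>E. c \<partial>lebesgue)" by (simp add: nn_integral_cmult)
      also have "\<dots> \<le> (\<integral>\<^sup>+x\<in>E. ennreal (\<mu> x) \<partial>lebesgue)"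
      proof (rule nn_integral_mono_AE)
        show "AE x in lebesgue. c * indicator E x \<le> ennreal (\<mu> x) * indicator E x"
          using c by eventually_elim (use E(1) in \<open>auto simp: indicator_def\<close>)
      qed
      finally have 1: "c * ennreal (V / 2) \<le> ennreal e" using e by simp
      have "c = c * ennreal (V / 2) * ennreal (2 / V)"
        using V by (simp add: mult.assoc flip: ennreal_mult)
      also have "\<dots> \<le> ennreal e * ennreal (2 / V)" using 1 by (rule mult_right_mono) simp
      also have "\<dots> = ennreal (2 * e / V)" using e0 V by (simp flip: ennreal_mult)
      finally show "c \<le> ennreal (2 * e / V)" .
    qed
    then have "inverse (ennreal (2 * e / V)) \<le> inverse i"
    proof (cases i rule: ennreal_cases)
      case (real z)
      show ?thesis
      proof (cases "z = 0")
        case False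
        with real \<open>i \<le> _\<close> have "0 < z" "z \<le> 2 * e / V" using e0 V by (auto simp: ennreal_le_iff)
        then have "inverse (2 * e / V) \<le> inverse z" by (intro le_imp_inverse_le)
        then show ?thesis using real e0 V \<open>0 < z\<close> by (simp add: inverse_ennreal ennreal_leI)
      qed (use real in simp)
    qed (use e0 V in \<open>simp add: top_unique\<close>)
    then have "ennreal (m / V) * inverse (ennreal (2 * e / V)) \<le> ennreal (m / V) * inverse i" by (rule mult_left_mono) simp
    also have "\<dots> \<le> ennreal C" using Q True m0 V by (simp add: avg epow i_def)
    finally have "ennreal (m / V * inverse (2 * e / V)) \<le> ennreal C"
      using e0 V m0 by (simp add: inverse_ennreal flip: ennreal_mult)
    then have "m / (2 * e) \<le> C" using e0 V C(2) m0 by (simp add: ennreal_le_iff)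
    then show ?thesis using True C e0 by (simp add: field_simps)
  next
    case False
    then have r1: "r > 1" using r by simp
    define \<sigma> where "\<sigma> x = \<mu> x powr (1 - conj_exp r)" for x
    have ce: "1 - conj_exp r = - 1 / (r - 1)" "1 / conj_exp r = 1 - 1/r"
      using r1 by (simp_all add: conj_exp_def field_simps)
    have [measurable]: "\<sigma> \<in> borel_measurable lebesgue" unfolding \<sigma>_def by measurable
    have Q': "ennreal ((m / V) powr (1/r)) * epow (average (cube a l) \<sigma>) (1 - 1/r) \<le> ennreal C"
      using Q False m0 V by (simp add: avg epow ce \<sigma>_def[abs_def])
    \<comment> \<open>The average of \<open>\<mu>\<close> is positive, so an infinite dual average
      would make the product in \<open>Ar_const\<close> infinite.\<close>
    have "average (cube a l) \<sigma> \<noteq> \<infinity>"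
    proof
      assume "average (cube a l) \<sigma> = \<infinity>"
      then have "ennreal ((m / V) powr (1/r)) * \<infinity> \<le> ennreal C" using Q' by (simp add: epow_def)
      then show False using m0 V by (simp add: ennreal_mult_top top_unique)
    qed
    then have sfin: "(\<integral>\<^sup>+x\<in>cube a l. ennreal (\<sigma> x) \<partial>lebesgue) \<noteq> \<infinity>"
      unfolding average_def vol by (auto simp: ennreal_top_divide)
    define s where "s = enn2real (\<integral>\<^sup>+x\<in>cube a l. ennreal (\<sigma> x) \<partial>lebesgue)"
    have s: "(\<integral>\<^sup>+x\<in>cube a l. ennreal (\<sigma> x) \<partial>lebesgue) = ennreal s" using sfin by (simp add: s_def less_top)
    have s0: "s \<ge> 0" by (simp add: s_def)
    have "average (cube a l) \<sigma> = ennreal (s / V)"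
      unfolding average_def s vol using V s0 by (simp add: divide_ennreal)
    then have "(m / V) powr (1/r) * (s / V) powr (1 - 1/r) \<le> C"
      using Q' s0 V C(2) by (simp add: epow flip: ennreal_mult)
    moreover have "(m / V) powr (1/r) * (s / V) powr (1 - 1/r) = m powr (1/r) * s powr (1 - 1/r) / V"
      using V by (simp add: powr_divide powr_add[symmetric])
    ultimately have mC: "m powr (1/r) * s powr (1 - 1/r) \<le> C * V" using V by (simp add: field_simps)
    have "ennreal (V / 2) \<le> emeasure lebesgue E" using E(2,3) by (simp add: V_def)
    also have "\<dots> = (\<integral>\<^sup>+x. indicator E x \<partial>lebesgue)" by simp
    also have "\<dots> \<le> (\<integral>\<^sup>+x. ennreal ((\<bar>\<mu> x\<bar> * indicator E x) powr (1/r) * (\<sigma> x * indicator E x) powr (1 - 1/r)) \<partial>lebesgue)"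
      using pos[unfolded ae_positive_def]
    proof (intro nn_integral_mono_AE, eventually_elim)
      case (elim x)
      have "\<bar>\<mu> x\<bar> powr (1/r) * \<sigma> x powr (1 - 1/r) = \<mu> x powr (1/r + (- 1 / (r - 1)) * (1 - 1/r))"
        using elim by (simp add: \<sigma>_def ce(1) powr_powr powr_add[symmetric])
      also have "1/r + (- 1 / (r - 1)) * (1 - 1/r) = 0"
        using r1 by (simp add: field_simps)
      finally have "\<bar>\<mu> x\<bar> powr (1/r) * \<sigma> x powr (1 - 1/r) = 1" using elim by simp
      then show ?case by (simp add: indicator_def)
    qed
    also have "\<dots> \<le> ennreal (e powr (1/r) * s powr (1 - 1/r))"
    proof (rule nn_integral_Holder)
      have "(\<integral>\<^sup>+x. ennreal (\<bar>\<mu> x\<bar> * indicator E x) \<partial>lebesgue) = (\<integral>\<^sup>+x\<in>E. ennreal (\<mu> x) \<partial>lebesgue)"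
        using pos[unfolded ae_positive_def]
        by (intro nn_integral_cong_AE, eventually_elim) (auto simp: indicator_def)
      then show "(\<integral>\<^sup>+x. ennreal (\<bar>\<mu> x\<bar> * indicator E x) \<partial>lebesgue) \<le> ennreal e" using e by simp
      have "(\<integral>\<^sup>+x. ennreal (\<sigma> x * indicator E x) \<partial>lebesgue) \<le> (\<integral>\<^sup>+x\<in>cube a l. ennreal (\<sigma> x) \<partial>lebesgue)"
        using E by (intro nn_integral_mono) (auto simp: indicator_def)
      then show "(\<integral>\<^sup>+x. ennreal (\<sigma> x * indicator E x) \<partial>lebesgue) \<le> ennreal s" using s by simp
    qed (use r1 e0 s0 in \<open>auto simp: \<sigma>_def\<close>)
    finally have "V / 2 \<le> e powr (1/r) * s powr (1 - 1/r)" by (simp add: ennreal_le_iff)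
    then have "V / 2 * m powr (1/r) \<le> e powr (1/r) * s powr (1 - 1/r) * m powr (1/r)" by (rule mult_right_mono) simp
    also have "\<dots> \<le> e powr (1/r) * (C * V)"
      using mult_left_mono[OF mC, of "e powr (1/r)"] by (simp add: mult_ac)
    finally have "m powr (1/r) \<le> (2 * C) * e powr (1/r)" using V by (simp add: field_simps)
    then have "(1 / (2 * C)) * m powr (1/r) \<le> e powr (1/r)" using C by (simp add: field_simps)
    then have "((1 / (2 * C)) * m powr (1/r)) powr r \<le> (e powr (1/r)) powr r"
      using C r1 by (intro powr_mono2) auto
    then show ?thesis using r1 m0 e0 by (simp only: powr_mult powr_powr) simp
  qed
  then show ?thesis unfolding m e using m0 by (simp add: ennreal_leI flip: ennreal_mult)
qed

text \<open>The complement of a subcube keeps the share \<open>c\<close> of the mass, so the subcube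
  has at most the share \<open>1 - c\<close>. The order of quantifiers is the point:
  \<open>d\<close> depends on \<open>r\<close> and \<open>C\<close> only, hence the same
  \<open>d\<close> serves almost all slices of a weight.\<close>

lemma Muckenhoupt_reverse_doubling:
  assumes r: "r \<ge> 1" and C: "C < \<infinity>"
  shows "\<exists>d>1. \<forall>\<mu> :: real ^ 'n::finite \<Rightarrow> real. Muckenhoupt r \<mu> \<longrightarrow> Ar_const r \<mu> \<le> C \<longrightarrow>
     (\<forall>a l S. 0 < l \<longrightarrow> ennreal d * (\<integral>\<^sup>+t\<in>subcube a l S. ennreal (\<mu> t) \<partial>lebesgue) \<le> (\<integral>\<^sup>+t\<in>cube a l. ennreal (\<mu> t) \<partial>lebesgue))"
proof -
  \<comment> \<open>Adding 1 ensures \<open>C' \<ge> 1\<close>, so that the share \<open>c\<close>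
    is strictly between 0 and 1.\<close>
  define C' where "C' = enn2real C + 1"
  have C': "C \<le> ennreal C'" "C' \<ge> 1"
    using C by (auto simp: C'_def ennreal_plus intro: order.trans[OF _ add_increasing2])
  define c where "c = (1 / (2 * C')) powr r"
  have c: "0 < c" "c < 1"
  proof -
    show "0 < c" using C' by (simp add: c_def)
    have "c < 1 powr r" unfolding c_def using C' r by (intro powr_less_mono2) auto
    then show "c < 1" by simp
  qed
  have "ennreal (1 / (1 - c)) * (\<integral>\<^sup>+t\<in>subcube a l S. ennreal (\<mu> t) \<partial>lebesgue) \<le> (\<integral>\<^sup>+t\<in>cube a l. ennreal (\<mu> t) \<partial>lebesgue)"
    if \<mu>: "Muckenhoupt r \<mu>" "Ar_const r \<mu> \<le> C" and l: "0 < l" for \<mu> :: "real ^ 'n \<Rightarrow> real" and a l S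
  proof -
    have w: "weight \<mu>" using \<mu> by (simp add: Muckenhoupt_def)
    have [measurable]: "\<mu> \<in> borel_measurable lebesgue" using w by (auto simp: weight_def)
    let ?E = "cube a l - subcube a l S"
    have "ennreal c * (\<integral>\<^sup>+x\<in>cube a l. ennreal (\<mu> x) \<partial>lebesgue) \<le> (\<integral>\<^sup>+x\<in>?E. ennreal (\<mu> x) \<partial>lebesgue)"
      unfolding c_def
      by (rule Muckenhoupt_subset[OF \<mu>(1) r order.trans[OF \<mu>(2) C'(1)] _ l _ _ emeasure_cube_diff_subcube[OF l]]) (use C' in auto)
    moreover have "(\<integral>\<^sup>+x\<in>cube a l. ennreal (\<mu> x) \<partial>lebesgue) = (\<integral>\<^sup>+x\<in>subcube a l S. ennreal (\<mu> x) \<partial>lebesgue) + (\<integral>\<^sup>+x\<in>?E. ennreal (\<mu> x) \<partial>lebesgue)"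
    proof -
      have [measurable]: "subcube a l S \<in> sets lebesgue" "?E \<in> sets lebesgue" by auto
      have "(\<integral>\<^sup>+x\<in>cube a l. ennreal (\<mu> x) \<partial>lebesgue)
         = (\<integral>\<^sup>+x. ennreal (\<mu> x) * indicator (subcube a l S) x + ennreal (\<mu> x) * indicator ?E x \<partial>lebesgue)"
        using subcube_subset[of l a S] l by (intro nn_integral_cong) (auto simp: indicator_def)
      then show ?thesis by (simp add: nn_integral_add)
    qed
    moreover obtain m where m: "(\<integral>\<^sup>+x\<in>cube a l. ennreal (\<mu> x) \<partial>lebesgue) = ennreal m" "m \<ge> 0"
      using ennreal_less_infinityE[OF weight_finite[OF w compact_cube, of a l]] .
    moreover obtain m' where m': "(\<integral>\<^sup>+x\<in>subcube a l S. ennreal (\<mu> x) \<partial>lebesgue) = ennreal m'" "m' \<ge> 0"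
      unfolding subcube_def using ennreal_less_infinityE[OF weight_finite[OF w compact_cube]] .
    moreover obtain e where e: "(\<integral>\<^sup>+x\<in>?E. ennreal (\<mu> x) \<partial>lebesgue) = ennreal e" "e \<ge> 0"
    proof -
      have "(\<integral>\<^sup>+x\<in>?E. ennreal (\<mu> x) \<partial>lebesgue) < \<infinity>"
        by (rule le_less_trans[OF set_nn_integral_mono_set weight_finite[OF w compact_cube, of a l]]) auto
      then show ?thesis using that by (rule ennreal_less_infinityE)
    qed
    ultimately have *: "ennreal (c * m) \<le> ennreal e" "ennreal m = ennreal (m' + e)"
      using c by (simp_all add: ennreal_mult)
    then have "c * m \<le> e" "m = m' + e" using m(2) m'(2) e(2) by (simp_all add: ennreal_le_iff del: ennreal_plus)
    then have "1 / (1 - c) * m' \<le> m" using c by (simp add: field_simps)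
    then show ?thesis unfolding m m' using c m' by (simp add: ennreal_leI flip: ennreal_mult)
  qed
  moreover have "1 / (1 - c) > 1" using c by simp
  ultimately show ?thesis by blast
qed

text \<open>Almost every slice in block \<open>s\<close> is reverse doubling with a constant
  independent of the slice, and integrating the slice inequality over the cubes of the other blocks
  preserves it. The constants of the finitely many blocks are merged at the end.\<close>

lemma rect_rd_A_infty:
  fixes v :: "real ^ 'n::finite ^ 'k::finite \<Rightarrow> real"
  assumes A: "A_infty_separately v" and v0: "\<And>x. v x \<ge> 0" and vm: "v \<in> borel_measurable lebesgue"
  shows "\<exists>d>1. rect_rd d v"
proof -
  obtain g where g[measurable]: "g \<in> borel_measurable borel" and g0: "\<And>x. g x \<ge> 0" and vg: "AE x in lborel. v x = g x"
    using borel_representative[OF vm] v0 by auto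
  have rint: "(\<integral>\<^sup>+x\<in>block_prod Q. ennreal (v x) \<partial>lebesgue) = (\<integral>\<^sup>+x. ennreal (g x) * indicator (block_prod Q) x \<partial>lborel)"
    if [measurable]: "\<And>s. Q s \<in> sets borel" for Q
  proof -
    have "(\<integral>\<^sup>+x\<in>block_prod Q. ennreal (v x) \<partial>lebesgue) = (\<integral>\<^sup>+x. ennreal (g x) * indicator (block_prod Q) x \<partial>lebesgue)"
      by (intro nn_integral_cong_AE) (use vg in \<open>auto simp: AE_lebesgue_iff\<close>)
    then show ?thesis by (simp add: nn_integral_completion)
  qed
  have "\<exists>d>1. \<forall>a l S. (\<forall>r. 0 < l r) \<longrightarrow>
     ennreal d * (\<integral>\<^sup>+x\<in>block_prod ((\<lambda>r. cube (a r) (l r))(s := subcube (a s) (l s) S)). ennreal (v x) \<partial>lebesgue)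
       \<le> (\<integral>\<^sup>+x\<in>block_prod (\<lambda>r. cube (a r) (l r)). ennreal (v x) \<partial>lebesgue)" for s
  proof -
    obtain r C where r: "r \<ge> 1" and C: "C < \<infinity>" and
      ae: "AE y in (\<Pi>\<^sub>M l\<in>UNIV - {s}. (lborel :: (real ^ 'n) measure)). Muckenhoupt r (slice v s y) \<and> Ar_const r (slice v s y) \<le> C"
      using A unfolding A_infty_separately_def by blast
    obtain d where d: "d > 1" and rd: "\<And>(\<mu> :: real ^ 'n \<Rightarrow> real) a l S. Muckenhoupt r \<mu> \<Longrightarrow> Ar_const r \<mu> \<le> C \<Longrightarrow> 0 < l \<Longrightarrow>
       ennreal d * (\<integral>\<^sup>+t\<in>subcube a l S. ennreal (\<mu> t) \<partial>lebesgue) \<le> (\<integral>\<^sup>+t\<in>cube a l. ennreal (\<mu> t) \<partial>lebesgue)"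
      using Muckenhoupt_reverse_doubling[OF r C] by blast
    have "ennreal d * (\<integral>\<^sup>+x\<in>block_prod ((\<lambda>r. cube (a r) (l r))(s := subcube (a s) (l s) S)). ennreal (v x) \<partial>lebesgue)
       \<le> (\<integral>\<^sup>+x\<in>block_prod (\<lambda>r. cube (a r) (l r)). ennreal (v x) \<partial>lebesgue)" if l: "\<forall>r. 0 < l r" for a l S
    proof -
      define Q where "Q = (\<lambda>r. cube (a r) (l r))"
      define Q' where "Q' = Q(s := subcube (a s) (l s) S)"
      have Qm[measurable]: "Q r \<in> sets borel" "Q' r \<in> sets borel" for r by (auto simp: Q_def Q'_def)
      define I where "I y = (of_bool (\<forall>r. r \<noteq> s \<longrightarrow> y r \<in> Q r) :: ennreal)" for y :: "'k \<Rightarrow> real ^ 'n"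
      have ind: "indicator (block_prod Q) (join s y t) = I y * indicator (Q s) t"
        "indicator (block_prod Q') (join s y t) = I y * indicator (subcube (a s) (l s) S) t" for y t
        by (auto simp: indicator_def I_def block_prod_def join_def Q'_def)
      have "ennreal d * (\<integral>\<^sup>+x\<in>block_prod Q'. ennreal (v x) \<partial>lebesgue)
        = (\<integral>\<^sup>+x. ennreal d * (ennreal (g x) * indicator (block_prod Q') x) \<partial>lborel)"
        by (simp add: rint nn_integral_cmult)
      also have "\<dots> = (\<integral>\<^sup>+y. (\<integral>\<^sup>+t. ennreal d * (ennreal (g (join s y t)) * indicator (block_prod Q') (join s y t)) \<partial>lborel) \<partial>(\<Pi>\<^sub>M l\<in>UNIV - {s}. lborel))"
        by (rule nn_integral_lborel_join) measurable
      also have "\<dots> \<le> (\<integral>\<^sup>+y. (\<integral>\<^sup>+t. ennreal (g (join s y t)) * indicator (block_prod Q) (join s y t) \<partial>lborel) \<partial>(\<Pi>\<^sub>M l\<in>UNIV - {s}. lborel))"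
      proof (rule nn_integral_mono_AE)
        from ae AE_lborel_join[OF vg, of s] AE_space[of "\<Pi>\<^sub>M l\<in>UNIV - {s}. lborel :: (real ^ 'n) measure"]
        show "AE y in (\<Pi>\<^sub>M l\<in>UNIV - {s}. lborel).
           (\<integral>\<^sup>+t. ennreal d * (ennreal (g (join s y t)) * indicator (block_prod Q') (join s y t)) \<partial>lborel)
           \<le> (\<integral>\<^sup>+t. ennreal (g (join s y t)) * indicator (block_prod Q) (join s y t) \<partial>lborel)"
        proof eventually_elim
        case (elim y)
        have [measurable]: "(\<lambda>t. g (join s y t)) \<in> borel_measurable borel"
          using measurable_compose[OF measurable_compose[OF measurable_Pair1'[OF elim(3)] measurable_join] g] by simp
        have *: "(\<integral>\<^sup>+t. ennreal (g (join s y t)) * indicator Z t \<partial>lborel) = (\<integral>\<^sup>+t\<in>Z. ennreal (slice v s y t) \<partial>lebesgue)"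
          if [measurable]: "Z \<in> sets borel" for Z
        proof -
          have "(\<integral>\<^sup>+t\<in>Z. ennreal (slice v s y t) \<partial>lebesgue) = (\<integral>\<^sup>+t. ennreal (g (join s y t)) * indicator Z t \<partial>lebesgue)"
            using elim(2) by (intro nn_integral_cong_AE) (auto simp: AE_lebesgue_iff slice_def join_def)
          then show ?thesis by (simp add: nn_integral_completion)
        qed
        have "(\<integral>\<^sup>+t. ennreal d * (ennreal (g (join s y t)) * indicator (block_prod Q') (join s y t)) \<partial>lborel)
          = I y * (ennreal d * (\<integral>\<^sup>+t. ennreal (g (join s y t)) * indicator (subcube (a s) (l s) S) t \<partial>lborel))"
          unfolding ind by (simp add: nn_integral_cmult[symmetric] mult_ac)
        also have "\<dots> \<le> I y * (\<integral>\<^sup>+t. ennreal (g (join s y t)) * indicator (Q s) t \<partial>lborel)"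
          using elim(1) l by (intro mult_left_mono) (auto simp: * rd Q_def)
        also have "\<dots> = (\<integral>\<^sup>+t. ennreal (g (join s y t)) * indicator (block_prod Q) (join s y t) \<partial>lborel)"
          unfolding ind by (simp add: nn_integral_cmult[symmetric] mult_ac)
        finally show ?case .
        qed
      qed
      also have "\<dots> = (\<integral>\<^sup>+x. ennreal (g x) * indicator (block_prod Q) x \<partial>lborel)"
        by (rule nn_integral_lborel_join[symmetric]) measurable
      also have "\<dots> = (\<integral>\<^sup>+x\<in>block_prod Q. ennreal (v x) \<partial>lebesgue)" by (simp add: rint)
      finally show ?thesis by (simp add: Q'_def Q_def)
    qed
    with d show ?thesis by blast
  qed
  then have "\<exists>d>1. \<forall>s a l S. (\<forall>r. 0 < l r) \<longrightarrow>
     ennreal d * (\<integral>\<^sup>+x\<in>block_prod ((\<lambda>r. cube (a r) (l r))(s := subcube (a s) (l s) S)). ennreal (v x) \<partial>lebesgue)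
       \<le> (\<integral>\<^sup>+x\<in>block_prod (\<lambda>r. cube (a r) (l r)). ennreal (v x) \<partial>lebesgue)"
    by (rule uniform_constant) (blast intro: order_trans[OF mult_right_mono[OF ennreal_leI zero_le]])
  then show ?thesis unfolding rect_rd_def by blast
qed

section \<open>Dyadic grids\<close>

text \<open>Cells are indexed by integer vectors: \<open>ganc j z\<close> is the level \<open>j\<close> cell, of side \<open>h 2\<^sup>j\<close>, around the mesh cell \<open>z\<close>
  of the grid with mesh \<open>h\<close> and origin \<open>\<omega>\<close>, and \<open>gX L\<close> is a single cell of level \<open>L\<close>.\<close>

definition gX :: "nat \<Rightarrow> ('n::finite \<Rightarrow> int) set" where
  "gX L = PiE UNIV (\<lambda>_. {0..<2 ^ L})"

definition ganc :: "nat \<Rightarrow> ('n \<Rightarrow> int) \<Rightarrow> nat \<times> ('n \<Rightarrow> int)" where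
  "ganc j z = (j, \<lambda>c. z c div 2 ^ j)"

text \<open>The floor makes the mesh cells half open, so that every point has exactly one cell. The
  closed sets \<open>cube\<close> of the weight conditions differ from them by null sets.\<close>

definition gpos :: "real \<Rightarrow> real ^ 'n ^ 'k \<Rightarrow> real ^ 'n ^ 'k \<Rightarrow> 'k::finite \<Rightarrow> 'n::finite \<Rightarrow> int" where
  "gpos h \<omega> x = (\<lambda>s c. \<lfloor>(x $ s $ c - \<omega> $ s $ c) / h\<rfloor>)"

interpretation grid: leveled_tree "gX L" L ganc for L
  by standard (auto simp: gX_def ganc_def intro!: finite_PiE)

lemma gX_iff: "z \<in> gX L \<longleftrightarrow> (\<forall>c. 0 \<le> z c \<and> z c < 2 ^ L)"
  by (auto simp: gX_def PiE_def)

lemma int_div_less_iff: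
  fixes a b z :: int
  assumes "b > 0"
  shows "z div b < a \<longleftrightarrow> z < a * b"
proof -
  have "a \<le> z div b \<longleftrightarrow> a * b \<le> z"
  proof
    assume "a \<le> z div b"
    then have "a * b \<le> z div b * b" using assms by simp
    also have "\<dots> \<le> z" using assms pos_mod_sign[of b z] div_mult_mod_eq[of z b] by linarith
    finally show "a * b \<le> z" .
  next
    assume "a * b \<le> z"
    then have "a * b div b \<le> z div b" using assms by (intro zdiv_mono1) auto
    then show "a \<le> z div b" using assms by simp
  qed
  then show ?thesis by linarith
qed

text \<open>As \<open>2 ^ j\<close> divides \<open>2 ^ L\<close>, a level \<open>j\<close> cell
  around a point of \<open>gX L\<close> does not stick out of \<open>gX L\<close>. The restriction
  to \<open>gX L\<close> inside \<open>leaves\<close> therefore cuts nothing off.\<close>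

lemma grid_leaves_ganc:
  assumes "z \<in> gX L" "j \<le> L"
  shows "grid.leaves L (ganc j z) = {z'. \<forall>c. z' c div 2 ^ j = z c div 2 ^ j}"
proof -
  have "z' \<in> gX L" if eq: "\<forall>c. z' c div 2 ^ j = z c div 2 ^ j" for z'
    unfolding gX_iff
  proof
    fix c
    have z: "0 \<le> z c" "z c < 2 ^ L" using assms by (auto simp: gX_iff)
    have "z c div 2 ^ j \<ge> 0" using z by (simp add: pos_imp_zdiv_nonneg_iff)
    then have 1: "z' c \<ge> 0" using eq pos_imp_zdiv_nonneg_iff[of "2 ^ j" "z' c"] by simp
    have "(2 :: int) ^ L = 2 ^ (L - j) * 2 ^ j" using assms(2) by (simp flip: power_add)
    then have "z c div 2 ^ j < 2 ^ (L - j)" using z by (simp add: int_div_less_iff)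
    then have "z' c div 2 ^ j < 2 ^ (L - j)" using eq by simp
    then have "z' c < 2 ^ (L - j) * 2 ^ j" by (simp add: int_div_less_iff)
    with 1 \<open>(2 :: int) ^ L = _\<close> show "0 \<le> z' c \<and> z' c < 2 ^ L" by simp
  qed
  moreover have "ganc i z' = ganc j z \<longleftrightarrow> i = j \<and> (\<forall>c. z' c div 2 ^ j = z c div 2 ^ j)" for i z'
    by (auto simp: ganc_def fun_eq_iff)
  ultimately show ?thesis
    using assms(2) unfolding grid.leaves_def by auto
qed

text \<open>Rounding down to the mesh and then to level \<open>j\<close> is rounding down to level
  \<open>j\<close> at once, so cells of integer vectors become intervals of length
  \<open>h * 2 ^ j\<close>.\<close>

lemma floor_div_power2:
  fixes t :: real and m :: int
  assumes "h > 0"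
  shows "\<lfloor>t / h\<rfloor> div 2 ^ j = m \<longleftrightarrow> h * 2 ^ j * m \<le> t \<and> t < h * 2 ^ j * m + h * 2 ^ j"
proof -
  have "\<lfloor>t / h\<rfloor> div 2 ^ j = \<lfloor>t / (h * 2 ^ j)\<rfloor>"
    using floor_divide_real_eq_div[of "2 ^ j" "t / h"] by simp
  moreover have "\<lfloor>t / (h * 2 ^ j)\<rfloor> = m \<longleftrightarrow> h * 2 ^ j * m \<le> t \<and> t < h * 2 ^ j * m + h * 2 ^ j"
    unfolding floor_eq_iff using assms by (simp add: field_simps)
  ultimately show ?thesis by simp
qed

definition gcorner :: "real \<Rightarrow> real ^ 'n ^ 'k \<Rightarrow> 'k::finite \<Rightarrow> nat \<times> ('n::finite \<Rightarrow> int) \<Rightarrow> real ^ 'n" where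
  "gcorner h \<omega> s Q = (\<chi> c. \<omega> $ s $ c + h * 2 ^ fst Q * snd Q c)"

definition gside :: "real \<Rightarrow> nat \<times> ('n \<Rightarrow> int) \<Rightarrow> real" where
  "gside h Q = h * 2 ^ fst Q"

definition gcubes :: "real \<Rightarrow> real ^ 'n ^ 'k \<Rightarrow> ('k::finite \<Rightarrow> nat \<times> ('n::finite \<Rightarrow> int)) \<Rightarrow> 'k \<Rightarrow> (real ^ 'n) set" where
  "gcubes h \<omega> R = (\<lambda>s. cube (gcorner h \<omega> s (R s)) (gside h (R s)))"

lemma grid_nodesE:
  assumes "Q \<in> grid.nodes L"
  obtains j z where "j \<le> L" "z \<in> gX L" "Q = ganc j z"
  using assms unfolding grid.nodes_def by auto

lemma gpos_mem_rect_iff: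
  assumes h: "h > 0" and R: "R \<in> PiE UNIV (\<lambda>_. grid.nodes L)"
  shows "gpos h \<omega> x \<in> grid.rect L UNIV R \<longleftrightarrow>
    (\<forall>s c. gcorner h \<omega> s (R s) $ c \<le> x $ s $ c \<and> x $ s $ c < gcorner h \<omega> s (R s) $ c + gside h (R s))"
proof -
  have "gpos h \<omega> x s \<in> grid.leaves L (R s) \<longleftrightarrow>
    (\<forall>c. gcorner h \<omega> s (R s) $ c \<le> x $ s $ c \<and> x $ s $ c < gcorner h \<omega> s (R s) $ c + gside h (R s))" for s
  proof -
    have "R s \<in> grid.nodes L" using R by auto
    then obtain j z where z: "j \<le> L" "z \<in> gX L" "R s = ganc j z" by (rule grid_nodesE)
    have "gpos h \<omega> x s \<in> grid.leaves L (R s) \<longleftrightarrow> (\<forall>c. \<lfloor>(x $ s $ c - \<omega> $ s $ c) / h\<rfloor> div 2 ^ j = z c div 2 ^ j)"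
      unfolding z(3) grid_leaves_ganc[OF z(2,1)] by (simp add: gpos_def)
    also have "\<dots> \<longleftrightarrow> (\<forall>c. h * 2 ^ j * (z c div 2 ^ j) \<le> x $ s $ c - \<omega> $ s $ c \<and>
       x $ s $ c - \<omega> $ s $ c < h * 2 ^ j * (z c div 2 ^ j) + h * 2 ^ j)"
      unfolding floor_div_power2[OF h] ..
    also have "\<dots> \<longleftrightarrow> (\<forall>c. gcorner h \<omega> s (R s) $ c \<le> x $ s $ c \<and> x $ s $ c < gcorner h \<omega> s (R s) $ c + gside h (R s))"
      unfolding z(3) by (intro arg_cong[where f=All] ext) (auto simp: gcorner_def gside_def ganc_def algebra_simps)
    finally show ?thesis .
  qed
  then show ?thesis unfolding grid.rect_def by (simp add: PiE_iff)
qed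

lemma AE_coordinates_neq: "AE x in lebesgue. \<forall>s c. (x :: real ^ 'n::finite ^ 'k::finite) $ s $ c \<noteq> K s c"
proof -
  have "AE t in lborel. t \<noteq> K s c" for s c by (rule AE_lborel_singleton)
  then have "AE x in lborel. (x :: real ^ 'n) $ c \<noteq> K s c" for s c
    by (rule AE_lborel_vec_nth)
  then have "AE x in lborel. (x :: real ^ 'n ^ 'k) $ s $ c \<noteq> K s c" for s c
    by (rule AE_lborel_vec_nth)
  then have "AE x in lborel. \<forall>s\<in>UNIV. \<forall>c\<in>UNIV. (x :: real ^ 'n ^ 'k) $ s $ c \<noteq> K s c"
    by (subst AE_finite_all, simp, intro ballI, subst AE_finite_all) auto
  then show ?thesis unfolding AE_lebesgue_iff by simp
qed

text \<open>The half open and the closed rectangle differ only on the upper faces, which lie on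
  finitely many coordinate hyperplanes.\<close>

lemma rect_integral_eq:
  fixes f :: "real ^ 'n::finite ^ 'k::finite \<Rightarrow> ennreal"
  assumes h: "h > 0" and R: "R \<in> PiE UNIV (\<lambda>_. grid.nodes L)"
  shows "(\<integral>\<^sup>+x\<in>{x. gpos h \<omega> x \<in> grid.rect L UNIV R}. f x \<partial>lebesgue) = (\<integral>\<^sup>+x\<in>block_prod (gcubes h \<omega> R). f x \<partial>lebesgue)"
proof (rule nn_integral_cong_AE)
  show "AE x in lebesgue. f x * indicator {x. gpos h \<omega> x \<in> grid.rect L UNIV R} x = f x * indicator (block_prod (gcubes h \<omega> R)) x"
    using AE_coordinates_neq[of "\<lambda>s c. gcorner h \<omega> s (R s) $ c + gside h (R s)"]
  proof eventually_elim
    case (elim x)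
    have "gpos h \<omega> x \<in> grid.rect L UNIV R \<longleftrightarrow> x \<in> block_prod (gcubes h \<omega> R)"
      unfolding gpos_mem_rect_iff[OF h R] block_prod_def gcubes_def cube_def mem_box_cart mem_Collect_eq
      using elim by (simp add: less_le)
    then show ?case by (simp add: indicator_def)
  qed
qed

section \<open>From functions to masses of mesh cells\<close>

lemma gpos_measurable: "{x. gpos h \<omega> x = z} \<in> sets borel"
proof -
  have "{x. gpos h \<omega> x = z} = {x \<in> space borel. \<forall>s\<in>UNIV. \<forall>c\<in>UNIV. \<lfloor>(x $ s $ c - \<omega> $ s $ c) / h\<rfloor> = z s c}"
    by (auto simp: gpos_def fun_eq_iff)
  also have "\<dots> \<in> sets borel"
    by measurable
  finally show ?thesis .
qed

text \<open>The discrete weight to which the tree estimates are applied. An infinite integral would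
  be recorded as 0 by \<open>enn2real\<close>, so identities for \<open>gsum\<close> come with
  finiteness of the cell integrals.\<close>

definition gsum :: "real \<Rightarrow> real ^ 'n ^ 'k \<Rightarrow> (real ^ 'n ^ 'k \<Rightarrow> real) \<Rightarrow> ('k::finite \<Rightarrow> 'n::finite \<Rightarrow> int) \<Rightarrow> real" where
  "gsum h \<omega> f z = enn2real (\<integral>\<^sup>+x\<in>{x. gpos h \<omega> x = z}. ennreal (f x) \<partial>lebesgue)"

lemma nn_integral_fibres:
  assumes f[measurable]: "f \<in> borel_measurable lebesgue" and A: "finite A"
  shows "(\<integral>\<^sup>+x\<in>{x. gpos h \<omega> x \<in> A}. f x \<partial>lebesgue) = (\<Sum>z\<in>A. \<integral>\<^sup>+x\<in>{x. gpos h \<omega> x = z}. (f x :: ennreal) \<partial>lebesgue)"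
proof -
  have [measurable]: "{x. gpos h \<omega> x = z} \<in> sets lebesgue" for z
    using gpos_measurable[of h \<omega> z] by simp
  have "(\<integral>\<^sup>+x\<in>{x. gpos h \<omega> x \<in> A}. f x \<partial>lebesgue) = (\<integral>\<^sup>+x. (\<Sum>z\<in>A. f x * indicator {x. gpos h \<omega> x = z} x) \<partial>lebesgue)"
  proof (intro nn_integral_cong)
    fix x
    have "(\<Sum>z\<in>A. f x * indicator {x. gpos h \<omega> x = z} x) = (\<Sum>z\<in>A. if z = gpos h \<omega> x then f x else 0)"
      by (intro sum.cong refl) (auto simp: indicator_def)
    then show "f x * indicator {x. gpos h \<omega> x \<in> A} x = (\<Sum>z\<in>A. f x * indicator {x. gpos h \<omega> x = z} x)"
      using A by (simp add: indicator_def)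
  qed
  also have "\<dots> = (\<Sum>z\<in>A. \<integral>\<^sup>+x\<in>{x. gpos h \<omega> x = z}. f x \<partial>lebesgue)"
    by (rule nn_integral_sum) measurable
  finally show ?thesis .
qed

lemma sum_gsum:
  assumes f: "f \<in> borel_measurable lebesgue" and A: "finite A"
    and fin: "\<And>z. z \<in> A \<Longrightarrow> (\<integral>\<^sup>+x\<in>{x. gpos h \<omega> x = z}. ennreal (f x) \<partial>lebesgue) < \<infinity>"
  shows "ennreal (sum (gsum h \<omega> f) A) = (\<integral>\<^sup>+x\<in>{x. gpos h \<omega> x \<in> A}. ennreal (f x) \<partial>lebesgue)"
proof -
  have "ennreal (sum (gsum h \<omega> f) A) = (\<Sum>z\<in>A. ennreal (gsum h \<omega> f z))"
    by (rule sum_ennreal[symmetric]) (simp add: gsum_def)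
  also have "\<dots> = (\<Sum>z\<in>A. \<integral>\<^sup>+x\<in>{x. gpos h \<omega> x = z}. ennreal (f x) \<partial>lebesgue)"
    using fin by (intro sum.cong refl) (simp add: gsum_def less_top)
  also have "\<dots> = (\<integral>\<^sup>+x\<in>{x. gpos h \<omega> x \<in> A}. ennreal (f x) \<partial>lebesgue)"
    by (rule nn_integral_fibres[symmetric]) (use f A in auto)
  finally show ?thesis .
qed

definition gleaf :: "('k \<Rightarrow> 'n \<Rightarrow> int) \<Rightarrow> 'k \<Rightarrow> nat \<times> ('n \<Rightarrow> int)" where
  "gleaf z = (\<lambda>s. ganc 0 (z s))"

lemma gleaf_nodes: "z \<in> PiE UNIV (\<lambda>_. gX L) \<Longrightarrow> gleaf z \<in> PiE UNIV (\<lambda>_. grid.nodes L)"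
  by (auto simp: gleaf_def grid.nodes_def PiE_iff)

lemma rect_gleaf: "z \<in> PiE UNIV (\<lambda>_. gX L) \<Longrightarrow> grid.rect L UNIV (gleaf z) = {z}"
  by (auto simp: grid.rect_def gleaf_def grid_leaves_ganc PiE_iff fun_eq_iff)

lemma fibre_integral_eq:
  fixes f :: "real ^ 'n::finite ^ 'k::finite \<Rightarrow> ennreal"
  assumes "h > 0" "z \<in> PiE UNIV (\<lambda>_. gX L)"
  shows "(\<integral>\<^sup>+x\<in>{x. gpos h \<omega> x = z}. f x \<partial>lebesgue) = (\<integral>\<^sup>+x\<in>block_prod (gcubes h \<omega> (gleaf z)). f x \<partial>lebesgue)"
  using rect_integral_eq[OF assms(1) gleaf_nodes[OF assms(2)], where \<omega>=\<omega> and f=f] by (simp add: rect_gleaf[OF assms(2)])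

lemma compact_block_prod:
  assumes "\<And>s. compact (Q s)"
  shows "compact (block_prod Q :: (real ^ 'n::finite ^ 'k::finite) set)"
proof -
  have "bounded (block_prod Q)"
  proof -
    have "\<forall>s. \<exists>B. \<forall>t\<in>Q s. norm t \<le> B" using assms compact_imp_bounded bounded_iff by blast
    from choice[OF this] obtain B where B: "\<forall>s. \<forall>t\<in>Q s. norm t \<le> B s" ..
    have "norm x \<le> (\<Sum>s\<in>UNIV. B s)" if "x \<in> block_prod Q" for x
    proof -
      have "norm x \<le> (\<Sum>s\<in>UNIV. norm (x $ s))"
        unfolding norm_vec_def by (rule L2_set_le_sum) simp
      also have "\<dots> \<le> (\<Sum>s\<in>UNIV. B s)"
        using B that by (intro sum_mono) (auto simp: block_prod_def)
      finally show ?thesis .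
    qed
    then show ?thesis unfolding bounded_iff by blast
  qed
  moreover have "closed (block_prod Q)"
  proof -
    have "block_prod Q = (\<Inter>s. (\<lambda>x. x $ s) -` Q s)" by (auto simp: block_prod_def)
    moreover have "closed ((\<lambda>x :: real ^ 'n ^ 'k. x $ s) -` Q s)" for s
      by (intro closed_vimage compact_imp_closed assms continuous_intros)
    ultimately show ?thesis by auto
  qed
  ultimately show ?thesis by (simp add: compact_eq_bounded_closed)
qed

lemma compact_gcubes: "compact (block_prod (gcubes h \<omega> R))"
  by (rule compact_block_prod) (simp add: gcubes_def compact_cube)

lemma emeasure_block_prod_pos:
  assumes "\<And>s. l s > 0"
  shows "emeasure lborel (block_prod (\<lambda>s. cube (a s) (l s)) :: (real ^ 'n::finite ^ 'k::finite) set) > 0"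
proof -
  let ?B = "block_prod (\<lambda>s. cube (a s) (l s)) :: (real ^ 'n ^ 'k) set"
  have "emeasure lborel ?B = (\<integral>\<^sup>+x. (\<Prod>s\<in>UNIV. indicator (cube (a s) (l s)) (x $ s)) \<partial>lborel)"
    unfolding indicator_block_prod[symmetric] by (rule nn_integral_indicator[symmetric]) auto
  also have "\<dots> = (\<Prod>s\<in>UNIV. emeasure lborel (cube (a s) (l s)))"
    by (subst nn_integral_lborel_vec_prod) auto
  also have "\<dots> = ennreal (\<Prod>s\<in>UNIV. l s ^ CARD('n))"
    using assms by (simp add: emeasure_lborel_cube less_imp_le prod_ennreal)
  finally show ?thesis using assms by (simp add: prod_pos)
qed

lemma gside_pos: "h > 0 \<Longrightarrow> gside h Q > 0"
  by (simp add: gside_def)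

lemma weight_fibre_finite:
  assumes "weight v" "h > 0" "z \<in> PiE UNIV (\<lambda>_. gX L)"
  shows "(\<integral>\<^sup>+x\<in>{x. gpos h \<omega> x = z}. ennreal (v x) \<partial>lebesgue) < \<infinity>"
  unfolding fibre_integral_eq[OF assms(2,3)] by (rule weight_finite[OF assms(1) compact_gcubes])

lemma gsum_pos:
  assumes "weight v" "h > 0" "z \<in> PiE UNIV (\<lambda>_. gX L)"
  shows "gsum h \<omega> v z > 0"
proof -
  have "(\<integral>\<^sup>+x\<in>{x. gpos h \<omega> x = z}. ennreal (v x) \<partial>lebesgue) > 0"
    unfolding fibre_integral_eq[OF assms(2,3)] gcubes_def
    using assms(1) by (intro set_nn_integral_pos emeasure_block_prod_pos gside_pos assms(2)) (auto simp: weight_def)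
  then show ?thesis unfolding gsum_def using weight_fibre_finite[OF assms, of \<omega>]
    by (simp add: enn2real_positive_iff)
qed

lemma sum_gsum_rect:
  assumes v: "weight v" and h: "h > 0" and R: "R \<in> PiE UNIV (\<lambda>_. grid.nodes L)"
  shows "ennreal (sum (gsum h \<omega> v) (grid.rect L UNIV R)) = (\<integral>\<^sup>+x\<in>block_prod (gcubes h \<omega> R). ennreal (v x) \<partial>lebesgue)"
  unfolding rect_integral_eq[OF h R, symmetric]
  using v by (intro sum_gsum weight_fibre_finite[OF v h, of _ L] grid.finite_rect)
    (use grid.rect_subset[of L UNIV R] in \<open>auto simp: weight_def\<close>)

text \<open>A sum over the leaves of one node with the other coordinates frozen is the mass of a
  rectangle whose other sides are mesh cells. The rectangles for consecutive levels differ in one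
  side only, where the child is one of the equal subcubes of the parent, as in
  \<open>rect_rd\<close>.\<close>

lemma separate_rd_gsum:
  fixes v :: "real ^ 'n::finite ^ 'k::finite \<Rightarrow> real"
  assumes v: "weight v" and rd: "rect_rd d v" and h: "h > 0" and d: "d > 0"
  shows "grid.separate_rd L d UNIV (gsum h \<omega> v)"
  unfolding grid.separate_rd_def
proof (intro ballI allI impI)
  fix i :: 'k and y :: "'k \<Rightarrow> 'n \<Rightarrow> int" and j assume y: "y \<in> PiE UNIV (\<lambda>_. gX L)" and j: "j < L"
  have yX: "y s \<in> gX L" for s using y by auto
  have *: "(\<Sum>c\<in>grid.leaves L (ganc J (y i)). gsum h \<omega> v (y(i := c)))
     = sum (gsum h \<omega> v) (grid.rect L UNIV ((gleaf y)(i := ganc J (y i))))" for J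
  proof (rule sum.reindex_cong[symmetric])
    show "inj_on (\<lambda>c. y(i := c)) (grid.leaves L (ganc J (y i)))"
      by (auto simp: inj_on_def fun_eq_iff split: if_splits)
    have "grid.leaves L (gleaf y s) = {y s}" for s
      using grid_leaves_ganc[OF yX, of 0 s] by (auto simp: gleaf_def)
    then have mem: "z \<in> grid.rect L UNIV ((gleaf y)(i := ganc J (y i))) \<longleftrightarrow>
        z i \<in> grid.leaves L (ganc J (y i)) \<and> (\<forall>s. s \<noteq> i \<longrightarrow> z s = y s)" for z
      unfolding grid.rect_def by (auto simp: PiE_iff)
    show "grid.rect L UNIV ((gleaf y)(i := ganc J (y i))) = (\<lambda>c. y(i := c)) ` grid.leaves L (ganc J (y i))"
    proof (intro equalityI subsetI)
      fix z assume z: "z \<in> grid.rect L UNIV ((gleaf y)(i := ganc J (y i)))"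
      then have "z = y(i := z i)" by (auto simp: mem fun_eq_iff)
      with z show "z \<in> (\<lambda>c. y(i := c)) ` grid.leaves L (ganc J (y i))" by (auto simp: mem)
    qed (auto simp: mem)
  qed simp
  have nodes: "(gleaf y)(i := ganc J (y i)) \<in> PiE UNIV (\<lambda>_. grid.nodes L)" if "J \<le> L" for J
    using gleaf_nodes[OF y] that yX by (auto simp: PiE_iff grid.nodes_def)
  define a where "a s = gcorner h \<omega> s (((gleaf y)(i := ganc (Suc j) (y i))) s)" for s
  define l where "l s = gside h (((gleaf y)(i := ganc (Suc j) (y i))) s)" for s
  \<comment> \<open>The parity of the child index decides, coordinate by coordinate, whether the
    child is the upper or the lower half of its parent.\<close>
  define S where "S = {c. (y i c div 2 ^ j) mod 2 = 1}"
  have parent: "gcubes h \<omega> ((gleaf y)(i := ganc (Suc j) (y i))) = (\<lambda>r. cube (a r) (l r))"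
    by (auto simp: gcubes_def a_def l_def)
  have child: "gcubes h \<omega> ((gleaf y)(i := ganc j (y i))) = (\<lambda>r. cube (a r) (l r))(i := subcube (a i) (l i) S)"
  proof
    fix r
    show "gcubes h \<omega> ((gleaf y)(i := ganc j (y i))) r = ((\<lambda>r. cube (a r) (l r))(i := subcube (a i) (l i) S)) r"
    proof (cases "r = i")
      case True
      have "gcorner h \<omega> i (ganc j (y i)) = (\<chi> c. if c \<in> S then a i $ c + l i / 2 else a i $ c)"
      proof (rule vec_eq_iff[THEN iffD2], intro allI)
        fix c
        define z where "z = y i c div 2 ^ j"
        have "y i c div 2 ^ Suc j = z div 2" unfolding z_def power_Suc2 by (simp add: zdiv_zmult2_eq)
        moreover have "z = 2 * (z div 2) + z mod 2" by simp
        then have "real_of_int z = 2 * real_of_int (z div 2) + real_of_int (z mod 2)" by (metis of_int_add of_int_mult of_int_numeral)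
        moreover have "z mod 2 = 0 \<or> z mod 2 = 1" by auto
        ultimately show "gcorner h \<omega> i (ganc j (y i)) $ c = (\<chi> c. if c \<in> S then a i $ c + l i / 2 else a i $ c) $ c"
          by (auto simp: gcorner_def ganc_def a_def l_def gside_def S_def z_def[symmetric] algebra_simps)
      qed
      moreover have "gside h (ganc j (y i)) = l i / 2" by (simp add: l_def gside_def ganc_def)
      ultimately show ?thesis using True by (simp only: gcubes_def subcube_def fun_upd_same)
    next
      case False
      then show ?thesis by (simp add: gcubes_def a_def l_def)
    qed
  qed
  have "l r > 0" for r by (simp add: l_def gside_pos h)
  then have "ennreal d * (\<integral>\<^sup>+x\<in>block_prod (gcubes h \<omega> ((gleaf y)(i := ganc j (y i)))). ennreal (v x) \<partial>lebesgue)
    \<le> (\<integral>\<^sup>+x\<in>block_prod (gcubes h \<omega> ((gleaf y)(i := ganc (Suc j) (y i)))). ennreal (v x) \<partial>lebesgue)"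
    unfolding parent child using rd unfolding rect_rd_def by blast
  then have "ennreal d * ennreal (sum (gsum h \<omega> v) (grid.rect L UNIV ((gleaf y)(i := ganc j (y i)))))
     \<le> ennreal (sum (gsum h \<omega> v) (grid.rect L UNIV ((gleaf y)(i := ganc (Suc j) (y i)))))"
    using j by (simp add: sum_gsum_rect[OF v h nodes])
  then have "ennreal (d * sum (gsum h \<omega> v) (grid.rect L UNIV ((gleaf y)(i := ganc j (y i)))))
     \<le> ennreal (sum (gsum h \<omega> v) (grid.rect L UNIV ((gleaf y)(i := ganc (Suc j) (y i)))))"
    using d by (simp add: ennreal_mult')
  then show "d * (\<Sum>c\<in>grid.leaves L (ganc j (y i)). gsum h \<omega> v (y(i := c)))
     \<le> (\<Sum>c\<in>grid.leaves L (ganc (Suc j) (y i)). gsum h \<omega> v (y(i := c)))"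
    unfolding * by (subst (asm) ennreal_le_iff) (auto simp: gsum_def intro!: sum_nonneg)
qed

section \<open>The dyadic model of the potential\<close>

text \<open>The levels of the sides of \<open>R\<close> vary independently from block to block,
  matching the product kernel. The coefficient \<open>cc\<close> depends on the side lengths alone
  and stays abstract until the kernel is compared with it.\<close>

definition grid_sum :: "real \<Rightarrow> nat \<Rightarrow> real ^ 'n ^ 'k \<Rightarrow> (('k \<Rightarrow> real) \<Rightarrow> real) \<Rightarrow> ('m::finite \<Rightarrow> real ^ 'n ^ 'k \<Rightarrow> real)
    \<Rightarrow> real ^ 'n::finite ^ 'k::finite \<Rightarrow> real" where
  "grid_sum h L \<omega> cc f x = (\<Sum>R\<in>PiE UNIV (\<lambda>_. grid.nodes L). of_bool (gpos h \<omega> x \<in> grid.rect L UNIV R) *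
      (cc (\<lambda>s. gside h (R s)) * (\<Prod>i\<in>UNIV. sum (gsum h \<omega> (f i)) (grid.rect L UNIV R))))"

lemma grid_sum_nonneg:
  assumes "\<And>l. cc l \<ge> 0"
  shows "grid_sum h L \<omega> cc f x \<ge> 0"
  unfolding grid_sum_def using assms
  by (intro sum_nonneg mult_nonneg_nonneg prod_nonneg) (auto simp: gsum_def intro!: sum_nonneg)

lemma gpos_in_measurable:
  assumes "finite A"
  shows "{x. gpos h \<omega> x \<in> A} \<in> sets borel"
proof -
  have "{x. gpos h \<omega> x \<in> A} = (\<Union>z\<in>A. {x. gpos h \<omega> x = z})" by auto
  then show ?thesis using assms by (auto intro!: sets.finite_UN gpos_measurable)
qed

lemma grid_sum_measurable: "grid_sum h L \<omega> cc f \<in> borel_measurable borel"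
proof -
  have [measurable]: "{x. gpos h \<omega> x \<in> grid.rect L UNIV R} \<in> sets borel" for R
    by (rule gpos_in_measurable[OF grid.finite_rect]) simp
  have "grid_sum h L \<omega> cc f = (\<lambda>x. \<Sum>R\<in>PiE UNIV (\<lambda>_. grid.nodes L). indicator {x. gpos h \<omega> x \<in> grid.rect L UNIV R} x *
      (cc (\<lambda>s. gside h (R s)) * (\<Prod>i\<in>UNIV. sum (gsum h \<omega> (f i)) (grid.rect L UNIV R))))"
    by (intro ext) (simp add: grid_sum_def indicator_def of_bool_def)
  also have "\<dots> \<in> borel_measurable borel" by measurable
  finally show ?thesis .
qed

text \<open>The constant \<open>K\<close> is fixed before the weights, the functions, the mesh
  \<open>h\<close>, the height \<open>L\<close> and the origin. It comes from the exponents,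
  \<open>d\<close> and the number of blocks, and this uniformity is what later permits the passage
  to infinitely fine and large grids.\<close>

lemma grid_sum_estimate:
  fixes p :: "'m::finite \<Rightarrow> real" and p0 q d :: real
  assumes p: "\<And>i. 1 < p i" and p0: "1 / p0 = (\<Sum>i\<in>UNIV. 1 / p i)" and q: "p0 < q" and d: "d > 1"
  obtains K where "K \<ge> 0"
    "\<And>(v :: real ^ 'n::finite ^ 'k::finite \<Rightarrow> real) \<sigma> N f cc A M h L \<omega>.
      weight v \<Longrightarrow> rect_rd d v \<Longrightarrow> (\<And>x. v x \<ge> 0) \<Longrightarrow>
      (\<And>i. weight (\<sigma> i)) \<Longrightarrow> (\<And>i. rect_rd d (\<sigma> i)) \<Longrightarrow> (\<And>i x. \<sigma> i x \<ge> 0) \<Longrightarrow>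
      (\<And>i. N i \<in> borel_measurable lebesgue) \<Longrightarrow> (\<And>i x. N i x \<ge> 0) \<Longrightarrow>
      (\<And>i. M i \<ge> 0) \<Longrightarrow> (\<And>i. (\<integral>\<^sup>+x. ennreal (N i x) \<partial>lebesgue) \<le> ennreal (M i)) \<Longrightarrow>
      (\<And>i. AE x in lebesgue. f i x \<le> N i x powr (1 / p i) * \<sigma> i x powr (1 - 1 / p i)) \<Longrightarrow>
      (\<And>l. cc l \<ge> 0) \<Longrightarrow> A \<ge> 0 \<Longrightarrow>
      (\<And>a l. (\<And>s. l s > 0) \<Longrightarrow> cc l * enn2real (\<integral>\<^sup>+x\<in>block_prod (\<lambda>s. cube (a s) (l s)). ennreal (v x) \<partial>lebesgue) powr (1 / q) *
         (\<Prod>i\<in>UNIV. enn2real (\<integral>\<^sup>+x\<in>block_prod (\<lambda>s. cube (a s) (l s)). ennreal (\<sigma> i x) \<partial>lebesgue) powr (1 - 1 / p i)) \<le> A) \<Longrightarrow>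
      h > 0 \<Longrightarrow>
      (\<integral>\<^sup>+x. ennreal (v x * grid_sum h L \<omega> cc f x powr q) \<partial>lebesgue) \<le> ennreal (K * A powr q * (\<Prod>i\<in>UNIV. M i powr (q / p i)))"
proof -
  have p0pos: "p0 > 0" by (rule Holder_exponent_pos[OF p p0])
  \<comment> \<open>Any exponent strictly between \<open>p0\<close> and \<open>q\<close> would do;
    the midpoint is taken.\<close>
  define s where "s = (p0 + q) / 2"
  have s: "p0 < s" "s < q" "s > 0" using q p0pos by (auto simp: s_def)
  obtain Cv where Cv: "hedberg_const Cv d s q" using hedberg_const_exists[OF d s(3,2)] by blast
  have "\<exists>C. hedberg_const C d ((s * p i / p0) / (s * p i / p0 - 1)) (p i / (p i - 1))" for i
  proof -
    define S where "S = s * p i / p0"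
    have "S > p i" using s p0pos p[of i] by (simp add: S_def field_simps)
    then have "0 < S / (S - 1)" "S / (S - 1) < p i / (p i - 1)" using p[of i] by (auto simp: field_simps)
    then show ?thesis unfolding S_def[symmetric] by (rule hedberg_const_exists[OF d])
  qed
  then have "\<forall>i. \<exists>C. hedberg_const C d ((s * p i / p0) / (s * p i / p0 - 1)) (p i / (p i - 1))" ..
  from choice[OF this] obtain C where C: "\<And>i. hedberg_const (C i) d ((s * p i / p0) / (s * p i / p0 - 1)) (p i / (p i - 1))" by blast
  define K where "K = (Cv powr q) ^ card (UNIV :: 'k set) *
    (\<Prod>i\<in>UNIV. (((C i powr (p i/(p i-1))) ^ card (UNIV :: 'k set)) powr (s * p i / p0 * (1 - 1/p i))) powr (p0 / p i)) powr (q/s)"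
  have "K \<ge> 0" by (simp add: K_def)
  have main: "(\<integral>\<^sup>+x. ennreal (v x * grid_sum h L \<omega> cc f x powr q) \<partial>lebesgue) \<le> ennreal (K * A powr q * (\<Prod>i\<in>UNIV. M i powr (q / p i)))"
    if v: "weight v" "rect_rd d v" and v0: "\<And>x. v x \<ge> 0"
    and \<sigma>: "\<And>i. weight (\<sigma> i)" "\<And>i. rect_rd d (\<sigma> i)" and \<sigma>0: "\<And>i x. \<sigma> i x \<ge> 0"
    and Nm: "\<And>i. N i \<in> borel_measurable lebesgue" and N0: "\<And>i x. N i x \<ge> 0"
    and M0: "\<And>i. M i \<ge> 0" and M: "\<And>i. (\<integral>\<^sup>+x. ennreal (N i x) \<partial>lebesgue) \<le> ennreal (M i)"
    and f: "\<And>i. AE x in lebesgue. f i x \<le> N i x powr (1 / p i) * \<sigma> i x powr (1 - 1 / p i)"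
    and cc: "\<And>l. cc l \<ge> 0" and A0: "A \<ge> 0"
    and A: "\<And>a l. (\<And>s. l s > 0) \<Longrightarrow> cc l * enn2real (\<integral>\<^sup>+x\<in>block_prod (\<lambda>s. cube (a s) (l s)). ennreal (v x) \<partial>lebesgue) powr (1 / q) *
         (\<Prod>i\<in>UNIV. enn2real (\<integral>\<^sup>+x\<in>block_prod (\<lambda>s. cube (a s) (l s)). ennreal (\<sigma> i x) \<partial>lebesgue) powr (1 - 1 / p i)) \<le> A"
    and h: "h > 0"
    for v :: "real ^ 'n::finite ^ 'k::finite \<Rightarrow> real" and \<sigma> N f cc A M h L \<omega>
  proof -
    let ?X = "PiE (UNIV :: 'k set) (\<lambda>_. gX L :: ('n \<Rightarrow> int) set)"
    have fX: "finite ?X" by (intro finite_PiE) (auto simp: grid.finite_X)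
    \<comment> \<open>The model depends on \<open>x\<close> only through its mesh cell and vanishes
      outside the top cell. Its integral against \<open>v\<close> is thus a finite sum over mesh
      cells, weighted by \<open>gsum h \<omega> v\<close>.\<close>
    define \<Phi> where "\<Phi> z = (\<Sum>R\<in>PiE UNIV (\<lambda>_. grid.nodes L). of_bool (z \<in> grid.rect L UNIV R) *
      (cc (\<lambda>s. gside h (R s)) * (\<Prod>i\<in>UNIV. sum (gsum h \<omega> (f i)) (grid.rect L UNIV R))))" for z
    have \<Phi>: "grid_sum h L \<omega> cc f x = \<Phi> (gpos h \<omega> x)" for x by (simp add: grid_sum_def \<Phi>_def)
    have \<Phi>0: "\<Phi> z = 0" if "z \<notin> ?X" for z
      unfolding \<Phi>_def using that grid.rect_subset[of L UNIV] by (intro sum.neutral) auto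
    have vm[measurable]: "v \<in> borel_measurable lebesgue" using v by (simp add: weight_def)
    have \<sigma>m[measurable]: "\<sigma> i \<in> borel_measurable lebesgue" for i using \<sigma>(1)[of i] by (simp add: weight_def)
    note Nm[measurable]
    have [measurable]: "{x. gpos h \<omega> x = z} \<in> sets lebesgue" for z
      using gpos_measurable[of h \<omega> z] by simp
    have Nfin: "(\<integral>\<^sup>+x\<in>{x. gpos h \<omega> x = z}. ennreal (N i x) \<partial>lebesgue) < \<infinity>" for i z
    proof -
      have "(\<integral>\<^sup>+x\<in>{x. gpos h \<omega> x = z}. ennreal (N i x) \<partial>lebesgue) \<le> (\<integral>\<^sup>+x. ennreal (N i x) \<partial>lebesgue)"
        by (intro nn_integral_mono) (auto simp: indicator_def)
      also have "\<dots> \<le> ennreal (M i)" by (rule M)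
      finally show ?thesis by (simp add: le_less_trans)
    qed
    have "(\<integral>\<^sup>+x. ennreal (v x * grid_sum h L \<omega> cc f x powr q) \<partial>lebesgue)
      = (\<integral>\<^sup>+x. (\<Sum>z\<in>?X. ennreal (\<Phi> z powr q) * (ennreal (v x) * indicator {x. gpos h \<omega> x = z} x)) \<partial>lebesgue)"
    proof (rule nn_integral_cong)
      fix x
      have "(\<Sum>z\<in>?X. ennreal (\<Phi> z powr q) * (ennreal (v x) * indicator {x. gpos h \<omega> x = z} x))
        = (\<Sum>z\<in>?X. if z = gpos h \<omega> x then ennreal (\<Phi> z powr q) * ennreal (v x) else 0)"
        by (intro sum.cong refl) (auto simp: indicator_def)
      also have "\<dots> = (if gpos h \<omega> x \<in> ?X then ennreal (\<Phi> (gpos h \<omega> x) powr q) * ennreal (v x) else 0)"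
        using fX by simp
      also have "\<dots> = ennreal (v x * grid_sum h L \<omega> cc f x powr q)"
        using \<Phi>0 v0 by (auto simp: \<Phi> ennreal_mult mult.commute)
      finally show "ennreal (v x * grid_sum h L \<omega> cc f x powr q)
        = (\<Sum>z\<in>?X. ennreal (\<Phi> z powr q) * (ennreal (v x) * indicator {x. gpos h \<omega> x = z} x))" ..
    qed
    also have "\<dots> = (\<Sum>z\<in>?X. ennreal (\<Phi> z powr q) * (\<integral>\<^sup>+x\<in>{x. gpos h \<omega> x = z}. ennreal (v x) \<partial>lebesgue))"
      by (simp add: nn_integral_sum nn_integral_cmult)
    also have "\<dots> = (\<Sum>z\<in>?X. ennreal (gsum h \<omega> v z * \<Phi> z powr q))"
      using weight_fibre_finite[OF v(1) h, of _ L]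
      by (intro sum.cong refl) (simp add: gsum_def ennreal_mult less_top mult.commute)
    also have "\<dots> = ennreal (\<Sum>z\<in>?X. gsum h \<omega> v z * \<Phi> z powr q)"
      by (intro sum_ennreal) (simp add: gsum_def)
    also have "\<dots> \<le> ennreal (K * A powr q * (\<Prod>i\<in>UNIV. (\<Sum>z\<in>?X. gsum h \<omega> (N i) z) powr (q / p i)))"
    proof (rule ennreal_leI)
      show "(\<Sum>z\<in>?X. gsum h \<omega> v z * \<Phi> z powr q) \<le> K * A powr q * (\<Prod>i\<in>UNIV. (\<Sum>z\<in>?X. gsum h \<omega> (N i) z) powr (q / p i))"
        unfolding \<Phi>_def K_def
      proof (rule grid.multilinear_rect_sum_le[OF p p0 s(1,2) Cv C finite])
        show "gsum h \<omega> v x > 0" if "x \<in> ?X" for x by (rule gsum_pos[OF v(1) h that])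
        show "gsum h \<omega> (\<sigma> i) x > 0" if "x \<in> ?X" for i x by (rule gsum_pos[OF \<sigma>(1) h that])
        show "grid.separate_rd L d UNIV (gsum h \<omega> v)" by (rule separate_rd_gsum) (use v h d in auto)
        show "grid.separate_rd L d UNIV (gsum h \<omega> (\<sigma> i))" for i by (rule separate_rd_gsum) (use \<sigma> h d in auto)
        show "gsum h \<omega> (N i) x \<ge> 0" "gsum h \<omega> (f i) x \<ge> 0" for i x by (simp_all add: gsum_def)
        \<comment> \<open>Hoelder's inequality on a single mesh cell transfers the pointwise
          factorisation of \<open>f i\<close> to cell masses, the form in which the tree estimate
          takes it.\<close>
        show "gsum h \<omega> (f i) z \<le> gsum h \<omega> (N i) z powr (1/p i) * gsum h \<omega> (\<sigma> i) z powr (1 - 1/p i)" if z: "z \<in> ?X" for i z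
        proof -
          let ?I = "indicator {x. gpos h \<omega> x = z} :: _ \<Rightarrow> real"
          have "(\<integral>\<^sup>+x\<in>{x. gpos h \<omega> x = z}. ennreal (f i x) \<partial>lebesgue)
            \<le> (\<integral>\<^sup>+x. ennreal ((N i x * ?I x) powr (1 / p i) * (\<sigma> i x * ?I x) powr (1 - 1 / p i)) \<partial>lebesgue)"
          proof (rule nn_integral_mono_AE)
            show "AE x in lebesgue. ennreal (f i x) * indicator {x. gpos h \<omega> x = z} x
              \<le> ennreal ((N i x * ?I x) powr (1 / p i) * (\<sigma> i x * ?I x) powr (1 - 1 / p i))"
              using f[of i] by eventually_elim (auto simp: indicator_def intro: ennreal_leI)
          qed
          also have "\<dots> \<le> ennreal (gsum h \<omega> (N i) z powr (1 / p i) * gsum h \<omega> (\<sigma> i) z powr (1 - 1 / p i))"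
          proof (rule nn_integral_Holder)
            have "(\<integral>\<^sup>+x. ennreal (N i x * ?I x) \<partial>lebesgue) = (\<integral>\<^sup>+x\<in>{x. gpos h \<omega> x = z}. ennreal (N i x) \<partial>lebesgue)"
              by (intro nn_integral_cong) (simp add: indicator_def)
            then show "(\<integral>\<^sup>+x. ennreal (N i x * ?I x) \<partial>lebesgue) \<le> ennreal (gsum h \<omega> (N i) z)"
              using Nfin[of i z] by (simp add: gsum_def less_top)
            have "(\<integral>\<^sup>+x. ennreal (\<sigma> i x * ?I x) \<partial>lebesgue) = (\<integral>\<^sup>+x\<in>{x. gpos h \<omega> x = z}. ennreal (\<sigma> i x) \<partial>lebesgue)"
              by (intro nn_integral_cong) (simp add: indicator_def)
            then show "(\<integral>\<^sup>+x. ennreal (\<sigma> i x * ?I x) \<partial>lebesgue) \<le> ennreal (gsum h \<omega> (\<sigma> i) z)"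
              using weight_fibre_finite[OF \<sigma>(1) h z, of i \<omega>] by (simp add: gsum_def less_top)
          qed (use p[of i] N0 \<sigma>0 in \<open>auto simp: gsum_def\<close>)
          finally have "ennreal (gsum h \<omega> (f i) z) \<le> ennreal (gsum h \<omega> (N i) z powr (1 / p i) * gsum h \<omega> (\<sigma> i) z powr (1 - 1 / p i))"
            unfolding gsum_def[of h \<omega> "f i"] by (rule order.trans[rotated]) (simp add: ennreal_enn2real_if)
          then show ?thesis by (simp add: ennreal_le_iff)
        qed
        show "cc (\<lambda>s. gside h (R s)) * sum (gsum h \<omega> v) (grid.rect L UNIV R) powr (1 / q) *
          (\<Prod>i\<in>UNIV. sum (gsum h \<omega> (\<sigma> i)) (grid.rect L UNIV R) powr (1 - 1 / p i)) \<le> A" if R: "R \<in> PiE UNIV (\<lambda>_. grid.nodes L)" for R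
        proof -
          have *: "sum (gsum h \<omega> w) (grid.rect L UNIV R) = enn2real (\<integral>\<^sup>+x\<in>block_prod (gcubes h \<omega> R). ennreal (w x) \<partial>lebesgue)"
            if w: "weight w" for w
          proof -
            have "0 \<le> sum (gsum h \<omega> w) (grid.rect L UNIV R)" by (auto simp: gsum_def intro!: sum_nonneg)
            then show ?thesis unfolding sum_gsum_rect[OF w h R, symmetric] by simp
          qed
          show ?thesis unfolding *[OF v(1)] *[OF \<sigma>(1)] gcubes_def
            by (rule A) (simp add: gside_pos h)
        qed
      qed (use A0 cc in auto)
    qed
    also have "\<dots> \<le> ennreal (K * A powr q * (\<Prod>i\<in>UNIV. M i powr (q / p i)))"
    proof (intro ennreal_leI mult_left_mono prod_mono conjI powr_mono2 sum_nonneg)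
      fix i
      have "ennreal (\<Sum>z\<in>?X. gsum h \<omega> (N i) z) = (\<integral>\<^sup>+x\<in>{x. gpos h \<omega> x \<in> ?X}. ennreal (N i x) \<partial>lebesgue)"
        by (rule sum_gsum) (use Nm fX Nfin in auto)
      also have "\<dots> \<le> (\<integral>\<^sup>+x. ennreal (N i x) \<partial>lebesgue)"
        by (intro nn_integral_mono) (auto simp: indicator_def)
      also have "\<dots> \<le> ennreal (M i)" by (rule M)
      finally show "(\<Sum>z\<in>?X. gsum h \<omega> (N i) z) \<le> M i" using M0 by (simp add: ennreal_le_iff)
    qed (use p[THEN less_trans[OF zero_less_one]] s \<open>K \<ge> 0\<close> in \<open>auto simp: gsum_def intro: less_imp_le divide_nonneg_pos\<close>)
    finally show ?thesis .
  qed
  show ?thesis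
  proof (rule that[OF \<open>K \<ge> 0\<close>], goal_cases)
    case (1 v \<sigma> N f cc A M h L \<omega>)
    then show ?case by (intro main[where N=N and \<sigma>=\<sigma>]) blast+
  qed
qed

section \<open>Domination of the kernel by grids\<close>

text \<open>The larger of the two floors lies between \<open>a\<close> and \<open>b\<close>, hence
  within \<open>\<epsilon>\<close> of \<open>a\<close>.\<close>

lemma floor_neq_imp_close:
  fixes a b :: real
  assumes "\<lfloor>b\<rfloor> \<noteq> \<lfloor>a\<rfloor>" "\<bar>b - a\<bar> \<le> \<epsilon>"
  shows "\<exists>m :: int. \<bar>a - m\<bar> \<le> \<epsilon>"
proof (cases "\<lfloor>a\<rfloor> < \<lfloor>b\<rfloor>")
  case True
  then have "a < \<lfloor>b\<rfloor>" by (simp add: floor_less_iff[symmetric])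
  moreover have "\<lfloor>b\<rfloor> \<le> b" by simp
  ultimately have "\<bar>a - \<lfloor>b\<rfloor>\<bar> \<le> \<epsilon>" using assms(2) by (simp only: abs_le_iff) linarith
  then show ?thesis ..
next
  case False
  with assms(1) have "\<lfloor>b\<rfloor> < \<lfloor>a\<rfloor>" by simp
  then have "b < \<lfloor>a\<rfloor>" by (simp add: floor_less_iff[symmetric])
  moreover have "\<lfloor>a\<rfloor> \<le> a" by simp
  ultimately have "\<bar>a - \<lfloor>a\<rfloor>\<bar> \<le> \<epsilon>" using assms(2) by (simp only: abs_le_iff) linarith
  then show ?thesis ..
qed

text \<open>Two grids shifted by a third of the top scale are at every level shifted by a third or two
  thirds of the mesh, so a short interval cannot meet cell boundaries of both.\<close>

lemma third_shift:
  fixes t h r H :: real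
  assumes h: "h > 0" and H: "H = h * 2 ^ L" and j: "j \<le> L" and r: "6 * r < h * 2 ^ j"
  shows "\<exists>e. \<forall>t'. \<bar>t' - t\<bar> \<le> r \<longrightarrow> \<lfloor>(t' - (if e then - H / 3 else - 2 * H / 3)) / h\<rfloor> div 2 ^ j
     = \<lfloor>(t - (if e then - H / 3 else - 2 * H / 3)) / h\<rfloor> div 2 ^ j"
proof (rule ccontr)
  assume not: "\<not> ?thesis"
  define D where "D = h * 2 ^ j"
  have D: "D > 0" using h by (simp add: D_def)
  have fl: "\<lfloor>z / h\<rfloor> div 2 ^ j = \<lfloor>z / D\<rfloor>" for z
    using floor_divide_real_eq_div[of "2 ^ j" "z / h"] by (simp add: D_def)
  have close: "\<exists>m :: int. \<bar>(t - \<tau>) / D - m\<bar> \<le> r / D"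
    if "\<bar>t' - t\<bar> \<le> r" "\<lfloor>(t' - \<tau>) / D\<rfloor> \<noteq> \<lfloor>(t - \<tau>) / D\<rfloor>" for t' \<tau>
  proof (rule floor_neq_imp_close[OF that(2)])
    have "(t' - \<tau>) / D - (t - \<tau>) / D = (t' - t) / D" by (simp add: diff_divide_distrib)
    then show "\<bar>(t' - \<tau>) / D - (t - \<tau>) / D\<bar> \<le> r / D"
      using that(1) D by (simp add: abs_divide divide_right_mono)
  qed
  from not[unfolded fl not_ex, rule_format, of True]
  have "\<exists>t'. \<bar>t' - t\<bar> \<le> r \<and> \<lfloor>(t' - (- H / 3)) / D\<rfloor> \<noteq> \<lfloor>(t - (- H / 3)) / D\<rfloor>"
    unfolding if_True if_False by blast
  with close obtain m1 :: int where m1: "\<bar>(t - (- H / 3)) / D - m1\<bar> \<le> r / D" by blast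
  from not[unfolded fl not_ex, rule_format, of False]
  have "\<exists>t'. \<bar>t' - t\<bar> \<le> r \<and> \<lfloor>(t' - (- 2 * H / 3)) / D\<rfloor> \<noteq> \<lfloor>(t - (- 2 * H / 3)) / D\<rfloor>"
    unfolding if_True if_False by blast
  with close obtain m2 :: int where m2: "\<bar>(t - (- 2 * H / 3)) / D - m2\<bar> \<le> r / D" by blast
  define a1 where "a1 = (t - (- H / 3)) / D"
  define a2 where "a2 = (t - (- 2 * H / 3)) / D"
  have "a2 - a1 = ((t - (- 2 * H / 3)) - (t - (- H / 3))) / D"
    unfolding a1_def a2_def by (rule diff_divide_distrib[symmetric])
  also have "\<dots> = H / D / 3" by simp
  also have "H / D = 2 ^ (L - j)" using h j by (simp add: H D_def power_diff)
  finally have "\<bar>2 ^ (L - j) / 3 - real_of_int (m2 - m1)\<bar> \<le> 2 * (r / D)"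
    using m1[folded a1_def] m2[folded a2_def] unfolding of_int_diff by linarith
  \<comment> \<open>If both grids failed, \<open>2 ^ (L - j) / 3\<close> would be within
    \<open>2 * (r / D) < 1 / 3\<close> of an integer, so \<open>2 ^ (L - j)\<close> would be within
    less than 1 of a multiple of 3, hence equal to it.\<close>
  moreover have "r / D < 1 / 6" using r D by (simp add: D_def[symmetric] field_simps)
  ultimately have "\<bar>2 ^ (L - j) / 3 - real_of_int (m2 - m1)\<bar> < 1 / 3" by linarith
  then have "\<bar>real_of_int (2 ^ (L - j) - 3 * (m2 - m1))\<bar> < 1"
    unfolding abs_less_iff of_int_diff of_int_mult of_int_power of_int_numeral by (auto simp: field_simps)
  then have "\<bar>2 ^ (L - j) - 3 * (m2 - m1)\<bar> < 1" by linarith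
  then have "(2 :: int) ^ (L - j) = 3 * (m2 - m1)" by linarith
  then have "(2 :: int) ^ (L - j) mod 3 = 0" by simp
  moreover have "(2 :: int) ^ n mod 3 \<noteq> 0" for n
  proof (induction n)
    case (Suc n)
    have "(2 :: int) ^ Suc n mod 3 = (2 * (2 ^ n mod 3)) mod 3" by (simp add: mod_mult_right_eq)
    with Suc show ?case by presburger
  qed simp
  ultimately show False by metis
qed

text \<open>The shift is chosen separately in each coordinate of each block, which gives finitely
  many grids. Both shifts are negative so that all points with coordinates below
  \<open>H / 3\<close> in absolute value fall into the top cell: adding a third or two thirds of
  \<open>H\<close> leaves them between 0 and \<open>H\<close>.\<close>

definition grid_origin :: "real \<Rightarrow> ('k \<Rightarrow> 'n \<Rightarrow> bool) \<Rightarrow> real ^ 'n::finite ^ 'k::finite" where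
  "grid_origin H e = (\<chi> s c. if e s c then - H / 3 else - 2 * H / 3)"

definition block_dist :: "real ^ 'n ^ 'k \<Rightarrow> real ^ 'n::finite ^ 'k::finite ^ 'm::finite \<Rightarrow> 'k \<Rightarrow> real" where
  "block_dist x y s = (\<Sum>i\<in>UNIV. norm (x $ s - y $ i $ s))"

lemma block_dist_nonneg: "block_dist x y s \<ge> 0"
  by (simp add: block_dist_def sum_nonneg)

lemma abs_le_block_dist: "\<bar>y $ i $ s $ c - x $ s $ c\<bar> \<le> block_dist x y s"
proof -
  have "\<bar>y $ i $ s $ c - x $ s $ c\<bar> \<le> norm (x $ s - y $ i $ s)"
    using component_le_norm_cart[of "x $ s - y $ i $ s" c] by (simp add: abs_minus_commute)
  also have "\<dots> \<le> block_dist x y s"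
    unfolding block_dist_def by (rule member_le_sum) auto
  finally show ?thesis .
qed

text \<open>In each block the scale is the first one above 6 times the distance. The factor 6 is the
  margin required by \<open>third_shift\<close>, and 12 is its double, because scales are powers of
  2. The level depends on the block and the shift on the coordinate; together they yield one grid in
  which \<open>x\<close> and all \<open>y $ i\<close> share a rectangle of comparable sides.\<close>

lemma kernel_dominated:
  fixes x :: "real ^ 'n::finite ^ 'k::finite" and y :: "real ^ 'n ^ 'k ^ 'm::finite"
  assumes h: "h > 0" and \<beta>: "\<And>s. \<beta> s \<ge> 0" and H: "H = h * 2 ^ L"
    and r: "\<And>s. h \<le> 12 * block_dist x y s" "\<And>s. 6 * block_dist x y s < H"
    and x: "\<And>s c. \<bar>x $ s $ c\<bar> < H / 3"
  obtains e R where "R \<in> PiE UNIV (\<lambda>_. grid.nodes L)"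
    "gpos h (grid_origin H e) x \<in> grid.rect L UNIV R"
    "\<And>i. gpos h (grid_origin H e) (y $ i) \<in> grid.rect L UNIV R"
    "(\<Prod>s\<in>UNIV. block_dist x y s powr (- \<beta> s)) \<le> (\<Prod>s\<in>UNIV. 12 powr \<beta> s) * (\<Prod>s\<in>UNIV. gside h (R s) powr (- \<beta> s))"
proof -
  have "\<exists>j\<le>L. 6 * block_dist x y s < h * 2 ^ j \<and> h * 2 ^ j \<le> 12 * block_dist x y s" for s
  proof -
    \<comment> \<open>Minimality gives the upper bound by 12 times the distance when
      \<open>j > 0\<close>; for \<open>j = 0\<close> it is the assumption that the mesh is not
      coarse.\<close>
    define j where "j = (LEAST j. 6 * block_dist x y s < h * 2 ^ j)"
    have ex: "6 * block_dist x y s < h * 2 ^ L" using r(2)[of s] H by simp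
    then have 1: "6 * block_dist x y s < h * 2 ^ j" unfolding j_def by (rule LeastI)
    have 2: "j \<le> L" unfolding j_def using ex by (rule Least_le)
    have 3: "h * 2 ^ j \<le> 12 * block_dist x y s"
    proof (cases j)
      case 0
      then show ?thesis using r(1)[of s] by simp
    next
      case (Suc i)
      then have "\<not> 6 * block_dist x y s < h * 2 ^ i"
        using not_less_Least[of i "\<lambda>j. 6 * block_dist x y s < h * 2 ^ j"] by (simp add: j_def)
      then show ?thesis using Suc by simp
    qed
    from 1 2 3 show ?thesis by blast
  qed
  then have "\<forall>s. \<exists>j. j \<le> L \<and> 6 * block_dist x y s < h * 2 ^ j \<and> h * 2 ^ j \<le> 12 * block_dist x y s" by blast
  from choice[OF this] obtain j where j: "\<And>s. j s \<le> L" "\<And>s. 6 * block_dist x y s < h * 2 ^ j s"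
    "\<And>s. h * 2 ^ j s \<le> 12 * block_dist x y s" by blast
  have "\<forall>c. \<exists>e. \<forall>t'. \<bar>t' - x $ s $ c\<bar> \<le> block_dist x y s \<longrightarrow>
     \<lfloor>(t' - (if e then - H / 3 else - 2 * H / 3)) / h\<rfloor> div 2 ^ j s
     = \<lfloor>(x $ s $ c - (if e then - H / 3 else - 2 * H / 3)) / h\<rfloor> div 2 ^ j s" for s
    using third_shift[OF h H j(1,2)] by blast
  from choice[OF this] have "\<forall>s. \<exists>e. \<forall>c. \<forall>t'. \<bar>t' - x $ s $ c\<bar> \<le> block_dist x y s \<longrightarrow>
     \<lfloor>(t' - (if e c then - H / 3 else - 2 * H / 3)) / h\<rfloor> div 2 ^ j s
     = \<lfloor>(x $ s $ c - (if e c then - H / 3 else - 2 * H / 3)) / h\<rfloor> div 2 ^ j s" ..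
  from choice[OF this] obtain e where e: "\<And>s c t'. \<bar>t' - x $ s $ c\<bar> \<le> block_dist x y s \<Longrightarrow>
     \<lfloor>(t' - (if e s c then - H / 3 else - 2 * H / 3)) / h\<rfloor> div 2 ^ j s
     = \<lfloor>(x $ s $ c - (if e s c then - H / 3 else - 2 * H / 3)) / h\<rfloor> div 2 ^ j s" by blast
  let ?\<omega> = "grid_origin H e"
  have xX: "gpos h ?\<omega> x s \<in> gX L" for s
    unfolding gX_iff
  proof
    fix c
    have "0 \<le> (x $ s $ c - ?\<omega> $ s $ c) / h" "(x $ s $ c - ?\<omega> $ s $ c) / h < 2 ^ L"
      using x[of s c] h by (auto simp: grid_origin_def H[symmetric] pos_divide_less_eq mult.commute abs_less_iff zero_le_divide_iff)
    then show "0 \<le> gpos h ?\<omega> x s c \<and> gpos h ?\<omega> x s c < 2 ^ L"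
      by (simp add: gpos_def floor_less_iff)
  qed
  define R where "R s = ganc (j s) (gpos h ?\<omega> x s)" for s
  have R: "R \<in> PiE UNIV (\<lambda>_. grid.nodes L)"
    using j(1) xX by (auto simp: R_def grid.nodes_def PiE_iff)
  moreover have "gpos h ?\<omega> x \<in> grid.rect L UNIV R"
    unfolding grid.rect_def R_def grid_leaves_ganc[OF xX j(1)] by (simp add: PiE_iff)
  moreover have "gpos h ?\<omega> (y $ i) \<in> grid.rect L UNIV R" for i
    unfolding grid.rect_def R_def grid_leaves_ganc[OF xX j(1)]
    using e[OF abs_le_block_dist] by (simp add: PiE_iff gpos_def grid_origin_def)
  moreover have "(\<Prod>s\<in>UNIV. block_dist x y s powr (- \<beta> s)) \<le> (\<Prod>s\<in>UNIV. 12 powr \<beta> s) * (\<Prod>s\<in>UNIV. gside h (R s) powr (- \<beta> s))"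
    unfolding prod.distrib[symmetric]
  proof (intro prod_mono conjI)
    fix s
    have side: "gside h (R s) = h * 2 ^ j s" by (simp add: R_def gside_def ganc_def)
    have "block_dist x y s powr (- \<beta> s) \<le> (gside h (R s) / 12) powr (- \<beta> s)"
      using j(3)[of s] h \<beta>[of s] unfolding side by (intro powr_mono2') auto
    also have "\<dots> = 12 powr \<beta> s * gside h (R s) powr (- \<beta> s)"
      using gside_pos[OF h, of "R s"] by (simp add: powr_divide powr_minus_divide)
    finally show "block_dist x y s powr (- \<beta> s) \<le> 12 powr \<beta> s * gside h (R s) powr (- \<beta> s)" .
  qed simp
  ultimately show ?thesis by (rule that)
qed

lemma block_dist_measurable[measurable]: "(\<lambda>y. block_dist x y s) \<in> borel_measurable borel"
  unfolding block_dist_def by (intro borel_measurable_continuous_onI continuous_intros)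

text \<open>The Riesz integrand with its quotient written as negative powers, where
  \<open>\<beta> s\<close> stands for \<open>m * n - \<alpha> s\<close>. At the singularity both
  forms give 0, one by division by 0, the other because 0 to any power is 0.\<close>

definition pot_integrand :: "('k \<Rightarrow> real) \<Rightarrow> ('m \<Rightarrow> real ^ 'n ^ 'k \<Rightarrow> real) \<Rightarrow> real ^ 'n ^ 'k
      \<Rightarrow> real ^ 'n::finite ^ 'k::finite ^ 'm::finite \<Rightarrow> real" where
  "pot_integrand \<beta> f x y = (\<Prod>i\<in>UNIV. f i (y $ i)) * (\<Prod>s\<in>UNIV. block_dist x y s powr (- \<beta> s))"

lemma pot_integrand_measurable:
  assumes [measurable]: "\<And>i. f i \<in> borel_measurable borel"
  shows "pot_integrand \<beta> f x \<in> borel_measurable borel"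
  unfolding pot_integrand_def[abs_def] by measurable

text \<open>The hypotheses of \<open>kernel_dominated\<close> for mesh \<open>2^-N\<close> and top
  scale \<open>2^N\<close>, as a set of \<open>y\<close>; it is empty when \<open>x\<close> is
  outside the range of the grids.\<close>

definition trunc_region :: "nat \<Rightarrow> real ^ 'n ^ 'k \<Rightarrow> (real ^ 'n::finite ^ 'k::finite ^ 'm::finite) set" where
  "trunc_region N x = {y. (\<forall>s c. \<bar>x $ s $ c\<bar> < 2 ^ N / 3) \<and> (\<forall>s. (1/2) ^ N \<le> 12 * block_dist x y s \<and> 6 * block_dist x y s < 2 ^ N)}"

lemma trunc_region_measurable[measurable]:
  "(trunc_region N x :: (real ^ 'n::finite ^ 'k::finite ^ 'm::finite) set) \<in> sets borel"
proof -
  have m: "{y \<in> space (borel :: (real ^ 'n ^ 'k ^ 'm) measure). \<forall>s\<in>UNIV. (1/2) ^ N \<le> 12 * block_dist x y s \<and> 6 * block_dist x y s < 2 ^ N} \<in> sets borel"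
    by measurable
  have "trunc_region N x = {y \<in> space (borel :: (real ^ 'n ^ 'k ^ 'm) measure). \<forall>s\<in>UNIV. (1/2) ^ N \<le> 12 * block_dist x y s \<and> 6 * block_dist x y s < 2 ^ N}
    \<or> trunc_region N x = ({} :: (real ^ 'n ^ 'k ^ 'm) set)"
    unfolding trunc_region_def by auto
  then show ?thesis
  proof
    assume "trunc_region N x = {y \<in> space (borel :: (real ^ 'n ^ 'k ^ 'm) measure). \<forall>s\<in>UNIV. (1/2) ^ N \<le> 12 * block_dist x y s \<and> 6 * block_dist x y s < 2 ^ N}"
    with m show ?thesis by (simp only:)
  qed simp
qed

text \<open>On the truncated region every integrand value is below one term of the double sum over
  origins \<open>e\<close> and rectangles \<open>R\<close>. That term is a product in the
  \<open>y $ i\<close>, so its integral factors into the cell sums of the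
  \<open>f i\<close>.\<close>

lemma truncated_potential_le:
  fixes f :: "'m::finite \<Rightarrow> real ^ 'n::finite ^ 'k::finite \<Rightarrow> real"
  assumes fm[measurable]: "\<And>i. f i \<in> borel_measurable borel" and f0: "\<And>i x. f i x \<ge> 0"
    and fin: "\<And>i K. compact K \<Longrightarrow> (\<integral>\<^sup>+x\<in>K. ennreal (f i x) \<partial>lebesgue) < \<infinity>"
    and \<beta>: "\<And>s. \<beta> s \<ge> 0"
  shows "(\<integral>\<^sup>+y\<in>trunc_region N x. ennreal (pot_integrand \<beta> f x y) \<partial>lborel)
    \<le> ennreal ((\<Prod>s\<in>UNIV. 12 powr \<beta> s) *
       (\<Sum>e\<in>UNIV. grid_sum ((1/2) ^ N) (2 * N) (grid_origin (2 ^ N) e) (\<lambda>l. \<Prod>s\<in>UNIV. l s powr (- \<beta> s)) f x))"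
proof -
  define h :: real where "h = (1/2) ^ N"
  \<comment> \<open>From mesh \<open>2^-N\<close> it takes \<open>2 * N\<close> doublings to reach
    the top scale \<open>2^N\<close>.\<close>
  define L where "L = 2 * N"
  have h: "h > 0" by (simp add: h_def)
  have H: "(2 :: real) ^ N = h * 2 ^ L" by (simp add: h_def L_def mult_2 power_add power_divide)
  define C0 where "C0 = (\<Prod>s\<in>UNIV. 12 powr \<beta> s)"
  have C0: "C0 \<ge> 0" by (simp add: C0_def prod_nonneg)
  define cc where "cc = (\<lambda>l :: 'k \<Rightarrow> real. \<Prod>s\<in>UNIV. l s powr (- \<beta> s))"
  have cc: "cc l \<ge> 0" for l by (simp add: cc_def prod_nonneg)
  define \<omega> :: "('k \<Rightarrow> 'n \<Rightarrow> bool) \<Rightarrow> real ^ 'n ^ 'k" where "\<omega> e = grid_origin (2 ^ N) e" for e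
  define k where "k e R = of_bool (gpos h (\<omega> e) x \<in> grid.rect L UNIV R) * (C0 * cc (\<lambda>s. gside h (R s)))" for e R
  have k: "k e R \<ge> 0" for e R using C0 cc by (simp add: k_def)
  let ?N = "PiE (UNIV :: 'k set) (\<lambda>_. grid.nodes L) :: ('k \<Rightarrow> nat \<times> ('n \<Rightarrow> int)) set"
  have fN: "finite ?N" by (intro finite_PiE grid.finite_nodes) auto
  let ?Z = "\<lambda>e R. {t. gpos h (\<omega> e) t \<in> grid.rect L UNIV R}"
  have Zm[measurable]: "?Z e R \<in> sets borel" for e R
    by (rule gpos_in_measurable[OF grid.finite_rect]) simp
  let ?G = "\<lambda>e R y. ennreal (k e R) * (\<Prod>i\<in>UNIV. ennreal (f i (y $ i)) * indicator (?Z e R) (y $ i))"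
  have "(\<integral>\<^sup>+y\<in>trunc_region N x. ennreal (pot_integrand \<beta> f x y) \<partial>lborel)
    \<le> (\<integral>\<^sup>+y. (\<Sum>e\<in>UNIV. \<Sum>R\<in>?N. ?G e R y) \<partial>lborel)"
  proof (rule nn_integral_mono)
    fix y
    show "ennreal (pot_integrand \<beta> f x y) * indicator (trunc_region N x) y \<le> (\<Sum>e\<in>UNIV. \<Sum>R\<in>?N. ?G e R y)"
    proof (cases "y \<in> trunc_region N x")
      case True
      then have c: "\<And>s. h \<le> 12 * block_dist x y s" "\<And>s. 6 * block_dist x y s < 2 ^ N" "\<And>s c. \<bar>x $ s $ c\<bar> < 2 ^ N / 3"
        by (auto simp: trunc_region_def h_def)
      obtain e R where R: "R \<in> ?N" "gpos h (\<omega> e) x \<in> grid.rect L UNIV R"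
        "\<And>i. gpos h (\<omega> e) (y $ i) \<in> grid.rect L UNIV R"
        "(\<Prod>s\<in>UNIV. block_dist x y s powr (- \<beta> s)) \<le> C0 * cc (\<lambda>s. gside h (R s))"
        unfolding \<omega>_def C0_def cc_def
        by (rule kernel_dominated[where \<beta>=\<beta>, OF h \<beta> H c]) blast
      have "pot_integrand \<beta> f x y \<le> (\<Prod>i\<in>UNIV. f i (y $ i)) * k e R"
        unfolding pot_integrand_def using R f0 by (intro mult_left_mono prod_nonneg) (auto simp: k_def)
      then have "ennreal (pot_integrand \<beta> f x y) \<le> ennreal (k e R * (\<Prod>i\<in>UNIV. f i (y $ i)))"
        by (intro ennreal_leI) (simp add: mult.commute)
      also have "\<dots> = ?G e R y"
        using R(3) k f0 by (simp add: ennreal_mult prod_nonneg prod_ennreal)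
      also have "\<dots> \<le> (\<Sum>R\<in>?N. ?G e R y)" by (rule member_le_sum) (use R(1) fN in auto)
      also have "\<dots> \<le> (\<Sum>e\<in>UNIV. \<Sum>R\<in>?N. ?G e R y)"
        by (rule member_le_sum[where f="\<lambda>e. \<Sum>R\<in>?N. ?G e R y"]) auto
      finally show ?thesis using True by simp
    qed simp
  qed
  also have "\<dots> = (\<Sum>e\<in>UNIV. \<Sum>R\<in>?N. ennreal (k e R) * (\<integral>\<^sup>+y. (\<Prod>i\<in>UNIV. ennreal (f i (y $ i)) * indicator (?Z e R) (y $ i)) \<partial>lborel))"
    by (simp add: nn_integral_sum nn_integral_cmult)
  also have "\<dots> = (\<Sum>e\<in>UNIV. \<Sum>R\<in>?N. ennreal (k e R * (\<Prod>i\<in>UNIV. sum (gsum h (\<omega> e) (f i)) (grid.rect L UNIV R))))"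
  proof (intro sum.cong refl)
    fix e R assume R: "R \<in> ?N"
    have "(\<integral>\<^sup>+y. (\<Prod>i\<in>UNIV. ennreal (f i (y $ i)) * indicator (?Z e R) (y $ i)) \<partial>lborel)
      = (\<Prod>i\<in>UNIV. \<integral>\<^sup>+t. ennreal (f i t) * indicator (?Z e R) t \<partial>lborel)"
      by (rule nn_integral_lborel_vec_prod) measurable
    also have "\<dots> = (\<Prod>i\<in>UNIV. ennreal (sum (gsum h (\<omega> e) (f i)) (grid.rect L UNIV R)))"
    proof (intro prod.cong refl)
      fix i
      have "ennreal (sum (gsum h (\<omega> e) (f i)) (grid.rect L UNIV R)) = (\<integral>\<^sup>+t\<in>?Z e R. ennreal (f i t) \<partial>lebesgue)"
      proof (rule sum_gsum)
        show "f i \<in> borel_measurable lebesgue" by (rule measurable_completion) (use fm[of i] in simp)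
        show "finite (grid.rect L UNIV R)" by (rule grid.finite_rect) simp
        fix z assume "z \<in> grid.rect L UNIV R"
        then have "z \<in> PiE UNIV (\<lambda>_. gX L)" using grid.rect_subset by blast
        then show "(\<integral>\<^sup>+t\<in>{t. gpos h (\<omega> e) t = z}. ennreal (f i t) \<partial>lebesgue) < \<infinity>"
          using fin[OF compact_gcubes] by (subst fibre_integral_eq[OF h]) auto
      qed
      then show "(\<integral>\<^sup>+t. ennreal (f i t) * indicator (?Z e R) t \<partial>lborel) = ennreal (sum (gsum h (\<omega> e) (f i)) (grid.rect L UNIV R))"
        by (subst (asm) nn_integral_completion) (rule sym)
    qed
    also have "\<dots> = ennreal (\<Prod>i\<in>UNIV. sum (gsum h (\<omega> e) (f i)) (grid.rect L UNIV R))"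
      by (rule prod_ennreal) (simp add: gsum_def sum_nonneg)
    finally show "ennreal (k e R) * (\<integral>\<^sup>+y. (\<Prod>i\<in>UNIV. ennreal (f i (y $ i)) * indicator (?Z e R) (y $ i)) \<partial>lborel)
      = ennreal (k e R * (\<Prod>i\<in>UNIV. sum (gsum h (\<omega> e) (f i)) (grid.rect L UNIV R)))"
      using k by (simp add: ennreal_mult')
  qed
  also have "\<dots> = (\<Sum>e\<in>UNIV. ennreal (\<Sum>R\<in>?N. k e R * (\<Prod>i\<in>UNIV. sum (gsum h (\<omega> e) (f i)) (grid.rect L UNIV R))))"
    using k by (intro sum.cong refl sum_ennreal mult_nonneg_nonneg prod_nonneg) (auto simp: gsum_def intro!: sum_nonneg)
  also have "\<dots> = (\<Sum>e\<in>UNIV. ennreal (C0 * grid_sum h L (\<omega> e) cc f x))"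
    by (simp add: grid_sum_def k_def sum_distrib_left mult_ac)
  also have "\<dots> = ennreal (\<Sum>e\<in>UNIV. C0 * grid_sum h L (\<omega> e) cc f x)"
    by (intro sum_ennreal mult_nonneg_nonneg C0 grid_sum_nonneg cc)
  finally show ?thesis
    by (simp add: C0_def cc_def \<omega>_def h_def L_def sum_distrib_left)
qed

text \<open>Fatou's lemma in \<open>y\<close>. A point \<open>y\<close> with all block distances
  positive lies in \<open>trunc_region N x\<close> for all large \<open>N\<close>; for the other
  \<open>y\<close> the integrand is 0 by convention, so they need no truncation.\<close>

lemma potential_le_liminf:
  fixes f :: "'m::finite \<Rightarrow> real ^ 'n::finite ^ 'k::finite \<Rightarrow> real"
  assumes fm[measurable]: "\<And>i. f i \<in> borel_measurable borel" and f0: "\<And>i x. f i x \<ge> 0"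
    and fin: "\<And>i K. compact K \<Longrightarrow> (\<integral>\<^sup>+x\<in>K. ennreal (f i x) \<partial>lebesgue) < \<infinity>"
    and \<beta>: "\<And>s. \<beta> s > 0"
  shows "(\<integral>\<^sup>+y. ennreal (pot_integrand \<beta> f x y) \<partial>lborel)
    \<le> liminf (\<lambda>N. ennreal ((\<Prod>s\<in>UNIV. 12 powr \<beta> s) *
       (\<Sum>e\<in>UNIV. grid_sum ((1/2) ^ N) (2 * N) (grid_origin (2 ^ N) e) (\<lambda>l. \<Prod>s\<in>UNIV. l s powr (- \<beta> s)) f x)))"
proof -
  have small: "\<forall>\<^sub>F N in sequentially. (1/2 :: real) ^ N < \<epsilon>" if "\<epsilon> > 0" for \<epsilon>
    using order_tendstoD(2)[OF LIMSEQ_power_zero[of "1/2 :: real"] that] by simp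
  have large: "\<forall>\<^sub>F N in sequentially. B < (2 :: real) ^ N" for B
  proof -
    have "\<forall>\<^sub>F N in sequentially. (1/2 :: real) ^ N < 1 / (\<bar>B\<bar> + 1)" by (rule small) simp
    then show ?thesis
    proof eventually_elim
      case (elim N)
      have "\<bar>B\<bar> + 1 < 2 ^ N"
      proof (rule ccontr)
        assume "\<not> ?thesis"
        then have "1 / (\<bar>B\<bar> + 1) \<le> 1 / 2 ^ N" by (intro frac_le) auto
        with elim show False by (simp add: power_one_over)
      qed
      then show ?case by simp
    qed
  qed
  have [measurable]: "pot_integrand \<beta> f x \<in> borel_measurable borel" by (rule pot_integrand_measurable) simp
  have "ennreal (pot_integrand \<beta> f x y) \<le> liminf (\<lambda>N. ennreal (pot_integrand \<beta> f x y) * indicator (trunc_region N x) y)" for y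
  proof (cases "\<forall>s. block_dist x y s > 0")
    case True
    have "\<forall>\<^sub>F N in sequentially. \<forall>s\<in>UNIV. (1/2) ^ N < 12 * block_dist x y s \<and> 6 * block_dist x y s < 2 ^ N"
      unfolding eventually_ball_finite_distrib[OF finite] using True by (auto intro!: eventually_conj small large)
    moreover have "\<forall>\<^sub>F N in sequentially. \<forall>s\<in>UNIV. \<forall>c\<in>UNIV. 3 * \<bar>x $ s $ c\<bar> < 2 ^ N"
      unfolding eventually_ball_finite_distrib[OF finite] using large by auto
    ultimately have "\<forall>\<^sub>F N in sequentially. y \<in> trunc_region N x"
      by eventually_elim (auto simp: trunc_region_def less_imp_le mult.commute)
    then have "\<forall>\<^sub>F N in sequentially. ennreal (pot_integrand \<beta> f x y) \<le> ennreal (pot_integrand \<beta> f x y) * indicator (trunc_region N x) y"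
      by eventually_elim simp
    then show ?thesis by (rule Liminf_bounded)
  next
    case False
    then obtain s where "block_dist x y s = 0" using block_dist_nonneg[of x y] by (auto simp: not_less intro: antisym)
    then have "(\<Prod>s\<in>UNIV. block_dist x y s powr (- \<beta> s)) = 0" by (intro prod_zero bexI[of _ s]) auto
    then have "pot_integrand \<beta> f x y = 0" unfolding pot_integrand_def by (simp only: mult_zero_right)
    then show ?thesis by simp
  qed
  then have "(\<integral>\<^sup>+y. ennreal (pot_integrand \<beta> f x y) \<partial>lborel)
    \<le> (\<integral>\<^sup>+y. liminf (\<lambda>N. ennreal (pot_integrand \<beta> f x y) * indicator (trunc_region N x) y) \<partial>lborel)"
    by (intro nn_integral_mono)
  also have "\<dots> \<le> liminf (\<lambda>N. \<integral>\<^sup>+y\<in>trunc_region N x. ennreal (pot_integrand \<beta> f x y) \<partial>lborel)"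
    by (rule nn_integral_liminf) measurable
  also have "\<dots> \<le> liminf (\<lambda>N. ennreal ((\<Prod>s\<in>UNIV. 12 powr \<beta> s) *
       (\<Sum>e\<in>UNIV. grid_sum ((1/2) ^ N) (2 * N) (grid_origin (2 ^ N) e) (\<lambda>l. \<Prod>s\<in>UNIV. l s powr (- \<beta> s)) f x)))"
    by (intro Liminf_mono always_eventually allI truncated_potential_le fm f0 fin less_imp_le[OF \<beta>])
  finally show ?thesis .
qed

lemma sum_powr_le_card:
  fixes a :: "'a \<Rightarrow> real"
  assumes E: "finite E" "E \<noteq> {}" and a: "\<And>e. e \<in> E \<Longrightarrow> a e \<ge> 0" and q: "q > 0"
  shows "(\<Sum>e\<in>E. a e) powr q \<le> card E powr q * (\<Sum>e\<in>E. a e powr q)"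
proof -
  obtain e0 where e0: "e0 \<in> E" "\<And>e. e \<in> E \<Longrightarrow> a e \<le> a e0"
    using Max_in[of "a ` E"] Max_ge[of "a ` E"] E by (metis (no_types, lifting) empty_is_image finite_imageI imageE image_eqI)
  have "(\<Sum>e\<in>E. a e) \<le> card E * a e0"
    using sum_bounded_above[of E a "a e0"] e0(2) by simp
  then have "(\<Sum>e\<in>E. a e) powr q \<le> (card E * a e0) powr q"
    using q a by (intro powr_mono2 sum_nonneg) auto
  also have "\<dots> = card E powr q * a e0 powr q" by (simp add: powr_mult)
  also have "\<dots> \<le> card E powr q * (\<Sum>e\<in>E. a e powr q)"
    by (intro mult_left_mono member_le_sum e0(1) E(1)) auto
  finally show ?thesis .
qed

section \<open>Extended powers, dual weights and the Riesz integrand\<close>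

lemma epow_ennreal: "r \<ge> 0 \<Longrightarrow> epow (ennreal r) a = ennreal (r powr a)"
  by (simp add: epow_def)

lemma epow_mono:
  assumes "x \<le> y" "a > 0"
  shows "epow x a \<le> epow y a"
proof (cases "y = \<infinity>")
  case False
  then obtain r where r: "y = ennreal r" "r \<ge> 0" by (cases y) auto
  then obtain z where z: "x = ennreal z" "z \<ge> 0" using assms(1) by (cases x) (auto simp: top_unique)
  then show ?thesis using r assms by (auto simp: epow_ennreal ennreal_le_iff intro!: ennreal_leI powr_mono2)
qed (simp add: epow_def)

lemma conj_exp_facts:
  assumes "1 < r"
  shows "1 / conj_exp r = 1 - 1 / r" "conj_exp r > 0" "conj_exp r * (1 - 1 / r) = 1" "r - conj_exp r * r = - conj_exp r"
  using assms by (auto simp: conj_exp_def field_simps)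

lemma weightI_rect:
  fixes \<rho> :: "real ^ 'n::finite ^ 'k::finite \<Rightarrow> real"
  assumes m: "\<rho> \<in> borel_measurable lebesgue" and pos: "ae_positive \<rho>" and nn: "\<And>x. \<rho> x \<ge> 0"
    and fin: "\<And>a l. (\<integral>\<^sup>+x\<in>block_prod (\<lambda>s. cube (a s) (l s)). ennreal (\<rho> x) \<partial>lebesgue) < \<infinity>"
  shows "weight \<rho>"
  unfolding weight_def
proof (intro conjI allI impI m pos)
  fix K :: "(real ^ 'n ^ 'k) set" assume K: "compact K"
  then obtain B where B: "\<And>x. x \<in> K \<Longrightarrow> norm x \<le> B" using compact_imp_bounded bounded_iff by metis
  have sub: "K \<subseteq> block_prod (\<lambda>s. cube (\<chi> c. - B) (2 * B))"
  proof
    fix x assume "x \<in> K"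
    have "\<bar>x $ s $ c\<bar> \<le> B" for s c
    proof -
      have "\<bar>x $ s $ c\<bar> \<le> norm (x $ s)" by (rule component_le_norm_cart)
      also have "\<dots> \<le> norm x" by (rule Finite_Cartesian_Product.norm_nth_le)
      also have "\<dots> \<le> B" using B \<open>x \<in> K\<close> .
      finally show ?thesis .
    qed
    then show "x \<in> block_prod (\<lambda>s. cube (\<chi> c. - B) (2 * B))"
      by (auto simp: block_prod_def cube_def mem_box_cart abs_le_iff minus_le_iff)
  qed
  have Km[measurable]: "K \<in> sets lebesgue" using K by (intro lmeasurable_compact fmeasurableD)
  show "set_integrable lebesgue K \<rho>"
    unfolding set_integrable_def
  proof (rule integrableI_bounded)
    have "(\<integral>\<^sup>+x. ennreal (norm (indicator K x *\<^sub>R \<rho> x)) \<partial>lebesgue) = (\<integral>\<^sup>+x\<in>K. ennreal (\<rho> x) \<partial>lebesgue)"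
      using nn by (intro nn_integral_cong) (auto simp: indicator_def)
    also have "\<dots> \<le> (\<integral>\<^sup>+x\<in>block_prod (\<lambda>s. cube (\<chi> c. - B) (2 * B)). ennreal (\<rho> x) \<partial>lebesgue)"
      by (rule set_nn_integral_mono_set[OF sub])
    also have "\<dots> < \<infinity>" by (rule fin)
    finally show "(\<integral>\<^sup>+x. ennreal (norm (indicator K x *\<^sub>R \<rho> x)) \<partial>lebesgue) < \<infinity>" .
  qed (use m in measurable)
qed

text \<open>A power of a product is the product of the powers, so the dual weight has masses on
  rectangles that factor into finite masses of reverse doubling weights. This gives local
  integrability as well as reverse doubling of the dual weight.\<close>

lemma product_dual_weight:
  fixes W :: "'k::finite \<Rightarrow> real ^ 'n::finite \<Rightarrow> real"
  assumes r: "1 < r" and w: "\<And>x. w x = (\<Prod>j\<in>UNIV. W j (x $ j))" and wpos: "ae_positive w"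
    and ww: "weight (\<lambda>x. w x powr r)"
    and RD: "\<And>j. reverse_doubling (\<lambda>t. W j t powr (- conj_exp r))"
  shows "weight (\<lambda>x. w x powr (- conj_exp r))" "\<exists>d>1. rect_rd d (\<lambda>x. w x powr (- conj_exp r))"
proof -
  have prod: "w x powr (- conj_exp r) = (\<Prod>j\<in>UNIV. W j (x $ j) powr (- conj_exp r))" for x
    by (simp add: w prod_powr_distrib)
  show "\<exists>d>1. rect_rd d (\<lambda>x. w x powr (- conj_exp r))"
    by (rule rect_rd_product[OF RD]) (auto simp: prod)
  have wW: "weight (\<lambda>t. W j t powr (- conj_exp r))" for j using RD[of j] by (simp add: reverse_doubling_def)
  show "weight (\<lambda>x. w x powr (- conj_exp r))"
  proof (rule weightI_rect)
    have [measurable]: "(\<lambda>x. w x powr r) \<in> borel_measurable lebesgue" using ww by (simp add: weight_def)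
    \<comment> \<open>Measurability is known for \<open>w x powr r\<close> rather than for
      \<open>w\<close>, so the dual weight is written as a power of that.\<close>
    have "(\<lambda>x. w x powr (- conj_exp r)) = (\<lambda>x. (w x powr r) powr (- conj_exp r / r))"
      using r by (simp add: powr_powr)
    also have "\<dots> \<in> borel_measurable lebesgue" by measurable
    finally show "(\<lambda>x. w x powr (- conj_exp r)) \<in> borel_measurable lebesgue" .
    show "ae_positive (\<lambda>x. w x powr (- conj_exp r))"
      using wpos unfolding ae_positive_def by eventually_elim simp
    fix a l
    have "(\<integral>\<^sup>+x\<in>block_prod (\<lambda>s. cube (a s) (l s)). ennreal (w x powr (- conj_exp r)) \<partial>lebesgue)
      = (\<Prod>j\<in>UNIV. \<integral>\<^sup>+t\<in>cube (a j) (l j). ennreal (W j t powr (- conj_exp r)) \<partial>lebesgue)"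
      by (rule rect_integral_product) (use wW in \<open>auto simp: prod weight_def\<close>)
    also have "\<dots> < \<infinity>"
      using weight_finite[OF wW compact_cube, THEN less_imp_neq]
      by (simp add: ennreal_prod_eq_top less_top[symmetric])
    finally show "(\<integral>\<^sup>+x\<in>block_prod (\<lambda>s. cube (a s) (l s)). ennreal (w x powr (- conj_exp r)) \<partial>lebesgue) < \<infinity>" .
  qed simp
qed

lemma riesz_integrand_eq:
  fixes f :: "'m::finite \<Rightarrow> real ^ 'n::finite ^ 'k::finite \<Rightarrow> real"
  shows "riesz_integrand \<alpha> f x y = pot_integrand (\<lambda>s. real CARD('m) * real CARD('n) - \<alpha> s) f x y"
  unfolding riesz_integrand_def pot_integrand_def block_dist_def powr_minus
  by (simp add: divide_inverse prod_inversef[symmetric] o_def)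

lemma abs_pot_integrand: "\<bar>pot_integrand \<beta> f x y\<bar> = pot_integrand \<beta> (\<lambda>i t. \<bar>f i t\<bar>) x y"
  by (simp add: pot_integrand_def abs_mult abs_prod)

lemma pot_integrand_AE_eq:
  fixes f g :: "'m::finite \<Rightarrow> real ^ 'n::finite ^ 'k::finite \<Rightarrow> real"
  assumes "\<And>i. AE t in lborel. f i t = g i t"
  shows "AE y in lborel. pot_integrand \<beta> f x y = pot_integrand \<beta> g x y"
proof -
  have "AE y in (lborel :: (real ^ 'n ^ 'k ^ 'm) measure). \<forall>i\<in>UNIV. f i (y $ i) = g i (y $ i)"
    by (subst AE_finite_all) (simp_all add: AE_lborel_vec_nth[OF assms])
  then show ?thesis by eventually_elim (simp add: pot_integrand_def)
qed

lemma pot_integrand_lebesgue_measurable: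
  fixes f :: "'m::finite \<Rightarrow> real ^ 'n::finite ^ 'k::finite \<Rightarrow> real"
  assumes "\<And>i. f i \<in> borel_measurable lebesgue"
  shows "pot_integrand \<beta> f x \<in> borel_measurable lebesgue"
proof -
  have "\<forall>i. \<exists>g. g \<in> borel_measurable borel \<and> (AE t in lborel. f i t = g t)"
    using completion_ex_borel_measurable_real[OF assms] by auto
  from choice[OF this] obtain g where g: "\<And>i. g i \<in> borel_measurable borel" "\<And>i. AE t in lborel. f i t = g i t" by blast
  have "pot_integrand \<beta> g x \<in> borel_measurable lebesgue"
    by (rule measurable_completion) (use pot_integrand_measurable[OF g(1)] in simp)
  moreover have "AE y in lebesgue. pot_integrand \<beta> g x y = pot_integrand \<beta> f x y"
    using pot_integrand_AE_eq[OF g(2)] by (simp add: AE_lebesgue_iff eq_commute)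
  ultimately show ?thesis by (rule borel_measurable_AE)
qed

section \<open>Boundedness of the potential\<close>

lemma measure_cube: "l > 0 \<Longrightarrow> measure lebesgue (cube (a :: real ^ 'n::finite) l) = l ^ CARD('n)"
  using emeasure_lborel_cube[of l a] by (simp add: measure_def)

lemma cube_volume_powr:
  assumes "l > 0"
  shows "measure lebesgue (cube (a :: real ^ 'n::finite) l) powr (\<alpha> / real CARD('n) - m) = l powr (- (m * real CARD('n) - \<alpha>))"
proof -
  have "measure lebesgue (cube a l) = l powr real CARD('n)"
    unfolding measure_cube[OF assms] using assms by (simp add: powr_realpow)
  then show ?thesis by (simp only:) (simp add: powr_powr algebra_simps)
qed

text \<open>Here \<open>r\<close> is the potential of the absolute values, possibly infinite. The
  bound holds whether or not the integral converges, since a divergent \<open>riesz\<close> has the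
  value 0.\<close>

lemma riesz_bound_of_potential:
  assumes f: "\<And>i. f i \<in> borel_measurable lebesgue" and r: "r = (\<integral>\<^sup>+y. ennreal \<bar>riesz_integrand \<alpha> f x y\<bar> \<partial>lebesgue)"
  shows "integrable lebesgue (riesz_integrand \<alpha> f x) \<longleftrightarrow> r < \<infinity>" "ennreal \<bar>riesz \<alpha> f x\<bar> \<le> r"
proof -
  have m: "riesz_integrand \<alpha> f x \<in> borel_measurable lebesgue"
    unfolding riesz_integrand_eq[THEN ext] by (rule pot_integrand_lebesgue_measurable) (rule f)
  show 1: "integrable lebesgue (riesz_integrand \<alpha> f x) \<longleftrightarrow> r < \<infinity>"
    unfolding integrable_iff_bounded r using m by simp
  show "ennreal \<bar>riesz \<alpha> f x\<bar> \<le> r"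
  proof (cases "integrable lebesgue (riesz_integrand \<alpha> f x)")
    case True
    then have "r = ennreal (LINT y|lebesgue. \<bar>riesz_integrand \<alpha> f x y\<bar>)"
      unfolding r by (intro nn_integral_eq_integral) auto
    moreover have "\<bar>riesz \<alpha> f x\<bar> \<le> (LINT y|lebesgue. \<bar>riesz_integrand \<alpha> f x y\<bar>)"
      unfolding riesz_def using integral_norm_bound[of lebesgue "riesz_integrand \<alpha> f x"] by simp
    ultimately show ?thesis by (simp add: ennreal_leI)
  next
    case False
    then show ?thesis unfolding riesz_def by (simp add: not_integrable_integral_eq)
  qed
qed

text \<open>Everything below \<open>v * \<rho> powr q\<close> is below
  \<open>v * \<eta> powr q\<close> for some \<open>\<eta> < \<rho>\<close>, and \<open>G N\<close>
  eventually exceeds \<open>\<eta>\<close>. The bound is stated for real \<open>\<rho>\<close> below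
  the lower limit, so that arbitrarily large \<open>\<rho>\<close> may be inserted where that limit
  is infinite.\<close>

lemma powr_bound_liminf:
  fixes G :: "nat \<Rightarrow> real"
  assumes v: "v > 0" and q: "q > 0" and \<rho>: "\<rho> \<ge> 0" "ennreal \<rho> \<le> liminf (\<lambda>N. ennreal (G N))"
  shows "ennreal (v * \<rho> powr q) \<le> liminf (\<lambda>N. ennreal (v * G N powr q))"
  unfolding le_Liminf_iff
proof (intro allI impI)
  fix z assume z: "z < ennreal (v * \<rho> powr q)"
  then obtain y where y: "z = ennreal y" "y \<ge> 0" by (cases z) auto
  then have yv: "y < v * \<rho> powr q" using z by (simp add: ennreal_less_iff)
  define \<eta> where "\<eta> = (y / v) powr (1 / q)"
  have \<eta>: "\<eta> \<ge> 0" "v * \<eta> powr q = y" using y v q by (simp_all add: \<eta>_def powr_powr)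
  have "\<eta> < \<rho>"
  proof (rule ccontr)
    assume "\<not> \<eta> < \<rho>"
    then have "\<rho> powr q \<le> \<eta> powr q" using \<rho> q by (intro powr_mono2) auto
    then have "v * \<rho> powr q \<le> v * \<eta> powr q" using v by simp
    then show False using yv \<eta> by simp
  qed
  then have "ennreal \<eta> < ennreal \<rho>" using \<eta> by (simp add: ennreal_less_iff)
  then have "\<forall>\<^sub>F N in sequentially. ennreal \<eta> < ennreal (G N)"
    using \<rho>(2) unfolding le_Liminf_iff by blast
  then show "\<forall>\<^sub>F N in sequentially. z < ennreal (v * G N powr q)"
  proof eventually_elim
    case (elim N)
    then have "\<eta> < G N" using \<eta> by (simp add: ennreal_less_iff)
    then have "\<eta> powr q < G N powr q" using \<eta> q by (intro powr_less_mono2) auto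
    then have "v * \<eta> powr q < v * G N powr q" using v by simp
    then show ?case using y \<eta> by (simp add: ennreal_less_iff)
  qed
qed

text \<open>Two applications of Fatou's lemma are stacked: one in \<open>y\<close> bounds the
  absolute potential by the lower limit of the grid sums, and one in \<open>x\<close> carries their
  uniform bound in \<open>q\<close>-th power to \<open>\<Lambda>\<close>. Since
  \<open>\<Lambda>\<close> is integrable, it controls both the norm and the convergence.\<close>

theorem potential_bounded:
  fixes p :: "'m::finite \<Rightarrow> real" and \<alpha> :: "'k::finite \<Rightarrow> real"
    and u :: "real ^ 'n::finite ^ 'k \<Rightarrow> real" and w :: "'m \<Rightarrow> real ^ 'n ^ 'k \<Rightarrow> real"
  assumes p: "\<And>i. 1 < p i" and p0: "1 / p0 = (\<Sum>i\<in>UNIV. 1 / p i)" and q: "p0 < q"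
    and \<alpha>: "\<And>s. \<alpha> s < real CARD('m) * real CARD('n)"
    and u_pos: "ae_positive u" and w_pos: "\<And>i. ae_positive (w i)"
    and u_weight: "weight (\<lambda>x. u x powr q)" and w_weight: "\<And>i. weight (\<lambda>x. w i x powr p i)"
    and \<sigma>_weight: "\<And>i. weight (\<lambda>x. w i x powr (- conj_exp (p i)))"
    and d: "d > 1" "rect_rd d (\<lambda>x. u x powr q)" "\<And>i. rect_rd d (\<lambda>x. w i x powr (- conj_exp (p i)))"
    and sup: "(SUP Q\<in>{Q :: 'k \<Rightarrow> (real ^ 'n) set. \<forall>s. Q s \<in> cubes}.
        ennreal (\<Prod>s\<in>UNIV. measure lebesgue (Q s) powr (\<alpha> s / real CARD('n) - real CARD('m))) *
        epow (\<integral>\<^sup>+ x\<in>block_prod Q. ennreal (u x powr q) \<partial>lebesgue) (1 / q) *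
        (\<Prod>i\<in>UNIV. epow (\<integral>\<^sup>+ y\<in>block_prod Q. ennreal (w i y powr (- conj_exp (p i))) \<partial>lebesgue)
                          (1 / conj_exp (p i)))) < \<infinity>" (is "(SUP Q\<in>_. ?T Q) < \<infinity>")
  shows "\<exists>c>0. \<forall>f. (\<forall>i. f i \<in> wLp (p i) (\<lambda>x. w i x powr p i)) \<longrightarrow>
        riesz_converges_ae \<alpha> f \<and>
        lnorm q (\<lambda>x. u x * riesz \<alpha> f x) \<le> ennreal c * (\<Prod>i\<in>UNIV. lnorm (p i) (\<lambda>x. w i x * f i x))"
proof -
  have p0pos: "p0 > 0" by (rule Holder_exponent_pos[OF p p0])
  have q0: "q > 0" using p0pos q by simp
  have ppos: "p i > 0" for i using p[of i] by simp
  define \<beta> where "\<beta> s = real CARD('m) * real CARD('n) - \<alpha> s" for s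
  have \<beta>: "\<beta> s > 0" for s using \<alpha>[of s] by (simp add: \<beta>_def)
  define v where "v x = u x powr q" for x
  define \<sigma> where "\<sigma> i x = w i x powr (- conj_exp (p i))" for i x
  have v: "weight v" "rect_rd d v" "\<And>x. v x \<ge> 0" using u_weight d by (simp_all add: v_def[abs_def])
  have \<sigma>: "\<And>i. weight (\<sigma> i)" "\<And>i. rect_rd d (\<sigma> i)" "\<And>i x. \<sigma> i x \<ge> 0"
    using \<sigma>_weight d by (simp_all add: \<sigma>_def[abs_def])
  define cc where "cc = (\<lambda>l :: 'k \<Rightarrow> real. \<Prod>s\<in>UNIV. l s powr (- \<beta> s))"
  have cc: "cc l \<ge> 0" for l by (simp add: cc_def prod_nonneg)
  define A where "A = enn2real (SUP Q\<in>{Q :: 'k \<Rightarrow> (real ^ 'n) set. \<forall>s. Q s \<in> cubes}. ?T Q)"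
  have A0: "A \<ge> 0" by (simp add: A_def)
  have A: "cc l * enn2real (\<integral>\<^sup>+x\<in>block_prod (\<lambda>s. cube (a s) (l s)). ennreal (v x) \<partial>lebesgue) powr (1 / q) *
         (\<Prod>i\<in>UNIV. enn2real (\<integral>\<^sup>+x\<in>block_prod (\<lambda>s. cube (a s) (l s)). ennreal (\<sigma> i x) \<partial>lebesgue) powr (1 - 1 / p i)) \<le> A"
    if l: "\<And>s. l s > 0" for a l
  proof -
    let ?Q = "\<lambda>s. cube (a s) (l s)"
    have cQ: "compact (block_prod ?Q)" by (intro compact_block_prod compact_cube)
    have ep: "epow z b = ennreal (enn2real z powr b)" if "z < \<infinity>" for z b
      using that by (simp add: epow_def)
    have "?Q \<in> {Q. \<forall>s. Q s \<in> cubes}" using l by (auto simp: cubes_def)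
    then have "?T ?Q \<le> (SUP Q\<in>{Q :: 'k \<Rightarrow> (real ^ 'n) set. \<forall>s. Q s \<in> cubes}. ?T Q)" by (rule SUP_upper)
    also have "\<dots> = ennreal A" using sup by (simp add: A_def less_top)
    also have "(\<Prod>s\<in>UNIV. measure lebesgue (?Q s) powr (\<alpha> s / real CARD('n) - real CARD('m))) = cc l"
      unfolding cc_def \<beta>_def by (intro prod.cong refl cube_volume_powr l)
    also have "epow (\<integral>\<^sup>+ x\<in>block_prod ?Q. ennreal (u x powr q) \<partial>lebesgue) (1 / q)
      = ennreal (enn2real (\<integral>\<^sup>+x\<in>block_prod ?Q. ennreal (v x) \<partial>lebesgue) powr (1 / q))"
      unfolding v_def[symmetric] by (intro ep weight_finite[OF v(1) cQ])
    also have "(\<Prod>i\<in>UNIV. epow (\<integral>\<^sup>+ y\<in>block_prod ?Q. ennreal (w i y powr (- conj_exp (p i))) \<partial>lebesgue) (1 / conj_exp (p i)))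
      = (\<Prod>i\<in>UNIV. ennreal (enn2real (\<integral>\<^sup>+x\<in>block_prod ?Q. ennreal (\<sigma> i x) \<partial>lebesgue) powr (1 - 1 / p i)))"
      unfolding \<sigma>_def[symmetric] conj_exp_facts(1)[OF p] by (intro prod.cong refl ep weight_finite[OF \<sigma>(1) cQ])
    finally have "ennreal (cc l * enn2real (\<integral>\<^sup>+x\<in>block_prod ?Q. ennreal (v x) \<partial>lebesgue) powr (1 / q) *
         (\<Prod>i\<in>UNIV. enn2real (\<integral>\<^sup>+x\<in>block_prod ?Q. ennreal (\<sigma> i x) \<partial>lebesgue) powr (1 - 1 / p i))) \<le> ennreal A"
      using cc by (simp add: prod_ennreal prod_nonneg ennreal_mult)
    then show ?thesis using A0 by (simp add: ennreal_le_iff)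
  qed
  obtain K where K: "K \<ge> 0" and est:
    "\<And>(v :: real ^ 'n ^ 'k \<Rightarrow> real) \<sigma> N f cc A M h L \<omega>.
      weight v \<Longrightarrow> rect_rd d v \<Longrightarrow> (\<And>x. v x \<ge> 0) \<Longrightarrow>
      (\<And>i. weight (\<sigma> i)) \<Longrightarrow> (\<And>i. rect_rd d (\<sigma> i)) \<Longrightarrow> (\<And>i x. \<sigma> i x \<ge> 0) \<Longrightarrow>
      (\<And>i. N i \<in> borel_measurable lebesgue) \<Longrightarrow> (\<And>i x. N i x \<ge> 0) \<Longrightarrow>
      (\<And>i. M i \<ge> 0) \<Longrightarrow> (\<And>i. (\<integral>\<^sup>+x. ennreal (N i x) \<partial>lebesgue) \<le> ennreal (M i)) \<Longrightarrow>
      (\<And>i. AE x in lebesgue. f i x \<le> N i x powr (1 / p i) * \<sigma> i x powr (1 - 1 / p i)) \<Longrightarrow>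
      (\<And>l. cc l \<ge> 0) \<Longrightarrow> A \<ge> 0 \<Longrightarrow>
      (\<And>a l. (\<And>s. l s > 0) \<Longrightarrow> cc l * enn2real (\<integral>\<^sup>+x\<in>block_prod (\<lambda>s. cube (a s) (l s)). ennreal (v x) \<partial>lebesgue) powr (1 / q) *
         (\<Prod>i\<in>UNIV. enn2real (\<integral>\<^sup>+x\<in>block_prod (\<lambda>s. cube (a s) (l s)). ennreal (\<sigma> i x) \<partial>lebesgue) powr (1 - 1 / p i)) \<le> A) \<Longrightarrow>
      h > 0 \<Longrightarrow>
      (\<integral>\<^sup>+x. ennreal (v x * grid_sum h L \<omega> cc f x powr q) \<partial>lebesgue) \<le> ennreal (K * A powr q * (\<Prod>i\<in>UNIV. M i powr (q / p i)))"
    by (rule grid_sum_estimate[OF p p0 q d(1)]) blast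
  define C0 where "C0 = (\<Prod>s\<in>UNIV. 12 powr \<beta> s)"
  have C0: "C0 \<ge> 0" by (simp add: C0_def prod_nonneg)
  define E where "E = real (card (UNIV :: ('k \<Rightarrow> 'n \<Rightarrow> bool) set))"
  \<comment> \<open>\<open>C0\<close> is the loss in the kernel comparison, \<open>E powr q\<close>
    the loss in the power of a sum over the grids, the single \<open>E\<close> counts the grids, and
    \<open>K * A powr q\<close> bounds each of them.\<close>
  define K1 where "K1 = C0 powr q * (E powr q * (E * (K * A powr q)))"
  have K1: "K1 \<ge> 0" using K by (simp add: K1_def E_def)
  \<comment> \<open>The summand 1 keeps the constant positive even if \<open>K1\<close> is
    0.\<close>
  have main: "riesz_converges_ae \<alpha> f \<and>
        lnorm q (\<lambda>x. u x * riesz \<alpha> f x) \<le> ennreal (K1 powr (1 / q) + 1) * (\<Prod>i\<in>UNIV. lnorm (p i) (\<lambda>x. w i x * f i x))"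
    if f: "\<forall>i. f i \<in> wLp (p i) (\<lambda>x. w i x powr p i)" for f
  proof -
    have fm[measurable]: "f i \<in> borel_measurable lebesgue" for i using f by (simp add: wLp_def)
    have wm[measurable]: "(\<lambda>x. w i x powr p i) \<in> borel_measurable lebesgue" for i using w_weight[of i] by (simp add: weight_def)
    have vm[measurable]: "v \<in> borel_measurable lebesgue" using v(1) by (simp add: weight_def)
    have \<sigma>m[measurable]: "\<sigma> i \<in> borel_measurable lebesgue" for i using \<sigma>(1)[of i] by (simp add: weight_def)
    define N where "N i x = \<bar>f i x\<bar> powr p i * w i x powr p i" for i x
    have Nm[measurable]: "N i \<in> borel_measurable lebesgue" for i unfolding N_def[abs_def] by measurable
    have N0: "N i x \<ge> 0" for i x by (simp add: N_def)
    define M where "M i = enn2real (\<integral>\<^sup>+x. ennreal (N i x) \<partial>lebesgue)" for i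
    have "(\<integral>\<^sup>+x. ennreal (N i x) \<partial>lebesgue) \<noteq> \<infinity>" for i
      using f[rule_format, of i] unfolding wLp_def wnorm_def N_def by (auto simp: epow_def)
    then have M: "(\<integral>\<^sup>+x. ennreal (N i x) \<partial>lebesgue) = ennreal (M i)" for i by (simp add: M_def less_top)
    have M0: "M i \<ge> 0" for i by (simp add: M_def)
    \<comment> \<open>With \<open>N i\<close> the \<open>p i\<close>-th power of the weighted
      function, the power of the dual weight is exactly the inverse of \<open>w i\<close>; this
      factorisation feeds Hoelder's inequality on cells.\<close>
    have fN: "AE x in lebesgue. \<bar>f i x\<bar> = N i x powr (1 / p i) * \<sigma> i x powr (1 - 1 / p i)" for i
      using w_pos[of i, unfolded ae_positive_def]
    proof eventually_elim
      case (elim x)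
      have "N i x powr (1 / p i) = \<bar>f i x\<bar> * w i x"
        using elim ppos[of i] by (simp add: N_def powr_mult powr_powr)
      moreover have "\<sigma> i x powr (1 - 1 / p i) = w i x powr (- 1)"
        unfolding \<sigma>_def powr_powr using conj_exp_facts(3)[OF p, of i] by simp
      ultimately show ?case using elim by (simp add: powr_minus_divide)
    qed
    have "\<forall>i. \<exists>g. g \<in> borel_measurable borel \<and> (\<forall>x. g x \<ge> 0) \<and> (AE x in lborel. \<bar>f i x\<bar> = g x)"
    proof
      fix i
      have "(\<lambda>x. \<bar>f i x\<bar>) \<in> borel_measurable lebesgue" by measurable
      then show "\<exists>g. g \<in> borel_measurable borel \<and> (\<forall>x. g x \<ge> 0) \<and> (AE x in lborel. \<bar>f i x\<bar> = g x)"
        by (rule borel_representative) auto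
    qed
    from choice[OF this] obtain g where g: "\<And>i. g i \<in> borel_measurable borel" "\<And>i x. g i x \<ge> 0"
      and fg: "\<And>i. AE x in lborel. \<bar>f i x\<bar> = g i x" by blast
    have gN: "AE x in lebesgue. g i x \<le> N i x powr (1 / p i) * \<sigma> i x powr (1 - 1 / p i)" for i
      using fN[of i] fg[of i, folded AE_lebesgue_iff] by eventually_elim simp
    \<comment> \<open>Local integrability is not part of the hypotheses on \<open>f\<close>. It
      follows from the factorisation, because the dual weight is locally integrable.\<close>
    have gfin: "(\<integral>\<^sup>+x\<in>Z. ennreal (g i x) \<partial>lebesgue) < \<infinity>" if Z: "compact Z" for i Z
    proof -
      have [measurable]: "Z \<in> sets lebesgue" using Z by (intro lmeasurable_compact fmeasurableD)
      let ?I = "indicator Z :: _ \<Rightarrow> real"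
      define S where "S = enn2real (\<integral>\<^sup>+x\<in>Z. ennreal (\<sigma> i x) \<partial>lebesgue)"
      have "(\<integral>\<^sup>+x\<in>Z. ennreal (g i x) \<partial>lebesgue) \<le> (\<integral>\<^sup>+x. ennreal (N i x powr (1 / p i) * (\<sigma> i x * ?I x) powr (1 - 1 / p i)) \<partial>lebesgue)"
      proof (rule nn_integral_mono_AE)
        show "AE x in lebesgue. ennreal (g i x) * indicator Z x \<le> ennreal (N i x powr (1 / p i) * (\<sigma> i x * ?I x) powr (1 - 1 / p i))"
          using gN[of i] by eventually_elim (auto simp: indicator_def intro: ennreal_leI)
      qed
      also have "\<dots> \<le> ennreal (M i powr (1 / p i) * S powr (1 - 1 / p i))"
      proof (rule nn_integral_Holder)
        have "(\<integral>\<^sup>+x. ennreal (\<sigma> i x * ?I x) \<partial>lebesgue) = (\<integral>\<^sup>+x\<in>Z. ennreal (\<sigma> i x) \<partial>lebesgue)"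
          by (intro nn_integral_cong) (simp add: indicator_def)
        then show "(\<integral>\<^sup>+x. ennreal (\<sigma> i x * ?I x) \<partial>lebesgue) \<le> ennreal S"
          using weight_finite[OF \<sigma>(1) Z, of i] by (simp add: S_def less_top)
      qed (use p[of i] N0 M M0 \<sigma>(3) in \<open>auto simp: S_def\<close>)
      also have "\<dots> < \<infinity>" by simp
      finally show ?thesis .
    qed
    define G where "G n x = C0 * (\<Sum>e\<in>UNIV. grid_sum ((1/2) ^ n) (2 * n) (grid_origin (2 ^ n) e) cc g x)" for n x
    have Gm[measurable]: "G n \<in> borel_measurable lebesgue" for n
      unfolding G_def[abs_def] by (intro borel_measurable_times borel_measurable_const borel_measurable_sum measurable_completion)
        (simp add: grid_sum_measurable)
    define P where "P = (\<Prod>i\<in>UNIV. M i powr (q / p i))"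
    have P0: "P \<ge> 0" by (simp add: P_def prod_nonneg)
    have GB: "(\<integral>\<^sup>+x. ennreal (v x * G n x powr q) \<partial>lebesgue) \<le> ennreal (K1 * P)" for n
    proof -
      let ?F = "\<lambda>e x. grid_sum ((1/2) ^ n) (2 * n) (grid_origin (2 ^ n) e) cc g x"
      have Fm[measurable]: "?F e \<in> borel_measurable lebesgue" for e
        by (rule measurable_completion) (simp add: grid_sum_measurable)
      have "(\<integral>\<^sup>+x. ennreal (v x * G n x powr q) \<partial>lebesgue)
        \<le> (\<integral>\<^sup>+x. (\<Sum>e\<in>UNIV. ennreal (C0 powr q * E powr q) * ennreal (v x * ?F e x powr q)) \<partial>lebesgue)"
      proof (rule nn_integral_mono)
        fix x
        have "G n x powr q \<le> C0 powr q * (E powr q * (\<Sum>e\<in>UNIV. ?F e x powr q))"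
          unfolding G_def powr_mult E_def
          by (intro mult_left_mono sum_powr_le_card grid_sum_nonneg cc q0) auto
        then have "v x * G n x powr q \<le> v x * (C0 powr q * (E powr q * (\<Sum>e\<in>UNIV. ?F e x powr q)))"
          using v(3) by (intro mult_left_mono) auto
        also have "\<dots> = (\<Sum>e\<in>UNIV. (C0 powr q * E powr q) * (v x * ?F e x powr q))"
          by (simp add: sum_distrib_left mult_ac)
        finally have "ennreal (v x * G n x powr q) \<le> ennreal (\<Sum>e\<in>UNIV. (C0 powr q * E powr q) * (v x * ?F e x powr q))"
          by (rule ennreal_leI)
        also have "\<dots> = (\<Sum>e\<in>UNIV. ennreal ((C0 powr q * E powr q) * (v x * ?F e x powr q)))"
          using v(3) by (intro sum_ennreal[symmetric] mult_nonneg_nonneg) auto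
        also have "\<dots> = (\<Sum>e\<in>UNIV. ennreal (C0 powr q * E powr q) * ennreal (v x * ?F e x powr q))"
          by (intro sum.cong refl ennreal_mult') simp
        finally show "ennreal (v x * G n x powr q)
           \<le> (\<Sum>e\<in>UNIV. ennreal (C0 powr q * E powr q) * ennreal (v x * ?F e x powr q))" .
      qed
      also have "\<dots> = (\<Sum>e\<in>UNIV. ennreal (C0 powr q * E powr q) * (\<integral>\<^sup>+x. ennreal (v x * ?F e x powr q) \<partial>lebesgue))"
        by (subst nn_integral_sum) (auto intro!: sum.cong nn_integral_cmult)
      also have "\<dots> \<le> (\<Sum>e\<in>(UNIV :: ('k \<Rightarrow> 'n \<Rightarrow> bool) set). ennreal (C0 powr q * E powr q) * ennreal (K * A powr q * P))"
      proof (intro sum_mono mult_left_mono)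
        fix e
        show "(\<integral>\<^sup>+x. ennreal (v x * ?F e x powr q) \<partial>lebesgue) \<le> ennreal (K * A powr q * P)"
          unfolding P_def
        proof (rule est[where N=N and \<sigma>=\<sigma>])
          show "cc l * enn2real (\<integral>\<^sup>+x\<in>block_prod (\<lambda>s. cube (a s) (l s)). ennreal (v x) \<partial>lebesgue) powr (1 / q) *
             (\<Prod>i\<in>UNIV. enn2real (\<integral>\<^sup>+x\<in>block_prod (\<lambda>s. cube (a s) (l s)). ennreal (\<sigma> i x) \<partial>lebesgue) powr (1 - 1 / p i)) \<le> A"
            if "\<And>s. l s > 0" for a l by (rule A[OF that])
        qed (simp_all add: v \<sigma> N0 M M0 gN cc A0)
      qed simp
      also have "\<dots> = ennreal (K1 * P)"
        using K P0 by (simp add: K1_def E_def ennreal_mult'[symmetric] ennreal_of_nat_eq_real_of_nat mult_ac)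
      finally show ?thesis .
    qed
    define \<Lambda> where "\<Lambda> x = liminf (\<lambda>n. ennreal (v x * G n x powr q))" for x
    have \<Lambda>m[measurable]: "\<Lambda> \<in> borel_measurable lebesgue" unfolding \<Lambda>_def[abs_def] by measurable
    have \<Lambda>B: "(\<integral>\<^sup>+x. \<Lambda> x \<partial>lebesgue) \<le> ennreal (K1 * P)"
    proof -
      have "(\<integral>\<^sup>+x. \<Lambda> x \<partial>lebesgue) \<le> liminf (\<lambda>n. \<integral>\<^sup>+x. ennreal (v x * G n x powr q) \<partial>lebesgue)"
        unfolding \<Lambda>_def by (rule nn_integral_liminf) measurable
      also have "\<dots> \<le> limsup (\<lambda>n. \<integral>\<^sup>+x. ennreal (v x * G n x powr q) \<partial>lebesgue)"
        by (rule Liminf_le_Limsup) simp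
      also have "\<dots> \<le> ennreal (K1 * P)" by (rule Limsup_bounded) (simp add: GB)
      finally show ?thesis .
    qed
    have "(\<integral>\<^sup>+x. \<Lambda> x \<partial>lebesgue) \<noteq> \<infinity>" using \<Lambda>B by (auto simp: top_unique)
    then have \<Lambda>fin: "AE x in lebesgue. \<Lambda> x \<noteq> \<infinity>" by (intro nn_integral_PInf_AE) auto
    define J where "J x = (\<integral>\<^sup>+y. ennreal \<bar>riesz_integrand \<alpha> f x y\<bar> \<partial>lebesgue)" for x
    have JG: "J x \<le> liminf (\<lambda>n. ennreal (G n x))" for x
    proof -
      have "J x = (\<integral>\<^sup>+y. ennreal (pot_integrand \<beta> g x y) \<partial>lebesgue)"
        unfolding J_def riesz_integrand_eq abs_pot_integrand \<beta>_def[symmetric]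
        by (intro nn_integral_cong_AE)
          (use pot_integrand_AE_eq[where f="\<lambda>i t. \<bar>f i t\<bar>" and g=g and \<beta>=\<beta> and x=x, OF fg] in \<open>auto simp: AE_lebesgue_iff\<close>)
      also have "\<dots> = (\<integral>\<^sup>+y. ennreal (pot_integrand \<beta> g x y) \<partial>lborel)" by (rule nn_integral_completion)
      also have "\<dots> \<le> liminf (\<lambda>n. ennreal (G n x))"
        unfolding G_def C0_def cc_def by (rule potential_le_liminf[OF g gfin \<beta>])
      finally show ?thesis .
    qed
    have \<Lambda>J: "ennreal (v x * \<rho> powr q) \<le> \<Lambda> x" if "v x > 0" "\<rho> \<ge> 0" "ennreal \<rho> \<le> J x" for x \<rho>
      unfolding \<Lambda>_def by (rule powr_bound_liminf[OF that(1) q0 that(2) order.trans[OF that(3) JG]])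
    have vpos: "AE x in lebesgue. v x > 0" using v(1) by (simp add: weight_def ae_positive_def)
    have Jfin: "AE x in lebesgue. J x < \<infinity>"
      using vpos \<Lambda>fin
    proof eventually_elim
      case (elim x)
      show ?case
      proof (rule ccontr)
        assume "\<not> ?thesis"
        then have top: "J x = \<infinity>" by (simp add: not_less top_unique)
        obtain z where z: "\<Lambda> x = ennreal z" "z \<ge> 0" using elim by (cases "\<Lambda> x") auto
        \<comment> \<open>If \<open>J x\<close> is infinite every real \<open>\<rho>\<close> is
          admissible; this one makes \<open>v x * \<rho> powr q\<close> exceed the finite value
          \<open>\<Lambda> x\<close> by 1.\<close>
        define \<rho> where "\<rho> = ((z + 1) / v x) powr (1 / q)"
        have "v x * \<rho> powr q = z + 1" using z elim q0 by (simp add: \<rho>_def powr_powr)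
        moreover have "ennreal (v x * \<rho> powr q) \<le> \<Lambda> x" by (rule \<Lambda>J) (use elim top in \<open>auto simp: \<rho>_def\<close>)
        ultimately show False using z by (simp add: ennreal_le_iff del: ennreal_plus)
      qed
    qed
    have conv: "riesz_converges_ae \<alpha> f"
      unfolding riesz_converges_ae_def using Jfin
      by eventually_elim (simp add: riesz_bound_of_potential(1)[OF fm J_def])
    have "(\<integral>\<^sup>+x. ennreal (\<bar>u x * riesz \<alpha> f x\<bar> powr q * 1) \<partial>lebesgue) \<le> (\<integral>\<^sup>+x. \<Lambda> x \<partial>lebesgue)"
    proof (rule nn_integral_mono_AE)
      show "AE x in lebesgue. ennreal (\<bar>u x * riesz \<alpha> f x\<bar> powr q * 1) \<le> \<Lambda> x"
        using vpos u_pos[unfolded ae_positive_def]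
      proof eventually_elim
        case (elim x)
        have "\<bar>u x * riesz \<alpha> f x\<bar> powr q * 1 = v x * \<bar>riesz \<alpha> f x\<bar> powr q"
          using elim by (simp add: abs_mult powr_mult v_def)
        then show ?case using \<Lambda>J[OF elim(1) abs_ge_zero riesz_bound_of_potential(2)[OF fm J_def]] by simp
      qed
    qed
    then have "lnorm q (\<lambda>x. u x * riesz \<alpha> f x) \<le> epow (ennreal (K1 * P)) (1 / q)"
      unfolding wnorm_def using \<Lambda>B q0 by (intro epow_mono) (auto intro: order.trans)
    also have "\<dots> = ennreal (K1 powr (1 / q) * (\<Prod>i\<in>UNIV. M i powr (1 / p i)))"
    proof -
      have "P powr (1 / q) = (\<Prod>i\<in>UNIV. M i powr (1 / p i))"
        unfolding P_def prod_powr_distrib powr_powr using q0 by simp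
      then show ?thesis using K1 P0 by (simp add: epow_ennreal powr_mult)
    qed
    also have "\<dots> \<le> ennreal ((K1 powr (1 / q) + 1) * (\<Prod>i\<in>UNIV. M i powr (1 / p i)))"
      by (intro ennreal_leI mult_right_mono prod_nonneg) auto
    also have "\<dots> = ennreal (K1 powr (1 / q) + 1) * (\<Prod>i\<in>UNIV. ennreal (M i powr (1 / p i)))"
      by (simp add: ennreal_mult prod_nonneg prod_ennreal del: ennreal_plus)
    also have "(\<Prod>i\<in>UNIV. ennreal (M i powr (1 / p i))) = (\<Prod>i\<in>UNIV. lnorm (p i) (\<lambda>x. w i x * f i x))"
    proof (intro prod.cong refl)
      fix i
      have "(\<integral>\<^sup>+x. ennreal (\<bar>w i x * f i x\<bar> powr p i * 1) \<partial>lebesgue) = (\<integral>\<^sup>+x. ennreal (N i x) \<partial>lebesgue)"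
      proof (rule nn_integral_cong_AE)
        show "AE x in lebesgue. ennreal (\<bar>w i x * f i x\<bar> powr p i * 1) = ennreal (N i x)"
          using w_pos[of i, unfolded ae_positive_def] by eventually_elim (simp add: N_def abs_mult powr_mult mult.commute)
      qed
      then show "ennreal (M i powr (1 / p i)) = lnorm (p i) (\<lambda>x. w i x * f i x)"
        unfolding wnorm_def by (simp add: M M0 epow_ennreal)
    qed
    finally show ?thesis using conv by blast
  qed
  have "K1 powr (1 / q) + 1 > 0" by (simp add: add_nonneg_pos)
  with main show ?thesis by blast
qed

section \<open>Necessity of the condition\<close>

lemma nn_integral_lebesgue_vec_prod:
  fixes f :: "'m::finite \<Rightarrow> 'a::euclidean_space \<Rightarrow> real"
  assumes fm: "\<And>i. f i \<in> borel_measurable lebesgue" and f0: "\<And>i t. f i t \<ge> 0"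
  shows "(\<integral>\<^sup>+y. ennreal (\<Prod>i\<in>UNIV. f i (y $ i)) \<partial>lebesgue) = (\<Prod>i\<in>UNIV. \<integral>\<^sup>+t. ennreal (f i t) \<partial>lebesgue)"
proof -
  have "\<exists>g. g \<in> borel_measurable borel \<and> (\<forall>x. g x \<ge> 0) \<and> (AE x in lborel. f i x = g x)" for i
    by (rule borel_representative[OF fm[of i]]) (auto simp: f0)
  then have "\<forall>i. \<exists>g. g \<in> borel_measurable borel \<and> (\<forall>x. g x \<ge> 0) \<and> (AE x in lborel. f i x = g x)" ..
  from choice[OF this] obtain g where g[measurable]: "\<And>i. g i \<in> borel_measurable borel" and g0: "\<And>i x. g i x \<ge> 0"
    and fg: "\<And>i. AE x in lborel. f i x = g i x" by blast
  have "AE y in (lborel :: ('a ^ 'm) measure). \<forall>i\<in>UNIV. f i (y $ i) = g i (y $ i)"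
    by (subst AE_finite_all) (simp_all add: AE_lborel_vec_nth[OF fg])
  then have ae: "AE y in lborel. ennreal (\<Prod>i\<in>UNIV. f i (y $ i)) = (\<Prod>i\<in>UNIV. ennreal (g i (y $ i)))"
    by eventually_elim (simp add: prod_ennreal g0)
  have "(\<integral>\<^sup>+y. ennreal (\<Prod>i\<in>UNIV. f i (y $ i)) \<partial>lebesgue) = (\<integral>\<^sup>+y. (\<Prod>i\<in>UNIV. ennreal (g i (y $ i))) \<partial>lebesgue)"
    by (intro nn_integral_cong_AE) (use ae in \<open>simp add: AE_lebesgue_iff\<close>)
  also have "\<dots> = (\<integral>\<^sup>+y. (\<Prod>i\<in>UNIV. ennreal (g i (y $ i))) \<partial>lborel)" by (rule nn_integral_completion)
  also have "\<dots> = (\<Prod>i\<in>UNIV. \<integral>\<^sup>+t. ennreal (g i t) \<partial>lborel)" by (rule nn_integral_lborel_vec_prod) simp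
  also have "\<dots> = (\<Prod>i\<in>UNIV. \<integral>\<^sup>+t. ennreal (f i t) \<partial>lebesgue)"
  proof (intro prod.cong refl)
    fix i
    have "(\<integral>\<^sup>+t. ennreal (f i t) \<partial>lebesgue) = (\<integral>\<^sup>+t. ennreal (g i t) \<partial>lebesgue)"
      by (intro nn_integral_cong_AE) (use fg[of i] in \<open>auto simp: AE_lebesgue_iff\<close>)
    then show "(\<integral>\<^sup>+t. ennreal (g i t) \<partial>lborel) = (\<integral>\<^sup>+t. ennreal (f i t) \<partial>lebesgue)"
      by (simp only: nn_integral_completion)
  qed
  finally show ?thesis .
qed

lemma prod_nth_measurable:
  fixes f :: "'m::finite \<Rightarrow> real ^ 'n::finite ^ 'k::finite \<Rightarrow> real"
  assumes "\<And>i. f i \<in> borel_measurable lebesgue"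
  shows "(\<lambda>y. \<Prod>i\<in>UNIV. f i (y $ i)) \<in> borel_measurable lebesgue"
proof -
  have "\<forall>i. \<exists>g. g \<in> borel_measurable borel \<and> (AE t in lborel. f i t = g t)"
    using completion_ex_borel_measurable_real[OF assms] by auto
  from choice[OF this] obtain g where g[measurable]: "\<And>i. g i \<in> borel_measurable borel"
    and fg: "\<And>i. AE t in lborel. f i t = g i t" by blast
  have "(\<lambda>y. \<Prod>i\<in>UNIV. g i (y $ i)) \<in> borel_measurable lebesgue"
    by (rule measurable_completion) measurable
  moreover have "AE y in (lborel :: (real ^ 'n ^ 'k ^ 'm) measure). \<forall>i\<in>UNIV. f i (y $ i) = g i (y $ i)"
    by (subst AE_finite_all) (simp_all add: AE_lborel_vec_nth[OF fg])
  then have "AE y in lebesgue. (\<Prod>i\<in>UNIV. g i (y $ i)) = (\<Prod>i\<in>UNIV. f i (y $ i))"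
    unfolding AE_lebesgue_iff by eventually_elim simp
  ultimately show ?thesis by (rule borel_measurable_AE)
qed

text \<open>The lower bound for the kernel fails at the singularity, where the conventional value is
  0. That set is null, because already one of the \<open>y $ i\<close> would have to share
  coordinates with \<open>x\<close>.\<close>

lemma AE_block_dist_pos:
  fixes x :: "real ^ 'n::finite ^ 'k::finite"
  shows "AE y in (lebesgue :: (real ^ 'n ^ 'k ^ 'm::finite) measure). \<forall>s. block_dist x y s > 0"
proof -
  define i :: 'm where "i = undefined"
  have "AE y in (lebesgue :: (real ^ 'n ^ 'k ^ 'm) measure). \<forall>s c. y $ i $ s $ c \<noteq> x $ s $ c"
    by (rule AE_lebesgue_vec_nth) (rule AE_coordinates_neq)
  then show ?thesis
  proof eventually_elim
    case (elim y)
    show ?case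
    proof
      fix s
      obtain c :: 'n where True by blast
      have "0 < \<bar>y $ i $ s $ c - x $ s $ c\<bar>" using elim by simp
      also have "\<dots> \<le> block_dist x y s" by (rule abs_le_block_dist)
      finally show "block_dist x y s > 0" .
    qed
  qed
qed

text \<open>Each of the \<open>m\<close> norms is at most the sum of \<open>n\<close> coordinate
  differences, none larger than the side. The crude factor is harmless, as it enters the constant of
  the condition only.\<close>

lemma block_dist_le_cube:
  fixes y :: "real ^ 'n::finite ^ 'k::finite ^ 'm::finite"
  assumes "x $ s \<in> cube a l" "\<And>i. y $ i $ s \<in> cube a l"
  shows "block_dist x y s \<le> real CARD('m) * real CARD('n) * l"
proof -
  have "norm (x $ s - y $ i $ s) \<le> real CARD('n) * l" for i
  proof -
    have "norm (x $ s - y $ i $ s) \<le> (\<Sum>c\<in>UNIV. \<bar>(x $ s - y $ i $ s) $ c\<bar>)" by (rule norm_le_l1_cart)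
    also have "\<dots> \<le> (\<Sum>c\<in>(UNIV :: 'n set). l)"
    proof (rule sum_mono)
      fix c
      have "a $ c \<le> x $ s $ c \<and> x $ s $ c \<le> a $ c + l" "a $ c \<le> y $ i $ s $ c \<and> y $ i $ s $ c \<le> a $ c + l"
        using assms(1) assms(2)[of i] by (auto simp: cube_def mem_box_cart)
      then show "\<bar>(x $ s - y $ i $ s) $ c\<bar> \<le> l" by (simp add: abs_le_iff)
    qed
    finally show ?thesis by simp
  qed
  then have "block_dist x y s \<le> (\<Sum>i\<in>(UNIV :: 'm set). real CARD('n) * l)"
    unfolding block_dist_def by (rule sum_mono)
  then show ?thesis by (simp add: mult_ac)
qed

text \<open>Since \<open>p - p' * p = - p'\<close>, testing with the dual weight on a rectangle
  makes the \<open>p i\<close>-th power of each norm equal to its mass \<open>S i\<close>, while on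
  the rectangle the potential is at least the smallest kernel value times the product of the
  \<open>S i\<close>. Comparing powers of the \<open>S i\<close> leaves the exponents
  \<open>1 - 1 / p i\<close> of the condition.\<close>

theorem potential_bounded_imp_condition:
  fixes p :: "'m::finite \<Rightarrow> real" and \<alpha> :: "'k::finite \<Rightarrow> real"
    and u :: "real ^ 'n::finite ^ 'k \<Rightarrow> real" and w :: "'m \<Rightarrow> real ^ 'n ^ 'k \<Rightarrow> real"
  assumes p: "\<And>i. 1 < p i" and q0: "q > 0"
    and \<alpha>: "\<And>s. \<alpha> s < real CARD('m) * real CARD('n)"
    and u_pos: "ae_positive u" and w_pos: "\<And>i. ae_positive (w i)"
    and u_weight: "weight (\<lambda>x. u x powr q)"
    and \<sigma>_weight: "\<And>i. weight (\<lambda>x. w i x powr (- conj_exp (p i)))"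
    and c: "c > 0" and bounded: "\<And>f. (\<forall>i. f i \<in> wLp (p i) (\<lambda>x. w i x powr p i)) \<Longrightarrow>
        riesz_converges_ae \<alpha> f \<and>
        lnorm q (\<lambda>x. u x * riesz \<alpha> f x) \<le> ennreal c * (\<Prod>i\<in>UNIV. lnorm (p i) (\<lambda>x. w i x * f i x))"
  shows "(SUP Q\<in>{Q :: 'k \<Rightarrow> (real ^ 'n) set. \<forall>s. Q s \<in> cubes}.
        ennreal (\<Prod>s\<in>UNIV. measure lebesgue (Q s) powr (\<alpha> s / real CARD('n) - real CARD('m))) *
        epow (\<integral>\<^sup>+ x\<in>block_prod Q. ennreal (u x powr q) \<partial>lebesgue) (1 / q) *
        (\<Prod>i\<in>UNIV. epow (\<integral>\<^sup>+ y\<in>block_prod Q. ennreal (w i y powr (- conj_exp (p i))) \<partial>lebesgue)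
                          (1 / conj_exp (p i)))) < \<infinity>" (is "(SUP Q\<in>_. ?T Q) < \<infinity>")
proof -
  have ppos: "p i > 0" for i using p[of i] by simp
  define \<beta> where "\<beta> s = real CARD('m) * real CARD('n) - \<alpha> s" for s
  have \<beta>: "\<beta> s > 0" for s using \<alpha>[of s] by (simp add: \<beta>_def)
  define v where "v x = u x powr q" for x
  define \<sigma> where "\<sigma> i x = w i x powr (- conj_exp (p i))" for i x
  have v: "weight v" using u_weight by (simp add: v_def[abs_def])
  have \<sigma>: "\<And>i. weight (\<sigma> i)" using \<sigma>_weight by (simp add: \<sigma>_def[abs_def])
  have [measurable]: "v \<in> borel_measurable lebesgue" using v by (simp add: weight_def)
  have \<sigma>m[measurable]: "\<sigma> i \<in> borel_measurable lebesgue" for i using \<sigma>[of i] by (simp add: weight_def)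
  define mn where "mn = real CARD('m) * real CARD('n)"
  have mn: "mn > 0" by (simp add: mn_def)
  define B where "B = c * (\<Prod>s\<in>UNIV. mn powr \<beta> s)"
  have "?T Q \<le> ennreal B" if Q: "\<forall>s. Q s \<in> cubes" for Q
  proof -
    have "\<forall>s. \<exists>z. 0 < snd z \<and> Q s = cube (fst z) (snd z)"
    proof
      fix s
      obtain b r where "Q s = cube b r" "0 < r" using Q[rule_format, of s] by (auto simp: cubes_def)
      then show "\<exists>z. 0 < snd z \<and> Q s = cube (fst z) (snd z)" by (intro exI[of _ "(b, r)"]) simp
    qed
    from choice[OF this] obtain z where z: "\<And>s. 0 < snd (z s) \<and> Q s = cube (fst (z s)) (snd (z s))" by blast
    define a where "a s = fst (z s)" for s
    define l where "l s = snd (z s)" for s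
    have l: "l s > 0" and Ql: "Q s = cube (a s) (l s)" for s using z[of s] by (simp_all add: a_def l_def)
    define R where "R = block_prod Q"
    have Rc: "compact R" unfolding R_def Ql by (intro compact_block_prod compact_cube)
    have Rb: "R \<in> sets borel" using Rc by (simp add: borel_compact)
    have [measurable]: "R \<in> sets lebesgue" using Rb by simp
    have Rpos: "emeasure lborel R > 0"
      using emeasure_block_prod_pos[of l a] l by (simp add: R_def Ql[abs_def])
    define V where "V = enn2real (\<integral>\<^sup>+x\<in>R. ennreal (v x) \<partial>lebesgue)"
    have V: "(\<integral>\<^sup>+x\<in>R. ennreal (v x) \<partial>lebesgue) = ennreal V"
      using weight_finite[OF v Rc] by (simp add: V_def)
    have V0: "V \<ge> 0" by (simp add: V_def)
    define S where "S i = enn2real (\<integral>\<^sup>+x\<in>R. ennreal (\<sigma> i x) \<partial>lebesgue)" for i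
    have S: "(\<integral>\<^sup>+x\<in>R. ennreal (\<sigma> i x) \<partial>lebesgue) = ennreal (S i)" for i
      using weight_finite[OF \<sigma> Rc, of i] by (simp add: S_def)
    have S0: "S i > 0" for i
      using set_nn_integral_pos[of "\<sigma> i", OF _ _ Rb Rpos] \<sigma>[of i] unfolding S by (simp add: weight_def)
    define f where "f i x = \<sigma> i x * indicator R x" for i x
    have f0: "f i x \<ge> 0" for i x by (simp add: f_def \<sigma>_def)
    have fm[measurable]: "f i \<in> borel_measurable lebesgue" for i unfolding f_def[abs_def] by measurable
    have wf: "AE x in lebesgue. \<bar>f i x\<bar> powr p i * w i x powr p i = \<sigma> i x * indicator R x" for i
      using w_pos[of i, unfolded ae_positive_def]
    proof eventually_elim
      case (elim x)
      have "\<sigma> i x powr p i * w i x powr p i = w i x powr (p i - conj_exp (p i) * p i)"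
        by (simp add: \<sigma>_def powr_powr powr_add[symmetric] algebra_simps)
      also have "\<dots> = \<sigma> i x" unfolding conj_exp_facts(4)[OF p] \<sigma>_def ..
      finally show ?case using f0[of i x] ppos[of i] by (simp add: f_def indicator_def)
    qed
    have fN: "(\<integral>\<^sup>+x. ennreal (\<bar>f i x\<bar> powr p i * w i x powr p i) \<partial>lebesgue) = ennreal (S i)" for i
    proof -
      have "(\<integral>\<^sup>+x. ennreal (\<bar>f i x\<bar> powr p i * w i x powr p i) \<partial>lebesgue) = (\<integral>\<^sup>+x\<in>R. ennreal (\<sigma> i x) \<partial>lebesgue)"
      proof (rule nn_integral_cong_AE)
        show "AE x in lebesgue. ennreal (\<bar>f i x\<bar> powr p i * w i x powr p i) = ennreal (\<sigma> i x) * indicator R x"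
          using wf[of i] by eventually_elim (simp add: indicator_def)
      qed
      then show ?thesis by (simp add: S)
    qed
    have lnorm: "lnorm (p i) (\<lambda>x. w i x * f i x) = ennreal (S i powr (1 / p i))" for i
    proof -
      have "(\<integral>\<^sup>+x. ennreal (\<bar>w i x * f i x\<bar> powr p i * 1) \<partial>lebesgue) = (\<integral>\<^sup>+x. ennreal (\<bar>f i x\<bar> powr p i * w i x powr p i) \<partial>lebesgue)"
      proof (rule nn_integral_cong_AE)
        show "AE x in lebesgue. ennreal (\<bar>w i x * f i x\<bar> powr p i * 1) = ennreal (\<bar>f i x\<bar> powr p i * w i x powr p i)"
          using w_pos[of i, unfolded ae_positive_def] by eventually_elim (simp add: abs_mult powr_mult mult.commute)
      qed
      then show ?thesis using S0[of i] unfolding wnorm_def by (simp add: fN epow_ennreal)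
    qed
    have "\<forall>i. f i \<in> wLp (p i) (\<lambda>x. w i x powr p i)"
      using S0 by (simp add: wLp_def wnorm_def fN epow_ennreal less_imp_le)
    then have conv: "riesz_converges_ae \<alpha> f"
      and bd: "lnorm q (\<lambda>x. u x * riesz \<alpha> f x) \<le> ennreal c * (\<Prod>i\<in>UNIV. lnorm (p i) (\<lambda>x. w i x * f i x))"
      using bounded by blast+
    \<comment> \<open>A lower bound for the kernel when \<open>x\<close> and all
      \<open>y $ i\<close> lie in the rectangle, off the singularity; the factors
      \<open>mn powr \<beta> s\<close> are returned in \<open>B\<close>.\<close>
    define \<kappa> where "\<kappa> = (\<Prod>s\<in>UNIV. (mn * l s) powr (- \<beta> s))"
    have \<kappa>: "\<kappa> > 0" using mn l by (simp add: \<kappa>_def prod_pos less_imp_neq[THEN not_sym])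
    define P where "P = (\<Prod>i\<in>UNIV. S i)"
    have P: "P > 0" using S0 by (simp add: P_def prod_pos)
    \<comment> \<open>Integrability at \<open>x\<close> is essential: without it
      \<open>riesz\<close> would be 0 and carry no information. The assumed almost everywhere
      convergence supplies it.\<close>
    have low: "\<kappa> * P \<le> \<bar>riesz \<alpha> f x\<bar>" if x: "x \<in> R" and int: "integrable lebesgue (riesz_integrand \<alpha> f x)" for x
    proof -
      have nn: "riesz_integrand \<alpha> f x y \<ge> 0" for y
        unfolding riesz_integrand_eq pot_integrand_def using f0 by (intro mult_nonneg_nonneg prod_nonneg) auto
      have "ennreal (\<kappa> * P) = ennreal \<kappa> * (\<Prod>i\<in>UNIV. \<integral>\<^sup>+t. ennreal (f i t) \<partial>lebesgue)"
      proof -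
        have "(\<integral>\<^sup>+t. ennreal (f i t) \<partial>lebesgue) = ennreal (S i)" for i
          unfolding S[symmetric] by (intro nn_integral_cong) (simp add: f_def indicator_def)
        then show ?thesis using \<kappa> S0 P by (simp add: prod_ennreal less_imp_le ennreal_mult P_def)
      qed
      also have "\<dots> = (\<integral>\<^sup>+y. ennreal \<kappa> * ennreal (\<Prod>i\<in>UNIV. f i (y $ i)) \<partial>lebesgue)"
      proof -
        show ?thesis
          unfolding nn_integral_lebesgue_vec_prod[OF fm f0, symmetric]
          by (rule nn_integral_cmult[symmetric]) (rule measurable_compose[OF prod_nth_measurable[OF fm] measurable_ennreal])
      qed
      also have "\<dots> \<le> (\<integral>\<^sup>+y. ennreal (riesz_integrand \<alpha> f x y) \<partial>lebesgue)"
      proof (rule nn_integral_mono_AE)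
        show "AE y in lebesgue. ennreal \<kappa> * ennreal (\<Prod>i\<in>UNIV. f i (y $ i)) \<le> ennreal (riesz_integrand \<alpha> f x y)"
          using AE_block_dist_pos[of x]
        proof eventually_elim
          case (elim y)
          have "\<kappa> * (\<Prod>i\<in>UNIV. f i (y $ i)) \<le> riesz_integrand \<alpha> f x y"
          proof (cases "\<forall>i. y $ i \<in> R")
            case True
            have "\<kappa> \<le> (\<Prod>s\<in>UNIV. block_dist x y s powr (- \<beta> s))"
              unfolding \<kappa>_def
            proof (intro prod_mono conjI)
              fix s
              have "x $ s \<in> cube (a s) (l s)" "\<And>i. y $ i $ s \<in> cube (a s) (l s)"
                using x True unfolding R_def block_prod_def Ql by auto
              then have "block_dist x y s \<le> mn * l s" unfolding mn_def by (rule block_dist_le_cube)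
              then show "(mn * l s) powr (- \<beta> s) \<le> block_dist x y s powr (- \<beta> s)"
                using elim \<beta>[of s] by (intro powr_mono2') auto
            qed simp
            then have "\<kappa> * (\<Prod>i\<in>UNIV. f i (y $ i)) \<le> (\<Prod>s\<in>UNIV. block_dist x y s powr (- \<beta> s)) * (\<Prod>i\<in>UNIV. f i (y $ i))"
              using f0 by (intro mult_right_mono prod_nonneg) auto
            then show ?thesis by (simp add: riesz_integrand_eq pot_integrand_def \<beta>_def mult.commute)
          next
            case False
            then obtain i where "y $ i \<notin> R" by blast
            then have "f i (y $ i) = 0" by (simp add: f_def)
            then have "(\<Prod>i\<in>UNIV. f i (y $ i)) = 0" by (intro prod_zero bexI[of _ i]) auto
            then show ?thesis using nn[of y] by (simp only: mult_zero_right)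
          qed
          then show ?case using \<kappa> by (simp add: ennreal_mult'[symmetric] ennreal_leI)
        qed
      qed
      also have "\<dots> = ennreal (riesz \<alpha> f x)"
        unfolding riesz_def by (rule nn_integral_eq_integral[OF int]) (simp add: nn)
      also have "\<dots> \<le> ennreal \<bar>riesz \<alpha> f x\<bar>" by (simp add: ennreal_leI)
      finally show ?thesis by (simp add: ennreal_le_iff)
    qed
    have "ennreal (V * (\<kappa> * P) powr q) = (\<integral>\<^sup>+x. ennreal ((\<kappa> * P) powr q) * (ennreal (v x) * indicator R x) \<partial>lebesgue)"
      using V V0 by (simp add: nn_integral_cmult ennreal_mult mult.commute)
    also have "\<dots> \<le> (\<integral>\<^sup>+x. ennreal (\<bar>u x * riesz \<alpha> f x\<bar> powr q * 1) \<partial>lebesgue)"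
    proof (rule nn_integral_mono_AE)
      show "AE x in lebesgue. ennreal ((\<kappa> * P) powr q) * (ennreal (v x) * indicator R x) \<le> ennreal (\<bar>u x * riesz \<alpha> f x\<bar> powr q * 1)"
        using conv[unfolded riesz_converges_ae_def] u_pos[unfolded ae_positive_def]
      proof eventually_elim
        case (elim x)
        show ?case
        proof (cases "x \<in> R")
          case True
          have "(\<kappa> * P) powr q \<le> \<bar>riesz \<alpha> f x\<bar> powr q"
            using low[OF True elim(1)] \<kappa> P q0 by (intro powr_mono2) auto
          then have "(\<kappa> * P) powr q * v x \<le> \<bar>riesz \<alpha> f x\<bar> powr q * v x"
            by (intro mult_right_mono) (auto simp: v_def)
          also have "\<dots> = \<bar>u x * riesz \<alpha> f x\<bar> powr q"
            using elim by (simp add: v_def abs_mult powr_mult mult.commute)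
          finally show ?thesis using True by (simp add: ennreal_mult'[symmetric] ennreal_leI)
        qed simp
      qed
    qed
    finally have "epow (ennreal (V * (\<kappa> * P) powr q)) (1 / q) \<le> lnorm q (\<lambda>x. u x * riesz \<alpha> f x)"
      unfolding wnorm_def using q0 by (intro epow_mono) auto
    also have "\<dots> \<le> ennreal c * (\<Prod>i\<in>UNIV. ennreal (S i powr (1 / p i)))" using bd by (simp only: lnorm)
    also have "\<dots> = ennreal (c * (\<Prod>i\<in>UNIV. S i powr (1 / p i)))"
      using c by (simp add: prod_ennreal ennreal_mult')
    finally have "V powr (1 / q) * (\<kappa> * P) \<le> c * (\<Prod>i\<in>UNIV. S i powr (1 / p i))"
      using V0 \<kappa> P q0 c by (simp add: epow_ennreal powr_mult powr_powr ennreal_le_iff prod_nonneg)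
    \<comment> \<open>Each \<open>S i\<close> is split into its share in the condition and its share
      in the norm. The latter cancels, being positive because the dual weight is positive almost
      everywhere and the rectangle has positive volume.\<close>
    moreover have "P = (\<Prod>i\<in>UNIV. S i powr (1 - 1 / p i)) * (\<Prod>i\<in>UNIV. S i powr (1 / p i))"
      unfolding P_def prod.distrib[symmetric] using S0[THEN less_imp_le] by (intro prod.cong refl) (simp add: powr_add[symmetric])
    ultimately have "(V powr (1 / q) * \<kappa> * (\<Prod>i\<in>UNIV. S i powr (1 - 1 / p i))) * (\<Prod>i\<in>UNIV. S i powr (1 / p i))
       \<le> c * (\<Prod>i\<in>UNIV. S i powr (1 / p i))" by (simp add: mult_ac)
    moreover have "(\<Prod>i\<in>UNIV. S i powr (1 / p i)) > 0"
      using S0 by (intro prod_pos) (simp add: less_imp_neq[THEN not_sym])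
    ultimately have le: "V powr (1 / q) * \<kappa> * (\<Prod>i\<in>UNIV. S i powr (1 - 1 / p i)) \<le> c"
      by (simp only: mult_le_cancel_right_pos)
    define cc where "cc = (\<Prod>s\<in>UNIV. l s powr (- \<beta> s))"
    have cc: "cc \<ge> 0" by (simp add: cc_def prod_nonneg)
    have "cc = (\<Prod>s\<in>UNIV. mn powr \<beta> s) * \<kappa>"
      unfolding cc_def \<kappa>_def prod.distrib[symmetric]
      using mn by (intro prod.cong refl) (simp add: powr_mult mult.assoc[symmetric] powr_add[symmetric])
    then have "cc * V powr (1 / q) * (\<Prod>i\<in>UNIV. S i powr (1 - 1 / p i))
       = (\<Prod>s\<in>UNIV. mn powr \<beta> s) * (V powr (1 / q) * \<kappa> * (\<Prod>i\<in>UNIV. S i powr (1 - 1 / p i)))" by (simp add: mult_ac)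
    also have "\<dots> \<le> (\<Prod>s\<in>UNIV. mn powr \<beta> s) * c" by (intro mult_left_mono le prod_nonneg) simp
    finally have T: "cc * V powr (1 / q) * (\<Prod>i\<in>UNIV. S i powr (1 - 1 / p i)) \<le> B" by (simp add: B_def mult.commute)
    have "(\<Prod>s\<in>UNIV. measure lebesgue (Q s) powr (\<alpha> s / real CARD('n) - real CARD('m))) = cc"
      unfolding cc_def \<beta>_def Ql by (intro prod.cong refl cube_volume_powr l)
    moreover have "epow (\<integral>\<^sup>+ x\<in>block_prod Q. ennreal (u x powr q) \<partial>lebesgue) (1 / q) = ennreal (V powr (1 / q))"
      unfolding v_def[symmetric] R_def[symmetric] V by (rule epow_ennreal[OF V0])
    moreover have "(\<Prod>i\<in>UNIV. epow (\<integral>\<^sup>+ y\<in>block_prod Q. ennreal (w i y powr (- conj_exp (p i))) \<partial>lebesgue) (1 / conj_exp (p i)))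
      = ennreal (\<Prod>i\<in>UNIV. S i powr (1 - 1 / p i))"
      unfolding \<sigma>_def[symmetric] R_def[symmetric] S conj_exp_facts(1)[OF p] epow_ennreal[OF less_imp_le[OF S0]]
      by (rule prod_ennreal) simp
    ultimately have "?T Q = ennreal (cc * V powr (1 / q) * (\<Prod>i\<in>UNIV. S i powr (1 - 1 / p i)))"
      using cc by (simp add: ennreal_mult prod_nonneg)
    then show ?thesis using T by (simp add: ennreal_leI)
  qed
  then have "(SUP Q\<in>{Q :: 'k \<Rightarrow> (real ^ 'n) set. \<forall>s. Q s \<in> cubes}. ?T Q) \<le> ennreal B"
    by (intro SUP_least) auto
  also have "\<dots> < \<infinity>" by simp
  finally show ?thesis .
qed

section \<open>The equivalence, from one reverse doubling constant for all weights\<close>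

theorem theorem3p7:
  fixes p :: "'m::finite \<Rightarrow> real"
    and p0 q :: real
    and \<alpha> :: "'k::finite \<Rightarrow> real"
    and u :: "real ^ 'n::finite ^ 'k \<Rightarrow> real"
    and w :: "'m \<Rightarrow> real ^ 'n ^ 'k \<Rightarrow> real"
    and W :: "'m \<Rightarrow> 'k \<Rightarrow> real ^ 'n \<Rightarrow> real"
  assumes k: "CARD('k) \<ge> 2"
    and p: "\<And>i. 1 < p i"
    and p0: "1 / p0 = (\<Sum>i\<in>UNIV. 1 / p i)"
    and q: "p0 < q"
    and \<alpha>: "\<And>s. 0 < \<alpha> s" "\<And>s. \<alpha> s < real CARD('m) * real CARD('n)"
    and u_pos: "ae_positive u"
    and w_pos: "\<And>i. ae_positive (w i)"
    and u_weight: "weight (\<lambda>x. u x powr q)"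
    and w_weight: "\<And>i. weight (\<lambda>x. w i x powr p i)"
    and W_pos: "\<And>i j. ae_positive (W i j)"
    and w_prod: "\<And>i x. w i x = (\<Prod>j\<in>UNIV. W i j (x $ j))"
    and W_RD: "\<And>i j. reverse_doubling (\<lambda>t. W i j t powr (- conj_exp (p i)))"
    and u_A_infty: "A_infty_separately (\<lambda>x. u x powr q)"
  shows
    "(\<exists>c>0. \<forall>f. (\<forall>i. f i \<in> wLp (p i) (\<lambda>x. w i x powr p i)) \<longrightarrow>
        riesz_converges_ae \<alpha> f \<and>
        lnorm q (\<lambda>x. u x * riesz \<alpha> f x)
          \<le> ennreal c * (\<Prod>i\<in>UNIV. lnorm (p i) (\<lambda>x. w i x * f i x)))
     \<longleftrightarrow>
     (SUP Q\<in>{Q :: 'k \<Rightarrow> (real ^ 'n) set. \<forall>s. Q s \<in> cubes}.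
        ennreal (\<Prod>s\<in>UNIV. measure lebesgue (Q s) powr (\<alpha> s / real CARD('n) - real CARD('m))) *
        epow (\<integral>\<^sup>+ x\<in>block_prod Q. ennreal (u x powr q) \<partial>lebesgue) (1 / q) *
        (\<Prod>i\<in>UNIV. epow (\<integral>\<^sup>+ y\<in>block_prod Q. ennreal (w i y powr (- conj_exp (p i))) \<partial>lebesgue)
                          (1 / conj_exp (p i)))) < \<infinity>"
proof -
  have q0: "q > 0" using Holder_exponent_pos[OF p p0] q by simp
  have \<sigma>_weight: "weight (\<lambda>x. w i x powr (- conj_exp (p i)))" for i
    by (rule product_dual_weight(1)[where r="p i" and w="w i" and W="W i"])
      (use p w_prod w_pos w_weight W_RD in auto)
  have "\<exists>d>1. \<forall>i. rect_rd d (\<lambda>x. w i x powr (- conj_exp (p i)))"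
  proof (rule uniform_constant)
    show "\<exists>d>1. rect_rd d (\<lambda>x. w i x powr (- conj_exp (p i)))" for i
      by (rule product_dual_weight(2)[where r="p i" and w="w i" and W="W i"])
        (use p w_prod w_pos w_weight W_RD in auto)
  qed (rule rect_rd_mono)
  then obtain d\<^sub>1 where d1: "d\<^sub>1 > 1" "\<And>i. rect_rd d\<^sub>1 (\<lambda>x. w i x powr (- conj_exp (p i)))" by blast
  obtain d\<^sub>2 where d2: "d\<^sub>2 > 1" "rect_rd d\<^sub>2 (\<lambda>x. u x powr q)"
    using rect_rd_A_infty[OF u_A_infty] u_weight by (auto simp: weight_def)
  \<comment> \<open>Reverse doubling with a constant implies it with any smaller one, so the minimum
    serves \<open>u\<close> and all dual weights at once.\<close>
  define d where "d = min d\<^sub>1 d\<^sub>2"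
  have d: "d > 1" "rect_rd d (\<lambda>x. u x powr q)" "\<And>i. rect_rd d (\<lambda>x. w i x powr (- conj_exp (p i)))"
    using d1(1) d2(1) rect_rd_mono[OF d1(2)] rect_rd_mono[OF d2(2)] by (auto simp: d_def)
  show ?thesis
  proof (intro iffI)
    assume "\<exists>c>0. \<forall>f. (\<forall>i. f i \<in> wLp (p i) (\<lambda>x. w i x powr p i)) \<longrightarrow>
        riesz_converges_ae \<alpha> f \<and>
        lnorm q (\<lambda>x. u x * riesz \<alpha> f x)
          \<le> ennreal c * (\<Prod>i\<in>UNIV. lnorm (p i) (\<lambda>x. w i x * f i x))"
    then obtain c where "c > 0" "\<And>f. (\<forall>i. f i \<in> wLp (p i) (\<lambda>x. w i x powr p i)) \<Longrightarrow>
        riesz_converges_ae \<alpha> f \<and>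
        lnorm q (\<lambda>x. u x * riesz \<alpha> f x)
          \<le> ennreal c * (\<Prod>i\<in>UNIV. lnorm (p i) (\<lambda>x. w i x * f i x))" by blast
    then show "(SUP Q\<in>{Q :: 'k \<Rightarrow> (real ^ 'n) set. \<forall>s. Q s \<in> cubes}.
        ennreal (\<Prod>s\<in>UNIV. measure lebesgue (Q s) powr (\<alpha> s / real CARD('n) - real CARD('m))) *
        epow (\<integral>\<^sup>+ x\<in>block_prod Q. ennreal (u x powr q) \<partial>lebesgue) (1 / q) *
        (\<Prod>i\<in>UNIV. epow (\<integral>\<^sup>+ y\<in>block_prod Q. ennreal (w i y powr (- conj_exp (p i))) \<partial>lebesgue)
                          (1 / conj_exp (p i)))) < \<infinity>"
      by (rule potential_bounded_imp_condition[OF p q0 \<alpha>(2) u_pos w_pos u_weight \<sigma>_weight])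
  qed (rule potential_bounded[OF p p0 q \<alpha>(2) u_pos w_pos u_weight w_weight \<sigma>_weight d])
qed

end
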